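(* For sets $\Gamma,\Delta$ and bornologies $\mathcal{F},\mathcal{G}$ on $\Gamma$ and $\Delta$ respectively, one has $$\mathrm{Hom}\big(\mathbf{k}[\Gamma;\mathcal{F}],\mathbf{k}[\Delta;\mathcal{G}]\big)\cong\mathbf{k}[\Gamma\times\Delta;(\mathcal{F}\to\mathcal{G})].$$ Here $\mathcal{F}\to\mathcal{G}$ is the bornology on $\Gamma\times\Delta$ consisting of those $S\subseteq\Gamma\times\Delta$ such that for every $F\in\mathcal{F}$ there is a $G\in\mathcal{G}$ such that $S\cap(F\times\Delta)\subseteq F\times G$ and $S\cap(F\times\Delta)$ has finite fibers over $G$ (i.e. for each $g\in G$ the set $\{\gamma\in F:(\gamma,g)\in S\}$ is finite).
   Context: Fix a field $\mathbf{k}$ and a (non-trivial) Grothendieck universe; sets in it are small; all index sets are small. $\mathrm{Vect}$ is the category of small $\mathbf{k}$-vector spaces, $[\mathrm{Vect},\mathrm{Vect}]$ the category of $\mathbf{k}$-additive functors (acting $\mathbf{k}$-linearly on hom-spaces) and natural transformations, $\mathbb{Y}V:=\mathrm{Vect}(V,-)$. $\mathrm{Ind}\text{-}(\mathrm{Vect}^{\mathrm{op}})$ is the full subcategory of $[\mathrm{Vect},\mathrm{Vect}]$ on the small functors, i.e. those isomorphic to a colimit, over a small directed poset, of representables. A bornology on a set $\Gamma$ is (identified with) an ideal $\mathcal{F}$ of subsets of $\Gamma$ (closed under subsets and finite unions) containing all finite subsets. $\mathbf{k}[\Gamma;\mathcal{F}]\in\mathrm{Ind}\text{-}(\mathrm{Vect}^{\mathrm{op}})$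 is the functor $V\mapsto\bigcup_{F\in\mathcal{F}}V^F\subseteq V^\Gamma$, i.e. the functions $\Gamma\to V$ whose support belongs to $\mathcal{F}$. $\mathrm{Hom}(X,-)$ is the right adjoint of $X\hat\otimes-$ on $\mathrm{Ind}\text{-}(\mathrm{Vect}^{\mathrm{op}})$, where $(X\hat\otimes Y)(V)\cong\int^{H_0}\int^{H_1}X(H_0)\otimes Y(H_1)\otimes\mathrm{Vect}(H_0\otimes H_1,V)$. Concretely $\mathrm{Hom}(X,Y)(V)$ is the space of natural transformations from $X$ to $Y(-\otimes V)$. *)

theory Defs
  imports "Jordan_Normal_Form.Missing_VectorSpace" "HOL-Library.FuncSet"
begin

section \<open>Small sets\<close>

text \<open>
  A Grothendieck universe is given by the type \<open>'u\<close> of its members together with the map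
  \<open>elts\<close> sending a member to the set of its elements. Transitivity is built into the typing,
  and the universe is nonempty because types are. No infinite member is required.
\<close>

locale grothendieck_universe =
  fixes elts :: "'u \<Rightarrow> 'u set"
  assumes extensionality: "inj elts"
    and pairing: "\<And>x y. \<exists>z. elts z = {x, y}"
    and power: "\<And>x. \<exists>p. elts ` elts p = Pow (elts x)"
    and union: "\<And>x f. \<exists>z. elts z = (\<Union>i\<in>elts x. elts (f i))"

text \<open>A set of arbitrary type is small if it is in bijection with a member of the universe.\<close>

definition small :: "('u \<Rightarrow> 'u set) \<Rightarrow> 'a set \<Rightarrow> bool" where
  "small elts A \<longleftrightarrow> (\<exists>x f. inj_on f A \<and> f ` A = elts x)"


section \<open>Small vector spaces\<close>

text \<open>
  The \<open>mult\<close> and \<open>one\<close> fields of a \<open>module\<close> record carry no meaning. Records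
  that differ only there are distinct but isomorphic objects.
\<close>

definition Vect :: "'k ring \<Rightarrow> ('u \<Rightarrow> 'u set) \<Rightarrow> ('k, 'u) module set" where
  "Vect K elts = {V. vectorspace K V \<and> carrier V \<in> range elts}"

text \<open>The set \<open>A\<close> of families in the product of the \<open>M i\<close>, with pointwise operations.\<close>

definition pointwise ::
    "'i set \<Rightarrow> ('i \<Rightarrow> ('k, 'm) module) \<Rightarrow> ('i \<Rightarrow> 'm) set \<Rightarrow> ('k, 'i \<Rightarrow> 'm) module" where
  "pointwise I M A =
    \<lparr>carrier = A,
     mult = undefined,
     one = undefined,
     zero = (\<lambda>i\<in>I. \<zero>\<^bsub>M i\<^esub>),
     add = (\<lambda>f g. \<lambda>i\<in>I. f i \<oplus>\<^bsub>M i\<^esub> g i),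
     smult = (\<lambda>c f. \<lambda>i\<in>I. c \<odot>\<^bsub>M i\<^esub> f i)\<rparr>"

text \<open>
  Maps are kept \<^const>\<open>extensional\<close> so that equality of morphisms is equality of functions.
  Composition is \<^const>\<open>compose\<close>, with the domain as first argument.
\<close>

definition Lin :: "'k ring \<Rightarrow> ('k, 'v) module \<Rightarrow> ('k, 'w) module \<Rightarrow> ('k, 'v \<Rightarrow> 'w) module" where
  "Lin K V W = pointwise (carrier V) (\<lambda>_. W) (module_hom K V W \<inter> extensional (carrier V))"

definition lin_id :: "('k, 'v) module \<Rightarrow> 'v \<Rightarrow> 'v" where
  "lin_id V = (\<lambda>v\<in>carrier V. v)"


section \<open>Tensor products\<close>

definition bilinear_maps ::
    "'k ring \<Rightarrow> ('k, 'v) module \<Rightarrow> ('k, 'w) module \<Rightarrow> ('k, 'z) module \<Rightarrow> ('v \<Rightarrow> 'w \<Rightarrow> 'z) set" where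
  "bilinear_maps K V W Z =
    {b. (\<forall>v\<in>carrier V. b v \<in> module_hom K W Z) \<and>
        (\<forall>w\<in>carrier W. (\<lambda>v. b v w) \<in> module_hom K V Z)}"

definition is_tensor_product ::
    "'k ring \<Rightarrow> ('u \<Rightarrow> 'u set) \<Rightarrow> ('k, 'u) module \<Rightarrow> ('k, 'u) module \<Rightarrow>
     ('k, 'u) module \<Rightarrow> ('u \<Rightarrow> 'u \<Rightarrow> 'u) \<Rightarrow> bool" where
  "is_tensor_product K elts V W T t \<longleftrightarrow>
    T \<in> Vect K elts \<and> t \<in> bilinear_maps K V W T \<and>
    (\<forall>Z\<in>Vect K elts. \<forall>b\<in>bilinear_maps K V W Z.
      \<exists>!h. h \<in> carrier (Lin K T Z) \<and>
           (\<forall>v\<in>carrier V. \<forall>w\<in>carrier W. h (t v w) = b v w))"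

definition tensor_choice ::
    "'k ring \<Rightarrow> ('u \<Rightarrow> 'u set) \<Rightarrow> ('k, 'u) module \<Rightarrow> ('k, 'u) module \<Rightarrow>
     ('k, 'u) module \<times> ('u \<Rightarrow> 'u \<Rightarrow> 'u)" where
  "tensor_choice K elts V W = (SOME p. is_tensor_product K elts V W (fst p) (snd p))"

definition tensor ::
    "'k ring \<Rightarrow> ('u \<Rightarrow> 'u set) \<Rightarrow> ('k, 'u) module \<Rightarrow> ('k, 'u) module \<Rightarrow> ('k, 'u) module" where
  "tensor K elts V W = fst (tensor_choice K elts V W)"

definition pure_tensor ::
    "'k ring \<Rightarrow> ('u \<Rightarrow> 'u set) \<Rightarrow> ('k, 'u) module \<Rightarrow> ('k, 'u) module \<Rightarrow> 'u \<Rightarrow> 'u \<Rightarrow> 'u" where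
  "pure_tensor K elts V W = snd (tensor_choice K elts V W)"

text \<open>The map \<open>f \<otimes> g\<close> from \<open>V \<otimes> W\<close> to \<open>V' \<otimes> W'\<close>.\<close>

definition tensor_map ::
    "'k ring \<Rightarrow> ('u \<Rightarrow> 'u set) \<Rightarrow> ('k, 'u) module \<Rightarrow> ('k, 'u) module \<Rightarrow>
     ('k, 'u) module \<Rightarrow> ('k, 'u) module \<Rightarrow> ('u \<Rightarrow> 'u) \<Rightarrow> ('u \<Rightarrow> 'u) \<Rightarrow> 'u \<Rightarrow> 'u" where
  "tensor_map K elts V W V' W' f g =
    (THE h. h \<in> carrier (Lin K (tensor K elts V W) (tensor K elts V' W')) \<and>
            (\<forall>v\<in>carrier V. \<forall>w\<in>carrier W.
               h (pure_tensor K elts V W v w) = pure_tensor K elts V' W' (f v) (g w)))"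


section \<open>Functors on small vector spaces\<close>

text \<open>
  The values of a functor may have carriers of any type \<open>'c\<close>, but they must be small sets.
  Hence every such functor is isomorphic to one with values literally in \<^const>\<open>Vect\<close>.
\<close>

record ('k, 'u, 'c) vfunctor =
  fobj :: "('k, 'u) module \<Rightarrow> ('k, 'c) module"
  farr :: "('k, 'u) module \<Rightarrow> ('k, 'u) module \<Rightarrow> ('u \<Rightarrow> 'u) \<Rightarrow> 'c \<Rightarrow> 'c"

definition is_vfunctor :: "'k ring \<Rightarrow> ('u \<Rightarrow> 'u set) \<Rightarrow> ('k, 'u, 'c) vfunctor \<Rightarrow> bool" where
  "is_vfunctor K elts X \<longleftrightarrow>
    (\<forall>V\<in>Vect K elts. vectorspace K (fobj X V) \<and> small elts (carrier (fobj X V))) \<and>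
    (\<forall>V\<in>Vect K elts. \<forall>W\<in>Vect K elts.
       farr X V W \<in> module_hom K (Lin K V W) (Lin K (fobj X V) (fobj X W))) \<and>
    (\<forall>V\<in>Vect K elts. farr X V V (lin_id V) = lin_id (fobj X V)) \<and>
    (\<forall>U\<in>Vect K elts. \<forall>V\<in>Vect K elts. \<forall>W\<in>Vect K elts.
       \<forall>f\<in>carrier (Lin K U V). \<forall>g\<in>carrier (Lin K V W).
         farr X U W (compose (carrier U) g f) =
         compose (carrier (fobj X U)) (farr X V W g) (farr X U V f))"

definition Nat ::
    "'k ring \<Rightarrow> ('u \<Rightarrow> 'u set) \<Rightarrow> ('k, 'u, 'c) vfunctor \<Rightarrow> ('k, 'u, 'd) vfunctor \<Rightarrow>
     ('k, ('k, 'u) module \<Rightarrow> 'c \<Rightarrow> 'd) module" where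
  "Nat K elts X Y =
    pointwise (Vect K elts) (\<lambda>V. Lin K (fobj X V) (fobj Y V))
      {\<eta> \<in> \<Pi>\<^sub>E V\<in>Vect K elts. carrier (Lin K (fobj X V) (fobj Y V)).
         \<forall>V\<in>Vect K elts. \<forall>W\<in>Vect K elts. \<forall>f\<in>carrier (Lin K V W).
           compose (carrier (fobj X V)) (\<eta> W) (farr X V W f) =
           compose (carrier (fobj X V)) (farr Y V W f) (\<eta> V)}"

definition nat_id ::
    "'k ring \<Rightarrow> ('u \<Rightarrow> 'u set) \<Rightarrow> ('k, 'u, 'c) vfunctor \<Rightarrow> ('k, 'u) module \<Rightarrow> 'c \<Rightarrow> 'c" where
  "nat_id K elts X = (\<lambda>V\<in>Vect K elts. lin_id (fobj X V))"

text \<open>Here \<open>X\<close> is the source of \<open>\<eta>\<close>.\<close>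

definition nat_comp ::
    "'k ring \<Rightarrow> ('u \<Rightarrow> 'u set) \<Rightarrow> ('k, 'u, 'c) vfunctor \<Rightarrow>
     (('k, 'u) module \<Rightarrow> 'd \<Rightarrow> 'e) \<Rightarrow> (('k, 'u) module \<Rightarrow> 'c \<Rightarrow> 'd) \<Rightarrow>
     ('k, 'u) module \<Rightarrow> 'c \<Rightarrow> 'e" where
  "nat_comp K elts X \<theta> \<eta> = (\<lambda>V\<in>Vect K elts. compose (carrier (fobj X V)) (\<theta> V) (\<eta> V))"


section \<open>Ind-objects\<close>

definition representable :: "'k ring \<Rightarrow> ('k, 'u) module \<Rightarrow> ('k, 'u, 'u \<Rightarrow> 'u) vfunctor" where
  "representable K V =
    \<lparr>fobj = (\<lambda>W. Lin K V W),
     farr = (\<lambda>W W' f. \<lambda>g\<in>carrier (Lin K V W). compose (carrier V) f g)\<rparr>"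

definition directed_poset :: "'i set \<Rightarrow> ('i \<times> 'i) set \<Rightarrow> bool" where
  "directed_poset I r \<longleftrightarrow>
    I \<noteq> {} \<and> r \<subseteq> I \<times> I \<and> partial_order_on I r \<and>
    (\<forall>i\<in>I. \<forall>j\<in>I. \<exists>l\<in>I. (i, l) \<in> r \<and> (j, l) \<in> r)"

definition is_diagram ::
    "'k ring \<Rightarrow> ('u \<Rightarrow> 'u set) \<Rightarrow> 'i set \<Rightarrow> ('i \<times> 'i) set \<Rightarrow> ('i \<Rightarrow> ('k, 'u, 'c) vfunctor) \<Rightarrow>
     ('i \<Rightarrow> 'i \<Rightarrow> ('k, 'u) module \<Rightarrow> 'c \<Rightarrow> 'c) \<Rightarrow> bool" where
  "is_diagram K elts I r D \<tau> \<longleftrightarrow>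
    (\<forall>i\<in>I. is_vfunctor K elts (D i)) \<and>
    (\<forall>i j. (i, j) \<in> r \<longrightarrow> \<tau> i j \<in> carrier (Nat K elts (D i) (D j))) \<and>
    (\<forall>i\<in>I. \<tau> i i = nat_id K elts (D i)) \<and>
    (\<forall>i j l. (i, j) \<in> r \<longrightarrow> (j, l) \<in> r \<longrightarrow> \<tau> i l = nat_comp K elts (D i) (\<tau> j l) (\<tau> i j))"

definition is_cocone ::
    "'k ring \<Rightarrow> ('u \<Rightarrow> 'u set) \<Rightarrow> 'i set \<Rightarrow> ('i \<times> 'i) set \<Rightarrow> ('i \<Rightarrow> ('k, 'u, 'c) vfunctor) \<Rightarrow>
     ('i \<Rightarrow> 'i \<Rightarrow> ('k, 'u) module \<Rightarrow> 'c \<Rightarrow> 'c) \<Rightarrow>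
     ('k, 'u, 'd) vfunctor \<Rightarrow> ('i \<Rightarrow> ('k, 'u) module \<Rightarrow> 'c \<Rightarrow> 'd) \<Rightarrow> bool" where
  "is_cocone K elts I r D \<tau> Z \<mu> \<longleftrightarrow>
    (\<forall>i\<in>I. \<mu> i \<in> carrier (Nat K elts (D i) Z)) \<and>
    (\<forall>i j. (i, j) \<in> r \<longrightarrow> \<mu> i = nat_comp K elts (D i) (\<mu> j) (\<tau> i j))"

text \<open>
  The universal property is tested on functors with carriers of values in \<open>'u\<close>, which suffices
  since every functor is isomorphic to one of these.
\<close>

definition is_colimit ::
    "'k ring \<Rightarrow> ('u \<Rightarrow> 'u set) \<Rightarrow> 'i set \<Rightarrow> ('i \<times> 'i) set \<Rightarrow> ('i \<Rightarrow> ('k, 'u, 'c) vfunctor) \<Rightarrow>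
     ('i \<Rightarrow> 'i \<Rightarrow> ('k, 'u) module \<Rightarrow> 'c \<Rightarrow> 'c) \<Rightarrow>
     ('k, 'u, 'd) vfunctor \<Rightarrow> ('i \<Rightarrow> ('k, 'u) module \<Rightarrow> 'c \<Rightarrow> 'd) \<Rightarrow> bool" where
  "is_colimit K elts I r D \<tau> X \<kappa> \<longleftrightarrow>
    is_vfunctor K elts X \<and> is_cocone K elts I r D \<tau> X \<kappa> \<and>
    (\<forall>(Z :: ('k, 'u, 'u) vfunctor) \<mu>.
       is_vfunctor K elts Z \<longrightarrow> is_cocone K elts I r D \<tau> Z \<mu> \<longrightarrow>
       (\<exists>!\<theta>. \<theta> \<in> carrier (Nat K elts X Z) \<and>
             (\<forall>i\<in>I. nat_comp K elts (D i) \<theta> (\<kappa> i) = \<mu> i)))"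

definition is_ind_object :: "'k ring \<Rightarrow> ('u \<Rightarrow> 'u set) \<Rightarrow> ('k, 'u, 'c) vfunctor \<Rightarrow> bool" where
  "is_ind_object K elts X \<longleftrightarrow>
    (\<exists>I \<in> range elts. \<exists>r H \<tau> \<kappa>.
       directed_poset I r \<and> (\<forall>i\<in>I. H i \<in> Vect K elts) \<and>
       is_diagram K elts I r (\<lambda>i. representable K (H i)) \<tau> \<and>
       is_colimit K elts I r (\<lambda>i. representable K (H i)) \<tau> X \<kappa>)"

definition ind_isomorphic ::
    "'k ring \<Rightarrow> ('u \<Rightarrow> 'u set) \<Rightarrow> ('k, 'u, 'c) vfunctor \<Rightarrow> ('k, 'u, 'd) vfunctor \<Rightarrow> bool" where
  "ind_isomorphic K elts X Y \<longleftrightarrow>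
    is_ind_object K elts X \<and> is_ind_object K elts Y \<and>
    (\<exists>\<eta>\<in>carrier (Nat K elts X Y). \<exists>\<epsilon>\<in>carrier (Nat K elts Y X).
       nat_comp K elts X \<epsilon> \<eta> = nat_id K elts X \<and>
       nat_comp K elts Y \<eta> \<epsilon> = nat_id K elts Y)"


section \<open>Internal Hom\<close>

text \<open>The functor \<open>Y(- \<otimes> V)\<close>.\<close>

definition tensor_shift ::
    "'k ring \<Rightarrow> ('u \<Rightarrow> 'u set) \<Rightarrow> ('k, 'u, 'c) vfunctor \<Rightarrow> ('k, 'u) module \<Rightarrow>
     ('k, 'u, 'c) vfunctor" where
  "tensor_shift K elts Y V =
    \<lparr>fobj = (\<lambda>W. fobj Y (tensor K elts W V)),
     farr = (\<lambda>W W' f. farr Y (tensor K elts W V) (tensor K elts W' V)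
                        (tensor_map K elts W V W' V f (lin_id V)))\<rparr>"

text \<open>
  The value at \<open>V\<close> is the space of natural transformations from \<open>X\<close> to \<open>Y(- \<otimes> V)\<close>, and a
  linear map \<open>g\<close> acts by composition with \<open>Y(- \<otimes> g)\<close>. This is the explicit form of the right adjoint of
  the completed (Day convolution) tensor product with \<open>X\<close>.
\<close>

definition ind_Hom ::
    "'k ring \<Rightarrow> ('u \<Rightarrow> 'u set) \<Rightarrow> ('k, 'u, 'c) vfunctor \<Rightarrow> ('k, 'u, 'd) vfunctor \<Rightarrow>
     ('k, 'u, ('k, 'u) module \<Rightarrow> 'c \<Rightarrow> 'd) vfunctor" where
  "ind_Hom K elts X Y =
    \<lparr>fobj = (\<lambda>V. Nat K elts X (tensor_shift K elts Y V)),
     farr = (\<lambda>V V' g. \<lambda>\<eta>\<in>carrier (Nat K elts X (tensor_shift K elts Y V)).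
               nat_comp K elts X
                 (\<lambda>W. farr Y (tensor K elts W V) (tensor K elts W V')
                        (tensor_map K elts W V W V' (lin_id W) g)) \<eta>)\<rparr>"


section \<open>Bornologies\<close>

definition bornology :: "'a set \<Rightarrow> 'a set set \<Rightarrow> bool" where
  "bornology \<Gamma> \<F> \<longleftrightarrow>
    \<F> \<subseteq> Pow \<Gamma> \<and>
    (\<forall>S\<in>\<F>. \<forall>T. T \<subseteq> S \<longrightarrow> T \<in> \<F>) \<and>
    (\<forall>S\<in>\<F>. \<forall>T\<in>\<F>. S \<union> T \<in> \<F>) \<and>
    (\<forall>S. S \<subseteq> \<Gamma> \<longrightarrow> finite S \<longrightarrow> S \<in> \<F>)"

text \<open>The functor \<open>k[\<Gamma>;\<F>]\<close>.\<close>

definition born_functor :: "'a set \<Rightarrow> 'a set set \<Rightarrow> ('k, 'u, 'a \<Rightarrow> 'u) vfunctor" where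
  "born_functor \<Gamma> \<F> =
    (let X = (\<lambda>V. pointwise \<Gamma> (\<lambda>_. V)
               {\<phi> \<in> \<Gamma> \<rightarrow>\<^sub>E carrier V. {\<gamma>\<in>\<Gamma>. \<phi> \<gamma> \<noteq> \<zero>\<^bsub>V\<^esub>} \<in> \<F>})
     in \<lparr>fobj = X, farr = (\<lambda>V W f. \<lambda>\<phi>\<in>carrier (X V). \<lambda>\<gamma>\<in>\<Gamma>. f (\<phi> \<gamma>))\<rparr>)"

definition bornology_fun ::
    "'a set \<Rightarrow> 'a set set \<Rightarrow> 'b set \<Rightarrow> 'b set set \<Rightarrow> ('a \<times> 'b) set set" where
  "bornology_fun \<Gamma> \<F> \<Delta> \<G> =
    {S. S \<subseteq> \<Gamma> \<times> \<Delta> \<and>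
        (\<forall>F\<in>\<F>. \<exists>G\<in>\<G>. S \<inter> (F \<times> \<Delta>) \<subseteq> F \<times> G \<and>
                       (\<forall>g\<in>G. finite {\<gamma>\<in>F. (\<gamma>, g) \<in> S}))}"

end

(*
  A natural transformation eta from k[Gamma;F] to k[Delta;G](- (x) V) is determined, by Yoneda, by its
  values at the generic families (e_g)_{g in F} over the free spaces k^(F), for F in the bornology of
  Gamma. Such a value is a family of tensors in k^(F) (x) V indexed by Delta; its expansion
  sum_g e_g (x) phi(g, d) has finitely many terms for each d and vanishes for d outside some G, which
  is precisely the condition that the support of phi lies in (F -> G). Conversely such a phi acts by
  psi |-> sum_g psi(g) (x) phi(g, -).

  The universe need not contain an infinite set, so free spaces and tensor products are built from
  finitely supported functions and power sets only, and then copied into the universe.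
*)

theory Submission
  imports Defs
begin

section \<open>Small sets\<close>

context grothendieck_universe
begin

text \<open>The comparison map runs from the bornological functor on
  \<open>\<Gamma> \<times> \<Delta>\<close> into the internal Hom, the direction that has a formula.
  The Hom side is awkward on its own: its elements are families indexed by all small spaces, and its
  values come with no visible bound on their size. That they are small vector spaces depending
  functorially on \<open>V\<close>, and that they form an Ind-object, is therefore carried over
  along the bijections once these are established. Yoneda gives a family of tensors for each
  \<open>F\<close> separately, over a free space chosen for that \<open>F\<close>. That all of them
  come from one function \<open>\<phi>\<close> is naturality along the coordinate projections onto
  singletons. Tensor products are arbitrary choices, known only by their universal property against
  small spaces. The coefficients of a tensor are hence values of linear maps obtained from that
  property, and are not read off a decomposition into pure tensors. Colimits enter only as directed
  unions: the cocones that occur are injective and jointly surjective, which already yields the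
  universal property.\<close>

lemma subset_of_elts_in_range:
  assumes "A \<subseteq> elts x" shows "A \<in> range elts"
proof -
  obtain p where "elts ` elts p = Pow (elts x)" using power by blast
  then have "A \<in> elts ` elts p" using assms by simp
  then show ?thesis by blast
qed

text \<open>This is replacement: the image is a union of singletons, which are instances of
  pairing.\<close>

lemma image_elts_in_range: "g ` elts x \<in> range elts"
proof -
  have "\<exists>z. elts z = {a}" for a using pairing[of a a] by simp
  then obtain s where s: "\<And>a. elts (s a) = {a}" by metis
  obtain z where "elts z = (\<Union>i\<in>elts x. elts (s (g i)))"
    using union[where x = x and f = "\<lambda>i. s (g i)"] by auto
  then have "elts z = g ` elts x" using s by auto
  then show ?thesis by (metis rangeI)
qed

lemma small_iff_bij_betw: "small elts A \<longleftrightarrow> (\<exists>x f. bij_betw f A (elts x))"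
  unfolding small_def bij_betw_def by blast

lemma small_elts: "small elts (elts x)"
  unfolding small_def by (intro exI[of _ x] exI[of _ id]) simp

text \<open>Smallness is mostly proved in this form below: an injection into a small set is enough,
  no bijection with a member of the universe has to be exhibited.\<close>

lemma small_inj_on:
  assumes "inj_on f A" "f ` A \<subseteq> B" "small elts B"
  shows "small elts A"
proof -
  obtain x g where g: "inj_on g B" "g ` B = elts x" using assms(3) unfolding small_def by blast
  have "(g \<circ> f) ` A \<subseteq> elts x" using assms(2) g(2) by auto
  then have "(g \<circ> f) ` A \<in> range elts" by (rule subset_of_elts_in_range)
  moreover have "inj_on (g \<circ> f) A"
    using assms(1,2) g(1) by (meson comp_inj_on inj_on_subset)
  ultimately show ?thesis unfolding small_def by blast
qed

lemma small_subset: "small elts B \<Longrightarrow> A \<subseteq> B \<Longrightarrow> small elts A"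
  using small_inj_on[of id A B] by auto

text \<open>A choice of preimages injects the image back into \<open>A\<close>.\<close>

lemma small_image: "small elts A \<Longrightarrow> small elts (f ` A)"
  by (rule small_inj_on[of "inv_into A f"]) (auto simp: inj_on_inv_into inv_into_into)

lemma small_Pow:
  assumes "small elts A" shows "small elts (Pow A)"
proof -
  obtain x f where f: "inj_on f A" "f ` A = elts x" using assms unfolding small_def by blast
  obtain p where p: "elts ` elts p = Pow (elts x)" using power by blast
  have "inj_on ((`) f) (Pow A)" using f(1) by (auto simp: inj_on_def inj_on_image_eq_iff)
  moreover have "(`) f ` Pow A \<subseteq> elts ` elts p" using f(2) unfolding p by blast
  ultimately show ?thesis using small_image[OF small_elts] by (rule small_inj_on)
qed

text \<open>Pairs are coded inside the universe in the manner of Kuratowski, by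
  \<open>k a b\<close>. The codes with a fixed first entry form a member by replacement, and the
  union axiom collects these over all first entries.\<close>

lemma small_Times:
  assumes "small elts A" "small elts B" shows "small elts (A \<times> B)"
proof -
  obtain x f where f: "inj_on f A" "f ` A = elts x" using assms unfolding small_def by blast
  obtain y g where g: "inj_on g B" "g ` B = elts y" using assms unfolding small_def by blast
  obtain p where p: "\<And>a b. elts (p a b) = {a, b}" using pairing by metis
  define k where "k a b = p (p a a) (p a b)" for a b
  have k: "k a b = k c d \<longleftrightarrow> a = c \<and> b = d" for a b c d
  proof
    assume "k a b = k c d"
    then have "{p a a, p a b} = {p c c, p c d}" using p unfolding k_def by metis
    then have "{{a}, {a, b}} = {{c}, {c, d}}"
      using p[of a a] p[of a b] p[of c c] p[of c d]
      by (metis image_empty image_insert insert_absorb2)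
    then show "a = c \<and> b = d" by (auto simp: doubleton_eq_iff)
  qed simp
  have "\<exists>h. elts h = k a ` elts y" for a
    using image_elts_in_range[of "k a" y] by (elim rangeE) (rule exI, rule sym)
  then obtain h where h: "\<And>a. elts (h a) = k a ` elts y" by metis
  obtain z where z: "elts z = (\<Union>a\<in>elts x. elts (h a))" using union by blast
  show ?thesis
  proof (rule small_inj_on)
    show "inj_on (\<lambda>(a, b). k (f a) (g b)) (A \<times> B)"
      using f(1) g(1) by (auto simp: inj_on_def k)
    show "(\<lambda>(a, b). k (f a) (g b)) ` (A \<times> B) \<subseteq> elts z"
      unfolding z h f(2)[symmetric] g(2)[symmetric] by auto
  qed (rule small_elts)
qed

text \<open>An extensional function is determined by its graph, a subset of
  \<open>A \<times> B\<close>.\<close>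

lemma small_PiE:
  assumes "small elts A" "small elts B" shows "small elts (A \<rightarrow>\<^sub>E B)"
proof (rule small_inj_on)
  show "inj_on (\<lambda>f. (\<lambda>a. (a, f a)) ` A) (A \<rightarrow>\<^sub>E B)"
  proof (rule inj_onI)
    fix f g assume fg: "f \<in> A \<rightarrow>\<^sub>E B" "g \<in> A \<rightarrow>\<^sub>E B" "(\<lambda>a. (a, f a)) ` A = (\<lambda>a. (a, g a)) ` A"
    show "f = g" using fg(1,2)
    proof (rule PiE_ext)
      fix a assume "a \<in> A"
      then have "(a, f a) \<in> (\<lambda>a. (a, g a)) ` A" using fg(3) by blast
      then show "f a = g a" by auto
    qed
  qed
  show "(\<lambda>f. (\<lambda>a. (a, f a)) ` A) ` (A \<rightarrow>\<^sub>E B) \<subseteq> Pow (A \<times> B)" by auto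
qed (intro small_Pow small_Times assms)

end


section \<open>Linear algebra\<close>

lemma vectorspace_field: "vectorspace K V \<Longrightarrow> field K"
  by (simp add: vectorspace_def)

text \<open>The axioms are taken out of the locale so that those of several spaces can be used side
  by side, each instance selected by \<open>OF\<close>.\<close>

lemma
  assumes "vectorspace K V"
  shows vs_zero_closed: "\<zero>\<^bsub>V\<^esub> \<in> carrier V"
    and vs_add_closed: "\<And>x y. x \<in> carrier V \<Longrightarrow> y \<in> carrier V \<Longrightarrow> x \<oplus>\<^bsub>V\<^esub> y \<in> carrier V"
    and vs_smult_closed:
      "\<And>a x. a \<in> carrier K \<Longrightarrow> x \<in> carrier V \<Longrightarrow> a \<odot>\<^bsub>V\<^esub> x \<in> carrier V"
    and vs_add_assoc: "\<And>x y z. x \<in> carrier V \<Longrightarrow> y \<in> carrier V \<Longrightarrow> z \<in> carrier V \<Longrightarrow>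
       x \<oplus>\<^bsub>V\<^esub> y \<oplus>\<^bsub>V\<^esub> z = x \<oplus>\<^bsub>V\<^esub> (y \<oplus>\<^bsub>V\<^esub> z)"
    and vs_add_comm:
      "\<And>x y. x \<in> carrier V \<Longrightarrow> y \<in> carrier V \<Longrightarrow> x \<oplus>\<^bsub>V\<^esub> y = y \<oplus>\<^bsub>V\<^esub> x"
    and vs_zero_add: "\<And>x. x \<in> carrier V \<Longrightarrow> \<zero>\<^bsub>V\<^esub> \<oplus>\<^bsub>V\<^esub> x = x"
    and vs_smult_l_distr: "\<And>a b x. a \<in> carrier K \<Longrightarrow> b \<in> carrier K \<Longrightarrow> x \<in> carrier V \<Longrightarrow>
       (a \<oplus>\<^bsub>K\<^esub> b) \<odot>\<^bsub>V\<^esub> x = a \<odot>\<^bsub>V\<^esub> x \<oplus>\<^bsub>V\<^esub> b \<odot>\<^bsub>V\<^esub> x"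
    and vs_smult_r_distr: "\<And>a x y. a \<in> carrier K \<Longrightarrow> x \<in> carrier V \<Longrightarrow> y \<in> carrier V \<Longrightarrow>
       a \<odot>\<^bsub>V\<^esub> (x \<oplus>\<^bsub>V\<^esub> y) = a \<odot>\<^bsub>V\<^esub> x \<oplus>\<^bsub>V\<^esub> a \<odot>\<^bsub>V\<^esub> y"
    and vs_smult_assoc: "\<And>a b x. a \<in> carrier K \<Longrightarrow> b \<in> carrier K \<Longrightarrow> x \<in> carrier V \<Longrightarrow>
       (a \<otimes>\<^bsub>K\<^esub> b) \<odot>\<^bsub>V\<^esub> x = a \<odot>\<^bsub>V\<^esub> (b \<odot>\<^bsub>V\<^esub> x)"
    and vs_one_smult: "\<And>x. x \<in> carrier V \<Longrightarrow> \<one>\<^bsub>K\<^esub> \<odot>\<^bsub>V\<^esub> x = x"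
    and vs_zero_smult: "\<And>x. x \<in> carrier V \<Longrightarrow> \<zero>\<^bsub>K\<^esub> \<odot>\<^bsub>V\<^esub> x = \<zero>\<^bsub>V\<^esub>"
    and vs_smult_zero: "\<And>a. a \<in> carrier K \<Longrightarrow> a \<odot>\<^bsub>V\<^esub> \<zero>\<^bsub>V\<^esub> = \<zero>\<^bsub>V\<^esub>"
proof -
  interpret vectorspace K V by fact
  show "\<zero>\<^bsub>V\<^esub> \<in> carrier V"
    "\<And>x y. x \<in> carrier V \<Longrightarrow> y \<in> carrier V \<Longrightarrow> x \<oplus>\<^bsub>V\<^esub> y \<in> carrier V"
    "\<And>a x. a \<in> carrier K \<Longrightarrow> x \<in> carrier V \<Longrightarrow> a \<odot>\<^bsub>V\<^esub> x \<in> carrier V"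
    "\<And>x y z. x \<in> carrier V \<Longrightarrow> y \<in> carrier V \<Longrightarrow> z \<in> carrier V \<Longrightarrow>
       x \<oplus>\<^bsub>V\<^esub> y \<oplus>\<^bsub>V\<^esub> z = x \<oplus>\<^bsub>V\<^esub> (y \<oplus>\<^bsub>V\<^esub> z)"
    "\<And>x y. x \<in> carrier V \<Longrightarrow> y \<in> carrier V \<Longrightarrow> x \<oplus>\<^bsub>V\<^esub> y = y \<oplus>\<^bsub>V\<^esub> x"
    "\<And>x. x \<in> carrier V \<Longrightarrow> \<zero>\<^bsub>V\<^esub> \<oplus>\<^bsub>V\<^esub> x = x"
    "\<And>a b x. a \<in> carrier K \<Longrightarrow> b \<in> carrier K \<Longrightarrow> x \<in> carrier V \<Longrightarrow>
       (a \<oplus>\<^bsub>K\<^esub> b) \<odot>\<^bsub>V\<^esub> x = a \<odot>\<^bsub>V\<^esub> x \<oplus>\<^bsub>V\<^esub> b \<odot>\<^bsub>V\<^esub> x"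
    "\<And>a x y. a \<in> carrier K \<Longrightarrow> x \<in> carrier V \<Longrightarrow> y \<in> carrier V \<Longrightarrow>
       a \<odot>\<^bsub>V\<^esub> (x \<oplus>\<^bsub>V\<^esub> y) = a \<odot>\<^bsub>V\<^esub> x \<oplus>\<^bsub>V\<^esub> a \<odot>\<^bsub>V\<^esub> y"
    "\<And>a b x. a \<in> carrier K \<Longrightarrow> b \<in> carrier K \<Longrightarrow> x \<in> carrier V \<Longrightarrow>
       (a \<otimes>\<^bsub>K\<^esub> b) \<odot>\<^bsub>V\<^esub> x = a \<odot>\<^bsub>V\<^esub> (b \<odot>\<^bsub>V\<^esub> x)"
    "\<And>x. x \<in> carrier V \<Longrightarrow> \<one>\<^bsub>K\<^esub> \<odot>\<^bsub>V\<^esub> x = x"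
    "\<And>x. x \<in> carrier V \<Longrightarrow> \<zero>\<^bsub>K\<^esub> \<odot>\<^bsub>V\<^esub> x = \<zero>\<^bsub>V\<^esub>"
    "\<And>a. a \<in> carrier K \<Longrightarrow> a \<odot>\<^bsub>V\<^esub> \<zero>\<^bsub>V\<^esub> = \<zero>\<^bsub>V\<^esub>"
    by (simp_all add: M.a_ac smult_l_distr smult_r_distr smult_assoc1)
qed

lemmas vs_simps = vs_zero_closed vs_add_closed vs_smult_closed vs_add_assoc vs_zero_add
  vs_smult_l_distr vs_smult_r_distr vs_smult_assoc vs_one_smult vs_zero_smult vs_smult_zero

lemma vs_add_interchange:
  assumes "vectorspace K V" "a \<in> carrier V" "b \<in> carrier V" "c \<in> carrier V" "d \<in> carrier V"
  shows "(a \<oplus>\<^bsub>V\<^esub> b) \<oplus>\<^bsub>V\<^esub> (c \<oplus>\<^bsub>V\<^esub> d) = (a \<oplus>\<^bsub>V\<^esub> c) \<oplus>\<^bsub>V\<^esub> (b \<oplus>\<^bsub>V\<^esub> d)"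
proof -
  interpret vectorspace K V by fact
  show ?thesis using assms(2-) by (simp add: M.a_ac)
qed

text \<open>Negatives do not have to be supplied: the multiple of \<open>x\<close> by minus one is
  one, because scalars distribute and the zero scalar annihilates.\<close>

lemma vectorspaceI:
  assumes K: "field K"
    and zero: "\<zero>\<^bsub>V\<^esub> \<in> carrier V"
    and add: "\<And>x y. x \<in> carrier V \<Longrightarrow> y \<in> carrier V \<Longrightarrow> x \<oplus>\<^bsub>V\<^esub> y \<in> carrier V"
    and smult: "\<And>a x. a \<in> carrier K \<Longrightarrow> x \<in> carrier V \<Longrightarrow> a \<odot>\<^bsub>V\<^esub> x \<in> carrier V"
    and assoc: "\<And>x y z. x \<in> carrier V \<Longrightarrow> y \<in> carrier V \<Longrightarrow> z \<in> carrier V \<Longrightarrow>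
       x \<oplus>\<^bsub>V\<^esub> y \<oplus>\<^bsub>V\<^esub> z = x \<oplus>\<^bsub>V\<^esub> (y \<oplus>\<^bsub>V\<^esub> z)"
    and comm: "\<And>x y. x \<in> carrier V \<Longrightarrow> y \<in> carrier V \<Longrightarrow> x \<oplus>\<^bsub>V\<^esub> y = y \<oplus>\<^bsub>V\<^esub> x"
    and zero_add: "\<And>x. x \<in> carrier V \<Longrightarrow> \<zero>\<^bsub>V\<^esub> \<oplus>\<^bsub>V\<^esub> x = x"
    and l_distr: "\<And>a b x. a \<in> carrier K \<Longrightarrow> b \<in> carrier K \<Longrightarrow> x \<in> carrier V \<Longrightarrow>
       (a \<oplus>\<^bsub>K\<^esub> b) \<odot>\<^bsub>V\<^esub> x = a \<odot>\<^bsub>V\<^esub> x \<oplus>\<^bsub>V\<^esub> b \<odot>\<^bsub>V\<^esub> x"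
    and r_distr: "\<And>a x y. a \<in> carrier K \<Longrightarrow> x \<in> carrier V \<Longrightarrow> y \<in> carrier V \<Longrightarrow>
       a \<odot>\<^bsub>V\<^esub> (x \<oplus>\<^bsub>V\<^esub> y) = a \<odot>\<^bsub>V\<^esub> x \<oplus>\<^bsub>V\<^esub> a \<odot>\<^bsub>V\<^esub> y"
    and smult_assoc: "\<And>a b x. a \<in> carrier K \<Longrightarrow> b \<in> carrier K \<Longrightarrow> x \<in> carrier V \<Longrightarrow>
       (a \<otimes>\<^bsub>K\<^esub> b) \<odot>\<^bsub>V\<^esub> x = a \<odot>\<^bsub>V\<^esub> (b \<odot>\<^bsub>V\<^esub> x)"
    and one_smult: "\<And>x. x \<in> carrier V \<Longrightarrow> \<one>\<^bsub>K\<^esub> \<odot>\<^bsub>V\<^esub> x = x"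
    and zero_smult: "\<And>x. x \<in> carrier V \<Longrightarrow> \<zero>\<^bsub>K\<^esub> \<odot>\<^bsub>V\<^esub> x = \<zero>\<^bsub>V\<^esub>"
  shows "vectorspace K V"
proof -
  interpret K: field K by fact
  have "\<exists>y\<in>carrier V. y \<oplus>\<^bsub>V\<^esub> x = \<zero>\<^bsub>V\<^esub>" if x: "x \<in> carrier V" for x
  proof
    show "(\<ominus>\<^bsub>K\<^esub> \<one>\<^bsub>K\<^esub>) \<odot>\<^bsub>V\<^esub> x \<oplus>\<^bsub>V\<^esub> x = \<zero>\<^bsub>V\<^esub>"
      using l_distr[of "\<ominus>\<^bsub>K\<^esub> \<one>\<^bsub>K\<^esub>" "\<one>\<^bsub>K\<^esub>" x] x by (simp add: K.l_neg one_smult zero_smult)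
  qed (simp add: smult x)
  then have "abelian_group V"
    using zero add assoc comm zero_add by (intro abelian_groupI) auto
  then have "module K V"
    using smult l_distr r_distr smult_assoc one_smult K.is_cring by (intro moduleI) auto
  then show ?thesis using K by (simp add: vectorspace_def)
qed

text \<open>\<open>W\<close> is at first a bare record, whose zero could be any element; that it is
  the image of the zero of \<open>V\<close> is therefore a hypothesis and not a consequence of
  additivity.\<close>

lemma vectorspace_transport:
  assumes V: "vectorspace K V" and f: "bij_betw f (carrier V) (carrier W)"
    and zero: "f \<zero>\<^bsub>V\<^esub> = \<zero>\<^bsub>W\<^esub>"
    and add: "\<And>x y. x \<in> carrier V \<Longrightarrow> y \<in> carrier V \<Longrightarrow> f (x \<oplus>\<^bsub>V\<^esub> y) = f x \<oplus>\<^bsub>W\<^esub> f y"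
    and smult: "\<And>a x. a \<in> carrier K \<Longrightarrow> x \<in> carrier V \<Longrightarrow> f (a \<odot>\<^bsub>V\<^esub> x) = a \<odot>\<^bsub>W\<^esub> f x"
  shows "vectorspace K W"
proof -
  interpret K: field K using V by (rule vectorspace_field)
  have W: "carrier W = f ` carrier V" using f by (simp add: bij_betw_def)
  note closed = vs_zero_closed[OF V] vs_add_closed[OF V] vs_smult_closed[OF V]
  note simps = closed zero[symmetric] add[symmetric] smult[symmetric]
  show ?thesis
  proof (rule vectorspaceI)
    show "\<zero>\<^bsub>W\<^esub> \<in> carrier W"
      unfolding W using closed by (simp add: zero[symmetric])
    show "\<And>x y. x \<in> carrier W \<Longrightarrow> y \<in> carrier W \<Longrightarrow> x \<oplus>\<^bsub>W\<^esub> y \<in> carrier W"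
      "\<And>a x. a \<in> carrier K \<Longrightarrow> x \<in> carrier W \<Longrightarrow> a \<odot>\<^bsub>W\<^esub> x \<in> carrier W"
      unfolding W by (auto simp: simps)
    show "\<And>x y. x \<in> carrier W \<Longrightarrow> y \<in> carrier W \<Longrightarrow> x \<oplus>\<^bsub>W\<^esub> y = y \<oplus>\<^bsub>W\<^esub> x"
      unfolding W by (auto simp: simps vs_add_comm[OF V])
    show "\<And>x y z. x \<in> carrier W \<Longrightarrow> y \<in> carrier W \<Longrightarrow> z \<in> carrier W \<Longrightarrow>
        x \<oplus>\<^bsub>W\<^esub> y \<oplus>\<^bsub>W\<^esub> z = x \<oplus>\<^bsub>W\<^esub> (y \<oplus>\<^bsub>W\<^esub> z)"
      "\<And>x. x \<in> carrier W \<Longrightarrow> \<zero>\<^bsub>W\<^esub> \<oplus>\<^bsub>W\<^esub> x = x"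
      "\<And>a b x. a \<in> carrier K \<Longrightarrow> b \<in> carrier K \<Longrightarrow> x \<in> carrier W \<Longrightarrow>
        (a \<oplus>\<^bsub>K\<^esub> b) \<odot>\<^bsub>W\<^esub> x = a \<odot>\<^bsub>W\<^esub> x \<oplus>\<^bsub>W\<^esub> b \<odot>\<^bsub>W\<^esub> x"
      "\<And>a x y. a \<in> carrier K \<Longrightarrow> x \<in> carrier W \<Longrightarrow> y \<in> carrier W \<Longrightarrow>
        a \<odot>\<^bsub>W\<^esub> (x \<oplus>\<^bsub>W\<^esub> y) = a \<odot>\<^bsub>W\<^esub> x \<oplus>\<^bsub>W\<^esub> a \<odot>\<^bsub>W\<^esub> y"
      "\<And>a b x. a \<in> carrier K \<Longrightarrow> b \<in> carrier K \<Longrightarrow> x \<in> carrier W \<Longrightarrow>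
        (a \<otimes>\<^bsub>K\<^esub> b) \<odot>\<^bsub>W\<^esub> x = a \<odot>\<^bsub>W\<^esub> (b \<odot>\<^bsub>W\<^esub> x)"
      "\<And>x. x \<in> carrier W \<Longrightarrow> \<one>\<^bsub>K\<^esub> \<odot>\<^bsub>W\<^esub> x = x"
      "\<And>x. x \<in> carrier W \<Longrightarrow> \<zero>\<^bsub>K\<^esub> \<odot>\<^bsub>W\<^esub> x = \<zero>\<^bsub>W\<^esub>"
      unfolding W by (auto simp: simps vs_simps[OF V])
  qed (rule K.field_axioms)
qed

section \<open>Subspaces of products\<close>

lemma pointwise_sel [simp]:
  "carrier (pointwise I M A) = A"
  "zero (pointwise I M A) = (\<lambda>i\<in>I. \<zero>\<^bsub>M i\<^esub>)"
  "f \<oplus>\<^bsub>pointwise I M A\<^esub> g = (\<lambda>i\<in>I. f i \<oplus>\<^bsub>M i\<^esub> g i)"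
  "c \<odot>\<^bsub>pointwise I M A\<^esub> f = (\<lambda>i\<in>I. c \<odot>\<^bsub>M i\<^esub> f i)"
  by (simp_all add: pointwise_def)

text \<open>The common source of the spaces of linear maps, of the spaces of families with
  restricted support, and of the image that serves as tensor product: all are sets of extensional
  families closed under the pointwise operations.\<close>

lemma vectorspace_pointwise:
  assumes K: "field K" and M: "\<And>i. i \<in> I \<Longrightarrow> vectorspace K (M i)"
    and A: "A \<subseteq> (\<Pi>\<^sub>E i\<in>I. carrier (M i))"
    and zero: "(\<lambda>i\<in>I. \<zero>\<^bsub>M i\<^esub>) \<in> A"
    and add: "\<And>f g. f \<in> A \<Longrightarrow> g \<in> A \<Longrightarrow> (\<lambda>i\<in>I. f i \<oplus>\<^bsub>M i\<^esub> g i) \<in> A"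
    and smult: "\<And>c f. c \<in> carrier K \<Longrightarrow> f \<in> A \<Longrightarrow> (\<lambda>i\<in>I. c \<odot>\<^bsub>M i\<^esub> f i) \<in> A"
  shows "vectorspace K (pointwise I M A)"
proof -
  interpret K: field K by fact
  have mem: "f i \<in> carrier (M i)" if "f \<in> A" "i \<in> I" for f i using A that by auto
  have ext: "(\<lambda>i\<in>I. f i) = f" if "f \<in> A" for f
    using A that by (auto simp: extensional_restrict PiE_def)
  have eq: "(\<lambda>i\<in>I. h i) = f" if "f \<in> A" "\<And>i. i \<in> I \<Longrightarrow> h i = f i" for h f
    using ext[OF that(1)] that(2) by (metis restrict_ext)
  show ?thesis
  proof (rule vectorspaceI)
    show "\<And>x. x \<in> carrier (pointwise I M A) \<Longrightarrow>
        \<zero>\<^bsub>pointwise I M A\<^esub> \<oplus>\<^bsub>pointwise I M A\<^esub> x = x"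
      by (auto intro!: eq simp: mem vs_simps[OF M])
    show "\<And>x. x \<in> carrier (pointwise I M A) \<Longrightarrow> \<one>\<^bsub>K\<^esub> \<odot>\<^bsub>pointwise I M A\<^esub> x = x"
      by (auto intro!: eq simp: mem vs_simps[OF M])
    show "\<And>x y. x \<in> carrier (pointwise I M A) \<Longrightarrow> y \<in> carrier (pointwise I M A) \<Longrightarrow>
        x \<oplus>\<^bsub>pointwise I M A\<^esub> y = y \<oplus>\<^bsub>pointwise I M A\<^esub> x"
      by (auto intro!: restrict_ext simp: mem vs_add_comm[OF M])
  qed (use zero add smult in \<open>auto intro!: restrict_ext K.field_axioms
        simp: mem vs_simps[OF M]\<close>)
qed

section \<open>Linear maps\<close>

lemma module_homI:
  assumes "\<And>x. x \<in> carrier V \<Longrightarrow> f x \<in> carrier W"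
    and "\<And>x y. x \<in> carrier V \<Longrightarrow> y \<in> carrier V \<Longrightarrow> f (x \<oplus>\<^bsub>V\<^esub> y) = f x \<oplus>\<^bsub>W\<^esub> f y"
    and "\<And>a x. a \<in> carrier K \<Longrightarrow> x \<in> carrier V \<Longrightarrow> f (a \<odot>\<^bsub>V\<^esub> x) = a \<odot>\<^bsub>W\<^esub> f x"
  shows "f \<in> module_hom K V W"
  using assms by (auto simp: module_hom_def)

lemma module_hom_in: "f \<in> module_hom K V W \<Longrightarrow> x \<in> carrier V \<Longrightarrow> f x \<in> carrier W"
  by (rule funcset_mem[OF module_hom_closed])

lemma module_hom_zero:
  assumes "vectorspace K V" "vectorspace K W" "f \<in> module_hom K V W"
  shows "f \<zero>\<^bsub>V\<^esub> = \<zero>\<^bsub>W\<^esub>"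
proof -
  interpret K: field K using assms(1) by (rule vectorspace_field)
  have "f (\<zero>\<^bsub>K\<^esub> \<odot>\<^bsub>V\<^esub> \<zero>\<^bsub>V\<^esub>) = \<zero>\<^bsub>K\<^esub> \<odot>\<^bsub>W\<^esub> f \<zero>\<^bsub>V\<^esub>"
    using assms by (intro module_hom_smult) (auto simp: vs_simps)
  then show ?thesis using assms by (simp add: vs_simps module_hom_in)
qed

lemma module_hom_cong:
  assumes "vectorspace K V" "\<And>x. x \<in> carrier V \<Longrightarrow> f x = g x"
  shows "f \<in> module_hom K V W \<longleftrightarrow> g \<in> module_hom K V W"
  using assms by (auto simp: module_hom_def vs_simps Pi_def)

lemma module_hom_comp:
  assumes "f \<in> module_hom K U V" "g \<in> module_hom K V W"
  shows "(\<lambda>x. g (f x)) \<in> module_hom K U W"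
  using assms by (auto intro!: module_homI simp: module_hom_in module_hom_add module_hom_smult)

lemma module_hom_inverse:
  assumes V: "vectorspace K V" and f: "f \<in> module_hom K V W" "bij_betw f (carrier V) (carrier W)"
  shows "inv_into (carrier V) f \<in> module_hom K W V"
proof -
  let ?g = "inv_into (carrier V) f"
  have inj: "inj_on f (carrier V)" and W: "carrier W = f ` carrier V"
    using f(2) by (auto simp: bij_betw_def)
  show ?thesis
    by (rule module_homI)
       (use V f(1) inj in \<open>auto simp: W vs_simps module_hom_add[symmetric]
         module_hom_smult[symmetric]\<close>)
qed

lemma carrier_Lin_iff:
  "f \<in> carrier (Lin K V W) \<longleftrightarrow> f \<in> module_hom K V W \<and> f \<in> extensional (carrier V)"
  by (simp add: Lin_def)

lemma Lin_sel:
  "zero (Lin K V W) = (\<lambda>x\<in>carrier V. \<zero>\<^bsub>W\<^esub>)"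
  "f \<oplus>\<^bsub>Lin K V W\<^esub> g = (\<lambda>x\<in>carrier V. f x \<oplus>\<^bsub>W\<^esub> g x)"
  "c \<odot>\<^bsub>Lin K V W\<^esub> f = (\<lambda>x\<in>carrier V. c \<odot>\<^bsub>W\<^esub> f x)"
  by (simp_all add: Lin_def)

lemma restrict_in_Lin:
  "vectorspace K V \<Longrightarrow> f \<in> module_hom K V W \<Longrightarrow> restrict f (carrier V) \<in> carrier (Lin K V W)"
  by (simp add: carrier_Lin_iff module_hom_cong[of K V "restrict f (carrier V)" f])

lemma Lin_eqI:
  "f \<in> carrier (Lin K V W) \<Longrightarrow> g \<in> carrier (Lin K V W) \<Longrightarrow>
   (\<And>x. x \<in> carrier V \<Longrightarrow> f x = g x) \<Longrightarrow> f = g"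
  unfolding carrier_Lin_iff by (blast intro: extensionalityI)

lemma compose_in_Lin:
  assumes "vectorspace K U" "f \<in> carrier (Lin K U V)" "g \<in> carrier (Lin K V W)"
  shows "compose (carrier U) g f \<in> carrier (Lin K U W)"
  using module_hom_comp[of f K U V g W] restrict_in_Lin[of K U "\<lambda>x. g (f x)" W] assms
  by (simp add: carrier_Lin_iff compose_def)

lemma lin_id_in_Lin: "vectorspace K V \<Longrightarrow> lin_id V \<in> carrier (Lin K V V)"
  unfolding lin_id_def by (intro restrict_in_Lin module_homI) auto

lemma vectorspace_Lin:
  assumes V: "vectorspace K V" and W: "vectorspace K W"
  shows "vectorspace K (Lin K V W)"
proof -
  interpret K: field K using V by (rule vectorspace_field)
  \<comment> \<open>Extensionality comes with the restriction, so that for each operation only the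
    linearity of the unrestricted function remains.\<close>
  have L: "restrict f (carrier V) \<in> module_hom K V W \<inter> extensional (carrier V)"
    if "f \<in> module_hom K V W" for f
    using restrict_in_Lin[OF V that] by (simp add: carrier_Lin_iff)
  show ?thesis unfolding Lin_def
  proof (rule vectorspace_pointwise)
    fix c f assume "c \<in> carrier K" "f \<in> module_hom K V W \<inter> extensional (carrier V)"
    then show "(\<lambda>i\<in>carrier V. c \<odot>\<^bsub>W\<^esub> f i) \<in> module_hom K V W \<inter> extensional (carrier V)"
      by (intro L module_homI)
         (auto simp: module_hom_in module_hom_add module_hom_smult vs_smult_closed[OF W]
           vs_smult_r_distr[OF W] vs_smult_assoc[OF W, symmetric] K.m_comm)
  next
    fix f g assume "f \<in> module_hom K V W \<inter> extensional (carrier V)"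
      "g \<in> module_hom K V W \<inter> extensional (carrier V)"
    then show "(\<lambda>i\<in>carrier V. f i \<oplus>\<^bsub>W\<^esub> g i) \<in> module_hom K V W \<inter> extensional (carrier V)"
      by (intro L module_homI)
         (auto simp: module_hom_in module_hom_add module_hom_smult vs_add_closed[OF W]
           vs_smult_r_distr[OF W] vs_add_interchange[OF W])
  next
    show "(\<lambda>i\<in>carrier V. \<zero>\<^bsub>W\<^esub>) \<in> module_hom K V W \<inter> extensional (carrier V)"
      by (intro L module_homI) (auto simp: vs_simps[OF W])
  qed (use W in \<open>auto intro: K.field_axioms simp: module_hom_in PiE_def extensional_def\<close>)
qed

text \<open>The sum of a finitely supported family; an infinite support gives \<open>\<zero>\<close>.\<close>

definition fsum :: "('k, 'w) module \<Rightarrow> ('i \<Rightarrow> 'w) \<Rightarrow> 'i set \<Rightarrow> 'w" where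
  "fsum W h I = finsum W h {i\<in>I. h i \<noteq> \<zero>\<^bsub>W\<^esub>}"

text \<open>Families with different supports can thereby be summed over one finite set that contains
  all of them.\<close>

lemma fsum_eq_finsum:
  assumes W: "vectorspace K W" and B: "finite B" "B \<subseteq> I"
    and h: "\<And>i. i \<in> B \<Longrightarrow> h i \<in> carrier W" "\<And>i. i \<in> I - B \<Longrightarrow> h i = \<zero>\<^bsub>W\<^esub>"
  shows "fsum W h I = finsum W h B"
proof -
  interpret vectorspace K W by fact
  have "{i\<in>I. h i \<noteq> \<zero>\<^bsub>W\<^esub>} \<subseteq> B" using h(2) by auto
  then show ?thesis unfolding fsum_def
    using B h by (intro M.add.finprod_mono_neutral_cong_left) auto
qed

lemma fsum_closed:
  assumes "vectorspace K W" "\<And>i. i \<in> I \<Longrightarrow> h i \<in> carrier W"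
  shows "fsum W h I \<in> carrier W"
proof -
  interpret vectorspace K W by fact
  show ?thesis unfolding fsum_def using assms(2) by (intro M.finsum_closed) auto
qed

lemma fsum_cong:
  assumes W: "vectorspace K W" and h: "\<And>i. i \<in> I \<Longrightarrow> h i \<in> carrier W"
    and eq: "\<And>i. i \<in> I \<Longrightarrow> h i = h' i"
  shows "fsum W h I = fsum W h' I"
proof -
  interpret vectorspace K W by fact
  have "{i\<in>I. h i \<noteq> \<zero>\<^bsub>W\<^esub>} = {i\<in>I. h' i \<noteq> \<zero>\<^bsub>W\<^esub>}" using eq by auto
  then show ?thesis unfolding fsum_def
    using h eq by (intro M.finsum_cong') auto
qed

lemma fsum_mono_neutral:
  assumes "J \<subseteq> I" "\<And>i. i \<in> I - J \<Longrightarrow> h i = \<zero>\<^bsub>W\<^esub>"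
  shows "fsum W h I = fsum W h J"
proof -
  have "{i\<in>I. h i \<noteq> \<zero>\<^bsub>W\<^esub>} = {i\<in>J. h i \<noteq> \<zero>\<^bsub>W\<^esub>}" using assms by auto
  then show ?thesis by (simp add: fsum_def)
qed

lemma fsum_single:
  assumes W: "vectorspace K W" and "j \<in> I" "h j \<in> carrier W"
    and "\<And>i. i \<in> I \<Longrightarrow> i \<noteq> j \<Longrightarrow> h i = \<zero>\<^bsub>W\<^esub>"
  shows "fsum W h I = h j"
proof -
  interpret vectorspace K W by fact
  have "fsum W h I = finsum W h {j}" using assms by (intro fsum_eq_finsum[OF W]) auto
  then show ?thesis using assms(3) by (simp add: M.finsum_insert)
qed

lemma fsum_zero: "(\<And>i. i \<in> I \<Longrightarrow> h i = \<zero>\<^bsub>W\<^esub>) \<Longrightarrow> vectorspace K W \<Longrightarrow> fsum W h I = \<zero>\<^bsub>W\<^esub>"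
proof -
  assume h: "\<And>i. i \<in> I \<Longrightarrow> h i = \<zero>\<^bsub>W\<^esub>" and "vectorspace K W"
  then interpret vectorspace K W by simp
  show ?thesis using fsum_mono_neutral[of "{}" I h W] h by (simp add: fsum_def M.finsum_empty)
qed

lemma fsum_add:
  assumes W: "vectorspace K W"
    and h: "\<And>i. i \<in> I \<Longrightarrow> h i \<in> carrier W" "finite {i\<in>I. h i \<noteq> \<zero>\<^bsub>W\<^esub>}"
    and g: "\<And>i. i \<in> I \<Longrightarrow> g i \<in> carrier W" "finite {i\<in>I. g i \<noteq> \<zero>\<^bsub>W\<^esub>}"
  shows "fsum W (\<lambda>i. h i \<oplus>\<^bsub>W\<^esub> g i) I = fsum W h I \<oplus>\<^bsub>W\<^esub> fsum W g I"
proof -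
  interpret vectorspace K W by fact
  \<comment> \<open>Terms may cancel, so the support of the sum can be smaller than those of
    \<open>h\<close> and \<open>g\<close>; all three sums are taken over the union of the two
    supports.\<close>
  define B where "B = {i\<in>I. h i \<noteq> \<zero>\<^bsub>W\<^esub>} \<union> {i\<in>I. g i \<noteq> \<zero>\<^bsub>W\<^esub>}"
  have B: "finite B" "B \<subseteq> I" using h(2) g(2) by (auto simp: B_def)
  have z: "h i = \<zero>\<^bsub>W\<^esub>" "g i = \<zero>\<^bsub>W\<^esub>" if "i \<in> I - B" for i using that by (auto simp: B_def)
  have c: "h i \<in> carrier W" "g i \<in> carrier W" if "i \<in> B" for i using that B h g by auto
  have "fsum W (\<lambda>i. h i \<oplus>\<^bsub>W\<^esub> g i) I = finsum W (\<lambda>i. h i \<oplus>\<^bsub>W\<^esub> g i) B"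
    using B z c by (intro fsum_eq_finsum[OF W]) auto
  also have "\<dots> = finsum W h B \<oplus>\<^bsub>W\<^esub> finsum W g B"
    using c by (intro M.finsum_addf) auto
  also have "finsum W h B = fsum W h I" using B z c by (intro fsum_eq_finsum[OF W, symmetric]) auto
  also have "finsum W g B = fsum W g I" using B z c by (intro fsum_eq_finsum[OF W, symmetric]) auto
  finally show ?thesis .
qed

lemma fsum_hom:
  assumes V: "vectorspace K V" and W: "vectorspace K W" and T: "T \<in> module_hom K V W"
    and h: "\<And>i. i \<in> I \<Longrightarrow> h i \<in> carrier V" "finite {i\<in>I. h i \<noteq> \<zero>\<^bsub>V\<^esub>}"
  shows "T (fsum V h I) = fsum W (\<lambda>i. T (h i)) I"
proof -
  interpret V: vectorspace K V by fact
  interpret W: vectorspace K W by fact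
  define B where "B = {i\<in>I. h i \<noteq> \<zero>\<^bsub>V\<^esub>}"
  have B: "finite B" "B \<subseteq> I" using h(2) by (auto simp: B_def)
  have "T (finsum V h B) = finsum W (\<lambda>i. T (h i)) B"
    using B
  proof (induction B rule: finite_induct)
    case empty
    then show ?case using module_hom_zero[OF V W T] by simp
  next
    case (insert x F)
    have "h x \<in> carrier V" "h \<in> F \<rightarrow> carrier V" using insert h by auto
    then show ?case using insert
      by (auto simp: module_hom_add[OF T] module_hom_in[OF T] Pi_def)
  qed
  moreover have "fsum V h I = finsum V h B" by (simp add: fsum_def B_def)
  \<comment> \<open>\<open>T\<close> may annihilate some of the terms, so \<open>B\<close> only
    contains the support on this side.\<close>
  moreover have "fsum W (\<lambda>i. T (h i)) I = finsum W (\<lambda>i. T (h i)) B"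
    using h module_hom_zero[OF V W T] module_hom_in[OF T]
    by (intro fsum_eq_finsum[OF W] B) (auto simp: B_def)
  ultimately show ?thesis by simp
qed

lemma smult_in_module_hom:
  assumes W: "vectorspace K W" and a: "a \<in> carrier K"
  shows "(\<lambda>w. a \<odot>\<^bsub>W\<^esub> w) \<in> module_hom K W W"
proof -
  interpret K: field K using W by (rule vectorspace_field)
  show ?thesis
    using a by (intro module_homI)
      (auto simp: vs_smult_closed[OF W] vs_smult_r_distr[OF W] vs_smult_assoc[OF W, symmetric]
        K.m_comm)
qed

lemma fsum_smult:
  assumes W: "vectorspace K W" and a: "a \<in> carrier K"
    and h: "\<And>i. i \<in> I \<Longrightarrow> h i \<in> carrier W" "finite {i\<in>I. h i \<noteq> \<zero>\<^bsub>W\<^esub>}"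
  shows "fsum W (\<lambda>i. a \<odot>\<^bsub>W\<^esub> h i) I = a \<odot>\<^bsub>W\<^esub> fsum W h I"
  using fsum_hom[OF W W smult_in_module_hom[OF W a] h] by simp

section \<open>The ground field as a space, and families with restricted support\<close>

definition self_space :: "'k ring \<Rightarrow> ('k, 'k) module" where
  "self_space K = \<lparr>carrier = carrier K, mult = mult K, one = one K, zero = zero K,
     add = add K, smult = mult K\<rparr>"

lemma self_space_sel [simp]:
  "carrier (self_space K) = carrier K" "zero (self_space K) = zero K"
  "add (self_space K) = add K" "smult (self_space K) = mult K"
  by (simp_all add: self_space_def)

lemma vectorspace_self_space: "field K \<Longrightarrow> vectorspace K (self_space K)"
proof -
  assume "field K"
  then interpret K: field K .
  show ?thesis
    by (rule vectorspaceI) (auto simp: K.field_axioms K.l_distr K.r_distr K.m_assoc K.a_ac)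
qed

text \<open>This is the value of \<open>born_functor\<close> at \<open>V\<close>, freed from the
  type \<open>'u\<close>: it also has to make sense for the ground field, whose elements have type
  \<open>'k\<close>.\<close>

definition born_space :: "'i set \<Rightarrow> 'i set set \<Rightarrow> ('k, 'v) module \<Rightarrow> ('k, 'i \<Rightarrow> 'v) module" where
  "born_space I \<F> V =
    pointwise I (\<lambda>_. V) {\<phi> \<in> I \<rightarrow>\<^sub>E carrier V. {i\<in>I. \<phi> i \<noteq> \<zero>\<^bsub>V\<^esub>} \<in> \<F>}"

lemma carrier_born_space_iff:
  "\<phi> \<in> carrier (born_space I \<F> V) \<longleftrightarrow>
   \<phi> \<in> extensional I \<and> (\<forall>i\<in>I. \<phi> i \<in> carrier V) \<and> {i\<in>I. \<phi> i \<noteq> \<zero>\<^bsub>V\<^esub>} \<in> \<F>"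
  by (auto simp: born_space_def PiE_def)

lemma born_space_sel:
  "zero (born_space I \<F> V) = (\<lambda>i\<in>I. \<zero>\<^bsub>V\<^esub>)"
  "\<phi> \<oplus>\<^bsub>born_space I \<F> V\<^esub> \<psi> = (\<lambda>i\<in>I. \<phi> i \<oplus>\<^bsub>V\<^esub> \<psi> i)"
  "c \<odot>\<^bsub>born_space I \<F> V\<^esub> \<phi> = (\<lambda>i\<in>I. c \<odot>\<^bsub>V\<^esub> \<phi> i)"
  by (simp_all add: born_space_def)

lemma bornology_subset: "bornology I \<F> \<Longrightarrow> S \<in> \<F> \<Longrightarrow> T \<subseteq> S \<Longrightarrow> T \<in> \<F>"
  by (auto simp: bornology_def)

lemma bornology_Un: "bornology I \<F> \<Longrightarrow> S \<in> \<F> \<Longrightarrow> T \<in> \<F> \<Longrightarrow> S \<union> T \<in> \<F>"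
  by (auto simp: bornology_def)

lemma bornology_finite: "bornology I \<F> \<Longrightarrow> S \<subseteq> I \<Longrightarrow> finite S \<Longrightarrow> S \<in> \<F>"
  by (auto simp: bornology_def)

lemma bornology_Pow: "bornology I \<F> \<Longrightarrow> S \<in> \<F> \<Longrightarrow> S \<subseteq> I"
  by (auto simp: bornology_def)

text \<open>For this smallest bornology \<open>born_space\<close> is a direct sum of copies of
  \<open>V\<close>. Free spaces and the target of tensor coordinates arise in this way.\<close>

lemma bornology_finite_subsets: "bornology I {F. F \<subseteq> I \<and> finite F}"
  by (auto simp: bornology_def intro: finite_subset)

lemma vectorspace_born_space:
  assumes \<F>: "bornology I \<F>" and V: "vectorspace K V"
  shows "vectorspace K (born_space I \<F> V)"
  unfolding born_space_def
proof (rule vectorspace_pointwise)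
  fix f g
  assume f: "f \<in> {\<phi> \<in> I \<rightarrow>\<^sub>E carrier V. {i\<in>I. \<phi> i \<noteq> \<zero>\<^bsub>V\<^esub>} \<in> \<F>}"
  have "{i\<in>I. (\<lambda>i\<in>I. c \<odot>\<^bsub>V\<^esub> f i) i \<noteq> \<zero>\<^bsub>V\<^esub>} \<in> \<F>" if "c \<in> carrier K" for c
    by (rule bornology_subset[OF \<F>, of "{i\<in>I. f i \<noteq> \<zero>\<^bsub>V\<^esub>}"])
       (use f that in \<open>auto simp: vs_simps[OF V]\<close>)
  then show "(\<lambda>i\<in>I. c \<odot>\<^bsub>V\<^esub> f i) \<in> {\<phi> \<in> I \<rightarrow>\<^sub>E carrier V. {i\<in>I. \<phi> i \<noteq> \<zero>\<^bsub>V\<^esub>} \<in> \<F>}"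
    if "c \<in> carrier K" for c using that f by (auto simp: PiE_def Pi_iff vs_simps[OF V])
  assume g: "g \<in> {\<phi> \<in> I \<rightarrow>\<^sub>E carrier V. {i\<in>I. \<phi> i \<noteq> \<zero>\<^bsub>V\<^esub>} \<in> \<F>}"
  have "{i\<in>I. (\<lambda>i\<in>I. f i \<oplus>\<^bsub>V\<^esub> g i) i \<noteq> \<zero>\<^bsub>V\<^esub>} \<in> \<F>"
    by (rule bornology_subset[OF \<F>, of "{i\<in>I. f i \<noteq> \<zero>\<^bsub>V\<^esub>} \<union> {i\<in>I. g i \<noteq> \<zero>\<^bsub>V\<^esub>}"])
       (use f g in \<open>auto simp: vs_simps[OF V] intro: bornology_Un[OF \<F>]\<close>)
  then show "(\<lambda>i\<in>I. f i \<oplus>\<^bsub>V\<^esub> g i) \<in> {\<phi> \<in> I \<rightarrow>\<^sub>E carrier V. {i\<in>I. \<phi> i \<noteq> \<zero>\<^bsub>V\<^esub>} \<in> \<F>}"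
    using f g by (auto simp: PiE_def Pi_iff vs_simps[OF V])
next
  have "{i\<in>I. (\<lambda>i\<in>I. \<zero>\<^bsub>V\<^esub>) i \<noteq> \<zero>\<^bsub>V\<^esub>} = {}" by auto
  then show "(\<lambda>i\<in>I. \<zero>\<^bsub>V\<^esub>) \<in> {\<phi> \<in> I \<rightarrow>\<^sub>E carrier V. {i\<in>I. \<phi> i \<noteq> \<zero>\<^bsub>V\<^esub>} \<in> \<F>}"
    using bornology_finite[OF \<F>, of "{}"] by (auto simp: vs_simps[OF V])
qed (use V in \<open>auto simp: vectorspace_field\<close>)

lemma (in grothendieck_universe) small_born_space:
  assumes "small elts I" "small elts (carrier V)"
  shows "small elts (carrier (born_space I \<F> V))"
  by (rule small_subset[OF small_PiE[OF assms]]) (auto simp: born_space_def)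

text \<open>Constructions are carried out in whatever type suits them and return to
  \<open>Vect\<close> here: the operations are conjugated by a bijection with a member of the
  universe.\<close>

lemma (in grothendieck_universe) Vect_copy:
  assumes V: "vectorspace K V" and small: "small elts (carrier V)"
  shows "\<exists>W\<in>Vect K elts. \<exists>f\<in>module_hom K V W. bij_betw f (carrier V) (carrier W)"
proof -
  obtain x f where f: "inj_on f (carrier V)" "f ` carrier V = elts x"
    using small unfolding small_def by blast
  define g where "g = inv_into (carrier V) f"
  define W :: "('a, 'u) module" where "W = \<lparr>carrier = elts x, mult = undefined, one = undefined,
    zero = f \<zero>\<^bsub>V\<^esub>, add = (\<lambda>a b. f (g a \<oplus>\<^bsub>V\<^esub> g b)), smult = (\<lambda>c a. f (c \<odot>\<^bsub>V\<^esub> g a))\<rparr>"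
  have g: "g (f a) = a" if "a \<in> carrier V" for a using f(1) that by (simp add: g_def)
  have bij: "bij_betw f (carrier V) (carrier W)" using f by (simp add: bij_betw_def W_def)
  have W: "vectorspace K W"
    using V bij by (rule vectorspace_transport) (auto simp: W_def g)
  moreover have "f \<in> module_hom K V W"
    using bij by (intro module_homI) (auto simp: W_def g bij_betw_def)
  moreover have "W \<in> Vect K elts" using W by (auto simp: Vect_def W_def)
  ultimately show ?thesis using bij by blast
qed

text \<open>A basis \<open>e\<close> indexed by \<open>I\<close> together with its dual functionals
  \<open>c\<close>. The functionals are part of the data because linear extensions and the
  coordinates on a tensor product are formulas in them; finiteness of the set of nonzero coordinates
  is stated apart since \<open>fsum\<close> would silently return zero for an infinite
  support.\<close>

definition coord_basis ::
    "'k ring \<Rightarrow> 'i set \<Rightarrow> ('k, 'v) module \<Rightarrow> ('i \<Rightarrow> 'v) \<Rightarrow> ('i \<Rightarrow> 'v \<Rightarrow> 'k) \<Rightarrow> bool" where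
  "coord_basis K I H e c \<longleftrightarrow> vectorspace K H \<and>
    (\<forall>i\<in>I. e i \<in> carrier H \<and> c i \<in> module_hom K H (self_space K)) \<and>
    (\<forall>i\<in>I. \<forall>j\<in>I. c i (e j) = (if i = j then \<one>\<^bsub>K\<^esub> else \<zero>\<^bsub>K\<^esub>)) \<and>
    (\<forall>x\<in>carrier H. finite {i\<in>I. c i x \<noteq> \<zero>\<^bsub>K\<^esub>} \<and> x = fsum H (\<lambda>i. c i x \<odot>\<^bsub>H\<^esub> e i) I)"

lemma
  assumes "coord_basis K I H e c"
  shows coord_basis_vectorspace: "vectorspace K H"
    and coord_basis_in: "\<And>i. i \<in> I \<Longrightarrow> e i \<in> carrier H"
    and coord_basis_hom: "\<And>i. i \<in> I \<Longrightarrow> c i \<in> module_hom K H (self_space K)"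
    and coord_basis_same: "\<And>i. i \<in> I \<Longrightarrow> c i (e i) = \<one>\<^bsub>K\<^esub>"
    and coord_basis_other: "\<And>i j. i \<in> I \<Longrightarrow> j \<in> I \<Longrightarrow> i \<noteq> j \<Longrightarrow> c i (e j) = \<zero>\<^bsub>K\<^esub>"
    and coord_basis_finite: "\<And>x. x \<in> carrier H \<Longrightarrow> finite {i\<in>I. c i x \<noteq> \<zero>\<^bsub>K\<^esub>}"
    and coord_basis_expand: "\<And>x. x \<in> carrier H \<Longrightarrow> fsum H (\<lambda>i. c i x \<odot>\<^bsub>H\<^esub> e i) I = x"
  using assms unfolding coord_basis_def by auto

lemma coord_basis_closed:
  "coord_basis K I H e c \<Longrightarrow> i \<in> I \<Longrightarrow> x \<in> carrier H \<Longrightarrow> c i x \<in> carrier K"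
  using module_hom_in[OF coord_basis_hom, of K I H e c i x] by simp

lemma coord_basis_add:
  "coord_basis K I H e c \<Longrightarrow> i \<in> I \<Longrightarrow> x \<in> carrier H \<Longrightarrow> y \<in> carrier H \<Longrightarrow>
   c i (x \<oplus>\<^bsub>H\<^esub> y) = c i x \<oplus>\<^bsub>K\<^esub> c i y"
  using module_hom_add[OF coord_basis_hom, of K I H e c i x y] by simp

lemma coord_basis_smult:
  "coord_basis K I H e c \<Longrightarrow> i \<in> I \<Longrightarrow> a \<in> carrier K \<Longrightarrow> x \<in> carrier H \<Longrightarrow>
   c i (a \<odot>\<^bsub>H\<^esub> x) = a \<otimes>\<^bsub>K\<^esub> c i x"
  using module_hom_smult[OF coord_basis_hom, of K I H e c i a x] by simp

text \<open>The free space on \<open>I\<close>: the basis vectors are Kronecker deltas, the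
  coordinates are evaluations.\<close>

lemma coord_basis_finite_functions:
  assumes K: "field K"
  shows "coord_basis K I (born_space I {F. F \<subseteq> I \<and> finite F} (self_space K))
           (\<lambda>j. \<lambda>i\<in>I. if i = j then \<one>\<^bsub>K\<^esub> else \<zero>\<^bsub>K\<^esub>) (\<lambda>i f. f i)"
    (is "coord_basis K I ?H ?e ?c")
proof -
  interpret K: field K by fact
  note S = vectorspace_self_space[OF K]
  have H: "vectorspace K ?H" using bornology_finite_subsets S by (rule vectorspace_born_space)
  have hom: "?c i \<in> module_hom K ?H (self_space K)" if "i \<in> I" for i
    using that by (intro module_homI) (auto simp: carrier_born_space_iff born_space_sel)
  have e: "?e j \<in> carrier ?H" if "j \<in> I" for j
    using that by (auto simp: carrier_born_space_iff intro: finite_subset[of _ "{j}"])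
  have "f = fsum ?H (\<lambda>i. f i \<odot>\<^bsub>?H\<^esub> ?e i) I" if f: "f \<in> carrier ?H" for f
  proof (rule extensionalityI[of _ I])
    have fK: "f i \<in> carrier K" if "i \<in> I" for i using f that by (simp add: carrier_born_space_iff)
    have t: "f i \<odot>\<^bsub>?H\<^esub> ?e i \<in> carrier ?H" if "i \<in> I" for i
      using fK[OF that] e[OF that] by (rule vs_smult_closed[OF H])
    have fin: "finite {i\<in>I. f i \<odot>\<^bsub>?H\<^esub> ?e i \<noteq> \<zero>\<^bsub>?H\<^esub>}"
    proof (rule finite_subset)
      show "{i\<in>I. f i \<odot>\<^bsub>?H\<^esub> ?e i \<noteq> \<zero>\<^bsub>?H\<^esub>} \<subseteq> {i\<in>I. f i \<noteq> \<zero>\<^bsub>K\<^esub>}"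
        using e by (auto simp: vs_zero_smult[OF H])
      show "finite {i\<in>I. f i \<noteq> \<zero>\<^bsub>K\<^esub>}" using f by (simp add: carrier_born_space_iff)
    qed
    show "f \<in> extensional I" using f by (simp add: carrier_born_space_iff)
    show "fsum ?H (\<lambda>i. f i \<odot>\<^bsub>?H\<^esub> ?e i) I \<in> extensional I"
    proof -
      have "fsum ?H (\<lambda>i. f i \<odot>\<^bsub>?H\<^esub> ?e i) I \<in> carrier ?H" by (rule fsum_closed[OF H t])
      then show ?thesis by (simp add: carrier_born_space_iff)
    qed
    fix j assume j: "j \<in> I"
    \<comment> \<open>The expansion is tested at each \<open>j\<close>: evaluation there is linear,
      passes under the sum and leaves a single nonzero term at most.\<close>
    have "fsum ?H (\<lambda>i. f i \<odot>\<^bsub>?H\<^esub> ?e i) I j =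
        fsum (self_space K) (\<lambda>i. (f i \<odot>\<^bsub>?H\<^esub> ?e i) j) I"
      by (rule fsum_hom[OF H S hom[OF j] t fin])
    also have "\<dots> = (f j \<odot>\<^bsub>?H\<^esub> ?e j) j"
      using j by (intro fsum_single[OF S]) (auto simp: born_space_sel fK)
    also have "\<dots> = f j" using j by (simp add: born_space_sel fK)
    finally show "f j = fsum ?H (\<lambda>i. f i \<odot>\<^bsub>?H\<^esub> ?e i) I j" by simp
  qed
  moreover have "finite {i\<in>I. f i \<noteq> \<zero>\<^bsub>K\<^esub>}" if "f \<in> carrier ?H" for f
    using that by (simp add: carrier_born_space_iff)
  ultimately show ?thesis
    unfolding coord_basis_def using H hom e by auto
qed

lemma coord_basis_transport:
  assumes b: "coord_basis K I H e c" and H': "vectorspace K H'"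
    and f: "f \<in> module_hom K H H'" "bij_betw f (carrier H) (carrier H')"
  shows "coord_basis K I H' (\<lambda>i. f (e i)) (\<lambda>i x. c i (inv_into (carrier H) f x))"
proof -
  let ?g = "inv_into (carrier H) f"
  note H = coord_basis_vectorspace[OF b]
  have g: "?g \<in> module_hom K H' H" using H f by (rule module_hom_inverse)
  have gf: "?g (f x) = x" if "x \<in> carrier H" for x
    using f(2) that by (simp add: bij_betw_def)
  have fg: "f (?g y) = y" if "y \<in> carrier H'" for y
    using f(2) that by (simp add: bij_betw_inv_into_right)
  have "y = fsum H' (\<lambda>i. c i (?g y) \<odot>\<^bsub>H'\<^esub> f (e i)) I" if y: "y \<in> carrier H'" for y
  proof -
    let ?x = "?g y"
    have x: "?x \<in> carrier H" using module_hom_in[OF g y] .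
    have t: "c i ?x \<odot>\<^bsub>H\<^esub> e i \<in> carrier H" if "i \<in> I" for i
      using that x by (simp add: vs_smult_closed[OF H] coord_basis_closed[OF b] coord_basis_in[OF b])
    have "y = f (fsum H (\<lambda>i. c i ?x \<odot>\<^bsub>H\<^esub> e i) I)"
      using coord_basis_expand[OF b x] fg[OF y] by simp
    also have "\<dots> = fsum H' (\<lambda>i. f (c i ?x \<odot>\<^bsub>H\<^esub> e i)) I"
    proof (rule fsum_hom[OF H H' f(1) t])
      show "finite {i\<in>I. c i ?x \<odot>\<^bsub>H\<^esub> e i \<noteq> \<zero>\<^bsub>H\<^esub>}"
        by (rule finite_subset[OF _ coord_basis_finite[OF b x]])
           (auto simp: vs_zero_smult[OF H] coord_basis_in[OF b])
    qed
    also have "\<dots> = fsum H' (\<lambda>i. c i ?x \<odot>\<^bsub>H'\<^esub> f (e i)) I"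
      using t x by (intro fsum_cong[OF H'])
        (auto simp: vs_smult_closed[OF H'] module_hom_in[OF f(1)] module_hom_smult[OF f(1)] coord_basis_closed[OF b]
          coord_basis_in[OF b])
    finally show ?thesis .
  qed
  then show ?thesis
    unfolding coord_basis_def
    using H' module_hom_comp[OF g coord_basis_hom[OF b]] coord_basis_finite[OF b]
    by (auto simp: gf module_hom_in[OF f(1)] module_hom_in[OF g] coord_basis_in[OF b]
        coord_basis_same[OF b] coord_basis_other[OF b])
qed

lemma (in grothendieck_universe) ex_coord_basis:
  assumes "field K" "small elts (carrier K)" "small elts I"
  shows "\<exists>H\<in>Vect K elts. \<exists>e c. coord_basis K I H e c"
proof -
  note b = coord_basis_finite_functions[OF assms(1), of I]
  have "small elts (carrier (born_space I {F. F \<subseteq> I \<and> finite F} (self_space K)))"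
    using assms by (intro small_born_space) simp_all
  from Vect_copy[OF coord_basis_vectorspace[OF b] this]
  obtain H f where "H \<in> Vect K elts"
    "f \<in> module_hom K (born_space I {F. F \<subseteq> I \<and> finite F} (self_space K)) H"
    "bij_betw f (carrier (born_space I {F. F \<subseteq> I \<and> finite F} (self_space K))) (carrier H)" by blast
  with coord_basis_transport[OF b _ this(2,3)] show ?thesis by (auto simp: Vect_def)
qed

definition lin_ext ::
    "'i set \<Rightarrow> ('k, 'v) module \<Rightarrow> ('i \<Rightarrow> 'v \<Rightarrow> 'k) \<Rightarrow> ('k, 'w) module \<Rightarrow> ('i \<Rightarrow> 'w) \<Rightarrow> 'v \<Rightarrow> 'w" where
  "lin_ext I H c W \<psi> = (\<lambda>x\<in>carrier H. fsum W (\<lambda>i. c i x \<odot>\<^bsub>W\<^esub> \<psi> i) I)"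

lemma lin_ext_in_Lin:
  assumes b: "coord_basis K I H e c" and W: "vectorspace K W"
    and \<psi>: "\<And>i. i \<in> I \<Longrightarrow> \<psi> i \<in> carrier W"
  shows "lin_ext I H c W \<psi> \<in> carrier (Lin K H W)"
  unfolding lin_ext_def
proof (rule restrict_in_Lin[OF coord_basis_vectorspace[OF b]], rule module_homI)
  note H = coord_basis_vectorspace[OF b]
  note cc = coord_basis_closed[OF b]
  have t: "c i x \<odot>\<^bsub>W\<^esub> \<psi> i \<in> carrier W" if "x \<in> carrier H" "i \<in> I" for i x
    using that by (simp add: vs_smult_closed[OF W] cc \<psi>)
  have fin: "finite {i\<in>I. c i x \<odot>\<^bsub>W\<^esub> \<psi> i \<noteq> \<zero>\<^bsub>W\<^esub>}" if x: "x \<in> carrier H" for x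
    by (rule finite_subset[OF _ coord_basis_finite[OF b x]]) (auto simp: vs_zero_smult[OF W] \<psi>)
  show "fsum W (\<lambda>i. c i x \<odot>\<^bsub>W\<^esub> \<psi> i) I \<in> carrier W" if "x \<in> carrier H" for x
    using fsum_closed[OF W t[OF that]] .
  show "fsum W (\<lambda>i. c i (x \<oplus>\<^bsub>H\<^esub> y) \<odot>\<^bsub>W\<^esub> \<psi> i) I =
      fsum W (\<lambda>i. c i x \<odot>\<^bsub>W\<^esub> \<psi> i) I \<oplus>\<^bsub>W\<^esub> fsum W (\<lambda>i. c i y \<odot>\<^bsub>W\<^esub> \<psi> i) I"
    if "x \<in> carrier H" "y \<in> carrier H" for x y
  proof -
    have "fsum W (\<lambda>i. c i (x \<oplus>\<^bsub>H\<^esub> y) \<odot>\<^bsub>W\<^esub> \<psi> i) I =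
        fsum W (\<lambda>i. c i x \<odot>\<^bsub>W\<^esub> \<psi> i \<oplus>\<^bsub>W\<^esub> c i y \<odot>\<^bsub>W\<^esub> \<psi> i) I"
      using that by (intro fsum_cong[OF W])
        (auto simp: t vs_add_closed[OF H] vs_add_closed[OF W] coord_basis_add[OF b] vs_smult_l_distr[OF W] cc \<psi>)
    then show ?thesis using fsum_add[OF W t fin t fin] that by simp
  qed
  show "fsum W (\<lambda>i. c i (a \<odot>\<^bsub>H\<^esub> x) \<odot>\<^bsub>W\<^esub> \<psi> i) I = a \<odot>\<^bsub>W\<^esub> fsum W (\<lambda>i. c i x \<odot>\<^bsub>W\<^esub> \<psi> i) I"
    if a: "a \<in> carrier K" and x: "x \<in> carrier H" for a x
  proof -
    have "a \<odot>\<^bsub>W\<^esub> fsum W (\<lambda>i. c i x \<odot>\<^bsub>W\<^esub> \<psi> i) I =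
        fsum W (\<lambda>i. a \<odot>\<^bsub>W\<^esub> (c i x \<odot>\<^bsub>W\<^esub> \<psi> i)) I"
      using fsum_smult[OF W a t[OF x] fin[OF x]] by simp
    also have "\<dots> = fsum W (\<lambda>i. c i (a \<odot>\<^bsub>H\<^esub> x) \<odot>\<^bsub>W\<^esub> \<psi> i) I"
      using a x by (intro fsum_cong[OF W])
        (auto simp: t vs_smult_closed[OF W] coord_basis_smult[OF b] vs_smult_assoc[OF W] cc \<psi>)
    finally show ?thesis by simp
  qed
qed

lemma lin_ext_basis:
  assumes b: "coord_basis K I H e c" and W: "vectorspace K W"
    and \<psi>: "\<And>i. i \<in> I \<Longrightarrow> \<psi> i \<in> carrier W" and j: "j \<in> I"
  shows "lin_ext I H c W \<psi> (e j) = \<psi> j"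
proof -
  interpret K: field K using W by (rule vectorspace_field)
  have "fsum W (\<lambda>i. c i (e j) \<odot>\<^bsub>W\<^esub> \<psi> i) I = c j (e j) \<odot>\<^bsub>W\<^esub> \<psi> j"
    using j by (intro fsum_single[OF W])
      (auto simp: coord_basis_same[OF b] coord_basis_other[OF b] vs_simps[OF W] \<psi>)
  then show ?thesis
    using j by (simp add: lin_ext_def coord_basis_in[OF b] coord_basis_same[OF b]
      vs_one_smult[OF W] \<psi>)
qed

lemma module_hom_expand:
  assumes b: "coord_basis K I H e c" and W: "vectorspace K W" and f: "f \<in> module_hom K H W"
    and x: "x \<in> carrier H"
  shows "f x = fsum W (\<lambda>i. c i x \<odot>\<^bsub>W\<^esub> f (e i)) I"
proof -
  note H = coord_basis_vectorspace[OF b]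
  have t: "c i x \<odot>\<^bsub>H\<^esub> e i \<in> carrier H" if "i \<in> I" for i
    using that x by (simp add: vs_smult_closed[OF H] coord_basis_closed[OF b] coord_basis_in[OF b])
  have "f x = f (fsum H (\<lambda>i. c i x \<odot>\<^bsub>H\<^esub> e i) I)" using coord_basis_expand[OF b x] by simp
  also have "\<dots> = fsum W (\<lambda>i. f (c i x \<odot>\<^bsub>H\<^esub> e i)) I"
  proof (rule fsum_hom[OF H W f t])
    show "finite {i\<in>I. c i x \<odot>\<^bsub>H\<^esub> e i \<noteq> \<zero>\<^bsub>H\<^esub>}"
      by (rule finite_subset[OF _ coord_basis_finite[OF b x]])
         (auto simp: vs_zero_smult[OF H] coord_basis_in[OF b])
  qed
  also have "\<dots> = fsum W (\<lambda>i. c i x \<odot>\<^bsub>W\<^esub> f (e i)) I"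
    using t x by (intro fsum_cong[OF W])
      (auto simp: vs_smult_closed[OF W] module_hom_in[OF f] module_hom_smult[OF f] coord_basis_closed[OF b]
        coord_basis_in[OF b])
  finally show ?thesis .
qed

lemma Lin_eq_on_basis:
  assumes b: "coord_basis K I H e c" and W: "vectorspace K W"
    and f: "f \<in> carrier (Lin K H W)" and g: "g \<in> carrier (Lin K H W)"
    and eq: "\<And>i. i \<in> I \<Longrightarrow> f (e i) = g (e i)"
  shows "f = g"
proof (rule Lin_eqI[OF f g])
  fix x assume x: "x \<in> carrier H"
  have hom: "f \<in> module_hom K H W" "g \<in> module_hom K H W"
    using f g by (simp_all add: carrier_Lin_iff)
  show "f x = g x"
    unfolding module_hom_expand[OF b W hom(1) x] module_hom_expand[OF b W hom(2) x]
    using x eq by (intro fsum_cong[OF W])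
      (auto simp: vs_smult_closed[OF W] coord_basis_closed[OF b] coord_basis_in[OF b]
        module_hom_in[OF hom(2)])
qed

section \<open>Tensor products of small vector spaces\<close>

locale vect_universe = grothendieck_universe elts for elts :: "'u \<Rightarrow> 'u set" +
  fixes K :: "'k ring"
  assumes field_K: "field K" and small_K: "small elts (carrier K)"
begin

lemma vectorspace_if_Vect: "V \<in> Vect K elts \<Longrightarrow> vectorspace K V"
  by (simp add: Vect_def)

lemma small_carrier_if_Vect: "V \<in> Vect K elts \<Longrightarrow> small elts (carrier V)"
  by (auto simp: Vect_def small_elts)

text \<open>
  The tensor product is the image of the free space on \<open>V \<times> W\<close> in the product of the spaces \<open>Z\<close> over all
  bilinear maps into small \<open>Z\<close>. The index set is not small but the image is, and the map induced by
  a bilinear map is a coordinate projection.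
\<close>

lemma ex_tensor_product:
  assumes V: "V \<in> Vect K elts" and W: "W \<in> Vect K elts"
  shows "\<exists>T t. is_tensor_product K elts V W T t"
proof -
  note vsV = vectorspace_if_Vect[OF V] and vsW = vectorspace_if_Vect[OF W]
  let ?P = "carrier V \<times> carrier W"
  obtain H e c where H: "H \<in> Vect K elts" and b: "coord_basis K ?P H e c"
    using ex_coord_basis[OF field_K small_K, of ?P]
      small_Times[OF small_carrier_if_Vect[OF V] small_carrier_if_Vect[OF W]] by blast
  note vsH = vectorspace_if_Vect[OF H]
  define I where "I = {(Z, \<beta>). Z \<in> Vect K elts \<and> \<beta> \<in> bilinear_maps K V W Z}"
  define L where "L p = lin_ext ?P H c (fst p) (\<lambda>(v, w). snd p v w)"
    for p :: "('k, 'u) module \<times> ('u \<Rightarrow> 'u \<Rightarrow> 'u)"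
  \<comment> \<open>\<open>\<Phi> h\<close> lists the values at \<open>h\<close> of the linear maps
    induced by all bilinear maps. Two elements of the free space get the same image exactly if no
    bilinear map into a small space separates them, so the image does the work of a quotient by the
    bilinearity relations.\<close>
  define \<Phi> where "\<Phi> h = (\<lambda>p\<in>I. L p h)" for h
  have vsI: "vectorspace K (fst p)" if "p \<in> I" for p
    using that by (auto simp: I_def vectorspace_if_Vect)
  have snd_in: "snd p v w \<in> carrier (fst p)" if "p \<in> I" "v \<in> carrier V" "w \<in> carrier W" for p v w
    using that module_hom_in[of "snd p v" K W "fst p" w] by (auto simp: I_def bilinear_maps_def)
  have L: "L p \<in> carrier (Lin K H (fst p))" if "p \<in> I" for p
    unfolding L_def using snd_in[OF that] by (intro lin_ext_in_Lin[OF b vsI[OF that]]) auto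
  have L_hom: "L p \<in> module_hom K H (fst p)" if "p \<in> I" for p
    using L[OF that] by (simp add: carrier_Lin_iff)
  have L_e: "L p (e (v, w)) = snd p v w" if "p \<in> I" "v \<in> carrier V" "w \<in> carrier W" for p v w
    unfolding L_def using snd_in[OF that(1)] that(2,3)
    by (subst lin_ext_basis[OF b vsI[OF that(1)]]) auto
  define T0 where "T0 = pointwise I fst (\<Phi> ` carrier H)"
  have \<Phi>_add: "\<Phi> (x \<oplus>\<^bsub>H\<^esub> y) = (\<lambda>p\<in>I. \<Phi> x p \<oplus>\<^bsub>fst p\<^esub> \<Phi> y p)"
    if "x \<in> carrier H" "y \<in> carrier H" for x y
    using that by (auto simp: \<Phi>_def module_hom_add[OF L_hom] intro!: restrict_ext)
  have \<Phi>_smult: "\<Phi> (a \<odot>\<^bsub>H\<^esub> x) = (\<lambda>p\<in>I. a \<odot>\<^bsub>fst p\<^esub> \<Phi> x p)"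
    if "a \<in> carrier K" "x \<in> carrier H" for a x
    using that by (auto simp: \<Phi>_def module_hom_smult[OF L_hom] intro!: restrict_ext)
  have vsT0: "vectorspace K T0"
    unfolding T0_def
  proof (rule vectorspace_pointwise[OF field_K vsI])
    show "\<Phi> ` carrier H \<subseteq> (\<Pi>\<^sub>E i\<in>I. carrier (fst i))"
      unfolding \<Phi>_def using module_hom_in[OF L_hom] by fastforce
    have "(\<lambda>i\<in>I. \<zero>\<^bsub>fst i\<^esub>) = \<Phi> \<zero>\<^bsub>H\<^esub>"
      by (auto simp: \<Phi>_def module_hom_zero[OF vsH vsI L_hom] intro!: restrict_ext)
    then show "(\<lambda>i\<in>I. \<zero>\<^bsub>fst i\<^esub>) \<in> \<Phi> ` carrier H" using vs_zero_closed[OF vsH] by blast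
    show "(\<lambda>i\<in>I. f i \<oplus>\<^bsub>fst i\<^esub> g i) \<in> \<Phi> ` carrier H"
      if "f \<in> \<Phi> ` carrier H" "g \<in> \<Phi> ` carrier H" for f g
      using that by (auto simp: \<Phi>_add[symmetric] vs_add_closed[OF vsH])
    show "(\<lambda>i\<in>I. a \<odot>\<^bsub>fst i\<^esub> f i) \<in> \<Phi> ` carrier H"
      if "a \<in> carrier K" "f \<in> \<Phi> ` carrier H" for a f
      using that by (auto simp: \<Phi>_smult[symmetric] vs_smult_closed[OF vsH])
  qed
  have \<Phi>_hom: "\<Phi> \<in> module_hom K H T0"
    by (rule module_homI) (auto simp: T0_def \<Phi>_add \<Phi>_smult)
  have "small elts (carrier T0)"
    by (simp add: T0_def small_image[OF small_carrier_if_Vect[OF H]])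
  then obtain T f where T: "T \<in> Vect K elts" and f: "f \<in> module_hom K T0 T"
    and f_bij: "bij_betw f (carrier T0) (carrier T)"
    using Vect_copy[OF vsT0] by blast
  note vsT = vectorspace_if_Vect[OF T]
  define g where "g = inv_into (carrier T0) f"
  have g_hom: "g \<in> module_hom K T T0"
    unfolding g_def using vsT0 f f_bij by (rule module_hom_inverse)
  have gf: "g (f x) = x" if "x \<in> carrier T0" for x
    using f_bij that by (simp add: bij_betw_def g_def)
  define t where "t v w = f (\<Phi> (e (v, w)))" for v w
  have f\<Phi>: "(\<lambda>x. f (\<Phi> x)) \<in> module_hom K H T" using \<Phi>_hom f by (rule module_hom_comp)
  have \<Phi>e: "\<Phi> (e (v, w)) = (\<lambda>p\<in>I. snd p v w)" if "v \<in> carrier V" "w \<in> carrier W" for v w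
    using that by (auto simp: \<Phi>_def L_e intro!: restrict_ext)
  have e_in: "e (v, w) \<in> carrier H" if "v \<in> carrier V" "w \<in> carrier W" for v w
    using coord_basis_in[OF b] that by simp
  have \<Phi>e_in: "\<Phi> (e (v, w)) \<in> carrier T0" if "v \<in> carrier V" "w \<in> carrier W" for v w
    using e_in[OF that] by (rule module_hom_in[OF \<Phi>_hom])
  have bil: "v \<in> carrier V \<Longrightarrow> snd p v \<in> module_hom K W (fst p)"
    "w \<in> carrier W \<Longrightarrow> (\<lambda>v. snd p v w) \<in> module_hom K V (fst p)" if "p \<in> I" for p v w
    using that by (auto simp: I_def bilinear_maps_def)
  \<comment> \<open>In the coordinate \<open>p\<close> the element \<open>\<Phi> (e (v, w))\<close>
    is \<open>snd p v w\<close>, so bilinearity of \<open>t\<close> is that of every bilinear map in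
    the index set.\<close>
  have "t \<in> bilinear_maps K V W T"
  proof -
    have "\<Phi> (e (v, w \<oplus>\<^bsub>W\<^esub> w')) = \<Phi> (e (v, w)) \<oplus>\<^bsub>T0\<^esub> \<Phi> (e (v, w'))"
      if "v \<in> carrier V" "w \<in> carrier W" "w' \<in> carrier W" for v w w'
      using that vs_add_closed[OF vsW]
      by (simp add: \<Phi>e T0_def module_hom_add[OF bil(1)] cong: restrict_cong)
    moreover have "\<Phi> (e (v \<oplus>\<^bsub>V\<^esub> v', w)) = \<Phi> (e (v, w)) \<oplus>\<^bsub>T0\<^esub> \<Phi> (e (v', w))"
      if "v \<in> carrier V" "v' \<in> carrier V" "w \<in> carrier W" for v v' w
      using that vs_add_closed[OF vsV]
      by (simp add: \<Phi>e T0_def module_hom_add[OF bil(2)] cong: restrict_cong)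
    moreover have "\<Phi> (e (v, a \<odot>\<^bsub>W\<^esub> w)) = a \<odot>\<^bsub>T0\<^esub> \<Phi> (e (v, w))"
      if "v \<in> carrier V" "w \<in> carrier W" "a \<in> carrier K" for v w a
      using that vs_smult_closed[OF vsW]
      by (simp add: \<Phi>e T0_def module_hom_smult[OF bil(1)] cong: restrict_cong)
    moreover have "\<Phi> (e (a \<odot>\<^bsub>V\<^esub> v, w)) = a \<odot>\<^bsub>T0\<^esub> \<Phi> (e (v, w))"
      if "v \<in> carrier V" "w \<in> carrier W" "a \<in> carrier K" for v w a
      using that vs_smult_closed[OF vsV]
      by (simp add: \<Phi>e T0_def module_hom_smult[OF bil(2)] cong: restrict_cong)
    ultimately show ?thesis
      unfolding bilinear_maps_def t_def
      by (auto intro!: module_homI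
          simp: \<Phi>e_in module_hom_in[OF f] module_hom_add[OF f] module_hom_smult[OF f])
  qed
  moreover have "\<exists>!h. h \<in> carrier (Lin K T Z) \<and> (\<forall>v\<in>carrier V. \<forall>w\<in>carrier W. h (t v w) = \<beta> v w)"
    if Z: "Z \<in> Vect K elts" and \<beta>: "\<beta> \<in> bilinear_maps K V W Z" for Z \<beta>
  proof (rule ex_ex1I)
    have I: "(Z, \<beta>) \<in> I" using Z \<beta> by (simp add: I_def)
    have "(\<lambda>\<phi>. \<phi> (Z, \<beta>)) \<in> module_hom K T0 Z"
      using I module_hom_in[OF L_hom[OF I]]
      by (intro module_homI) (auto simp: T0_def \<Phi>_def)
    from module_hom_comp[OF g_hom this]
    have "(\<lambda>x\<in>carrier T. g x (Z, \<beta>)) \<in> carrier (Lin K T Z)" by (rule restrict_in_Lin[OF vsT])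
    then show "\<exists>h. h \<in> carrier (Lin K T Z) \<and> (\<forall>v\<in>carrier V. \<forall>w\<in>carrier W. h (t v w) = \<beta> v w)"
      using I by (intro exI[of _ "\<lambda>x\<in>carrier T. g x (Z, \<beta>)"])
        (simp add: t_def gf \<Phi>e_in module_hom_in[OF f], simp add: \<Phi>e)
  next
    note vsZ = vectorspace_if_Vect[OF Z]
    fix h h'
    assume h: "h \<in> carrier (Lin K T Z) \<and> (\<forall>v\<in>carrier V. \<forall>w\<in>carrier W. h (t v w) = \<beta> v w)"
      and h': "h' \<in> carrier (Lin K T Z) \<and> (\<forall>v\<in>carrier V. \<forall>w\<in>carrier W. h' (t v w) = \<beta> v w)"
    \<comment> \<open>Uniqueness is checked after pulling back to the free space: the pullbacks
      agree on the basis, whose images are the pure tensors, and the map from the free space to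
      \<open>T\<close> is onto.\<close>
    have "(\<lambda>x\<in>carrier H. h (f (\<Phi> x))) = (\<lambda>x\<in>carrier H. h' (f (\<Phi> x)))"
    proof (rule Lin_eq_on_basis[OF b vsZ])
      show "(\<lambda>x\<in>carrier H. h (f (\<Phi> x))) \<in> carrier (Lin K H Z)"
        "(\<lambda>x\<in>carrier H. h' (f (\<Phi> x))) \<in> carrier (Lin K H Z)"
        using module_hom_comp[OF f\<Phi>, of h Z] module_hom_comp[OF f\<Phi>, of h' Z] h h'
        by (simp_all add: restrict_in_Lin[OF vsH] carrier_Lin_iff[of _ K T])
    qed (use h h' in \<open>auto simp: e_in t_def\<close>)
    then have eq: "h (f (\<Phi> x)) = h' (f (\<Phi> x))" if "x \<in> carrier H" for x
      using that by (metis restrict_apply')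
    have surj: "carrier T = (\<lambda>x. f (\<Phi> x)) ` carrier H"
      using f_bij by (auto simp: bij_betw_def T0_def)
    show "h = h'" using h h' eq surj by (intro Lin_eqI[of h K T Z h']) auto
  qed
  ultimately have "is_tensor_product K elts V W T t" using T by (simp add: is_tensor_product_def)
  then show ?thesis by blast
qed

text \<open>\<open>tensor\<close> is an arbitrary choice; what is known about it from here on is the
  universal property with respect to small targets.\<close>

lemma is_tensor_product_tensor:
  assumes "V \<in> Vect K elts" "W \<in> Vect K elts"
  shows "is_tensor_product K elts V W (tensor K elts V W) (pure_tensor K elts V W)"
proof -
  have "\<exists>p. is_tensor_product K elts V W (fst p) (snd p)" using ex_tensor_product[OF assms] by simp
  from someI_ex[OF this] show ?thesis
    by (simp add: tensor_def pure_tensor_def tensor_choice_def)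
qed

section \<open>Consequences of the universal property\<close>

context
  fixes V W assumes V: "V \<in> Vect K elts" and W: "W \<in> Vect K elts"
begin

lemma tensor_in_Vect: "tensor K elts V W \<in> Vect K elts"
  using is_tensor_product_tensor[OF V W] by (simp add: is_tensor_product_def)

lemma vectorspace_tensor: "vectorspace K (tensor K elts V W)"
  using tensor_in_Vect by (rule vectorspace_if_Vect)

lemma pure_tensor_hom_right:
  "v \<in> carrier V \<Longrightarrow> pure_tensor K elts V W v \<in> module_hom K W (tensor K elts V W)"
  using is_tensor_product_tensor[OF V W] by (auto simp: is_tensor_product_def bilinear_maps_def)

lemma pure_tensor_hom_left:
  "w \<in> carrier W \<Longrightarrow> (\<lambda>v. pure_tensor K elts V W v w) \<in> module_hom K V (tensor K elts V W)"
  using is_tensor_product_tensor[OF V W] by (auto simp: is_tensor_product_def bilinear_maps_def)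

lemma pure_tensor_in:
  "v \<in> carrier V \<Longrightarrow> w \<in> carrier W \<Longrightarrow> pure_tensor K elts V W v w \<in> carrier (tensor K elts V W)"
  using pure_tensor_hom_right by (rule module_hom_in)

lemma pure_tensor_zero:
  "w \<in> carrier W \<Longrightarrow> pure_tensor K elts V W \<zero>\<^bsub>V\<^esub> w = \<zero>\<^bsub>tensor K elts V W\<^esub>"
  "v \<in> carrier V \<Longrightarrow> pure_tensor K elts V W v \<zero>\<^bsub>W\<^esub> = \<zero>\<^bsub>tensor K elts V W\<^esub>"
  using module_hom_zero[OF _ vectorspace_tensor pure_tensor_hom_left]
    module_hom_zero[OF _ vectorspace_tensor pure_tensor_hom_right] V W
  by (auto simp: vectorspace_if_Vect)

lemma tensor_lift:
  assumes "Z \<in> Vect K elts" "\<beta> \<in> bilinear_maps K V W Z"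
  shows "\<exists>!h. h \<in> carrier (Lin K (tensor K elts V W) Z) \<and>
           (\<forall>v\<in>carrier V. \<forall>w\<in>carrier W. h (pure_tensor K elts V W v w) = \<beta> v w)"
  using is_tensor_product_tensor[OF V W] assms by (simp add: is_tensor_product_def)

text \<open>The uniqueness half of the universal property, made applicable to maps that need not be
  extensional: it is applied to their restrictions to the carrier.\<close>

lemma tensor_hom_eqI:
  assumes Z: "Z \<in> Vect K elts"
    and f: "f \<in> module_hom K (tensor K elts V W) Z" and g: "g \<in> module_hom K (tensor K elts V W) Z"
    and eq: "\<And>v w. v \<in> carrier V \<Longrightarrow> w \<in> carrier W \<Longrightarrow>
      f (pure_tensor K elts V W v w) = g (pure_tensor K elts V W v w)"
    and t: "t \<in> carrier (tensor K elts V W)"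
  shows "f t = g t"
proof -
  let ?T = "carrier (tensor K elts V W)"
  have "(\<lambda>v w. f (pure_tensor K elts V W v w)) \<in> bilinear_maps K V W Z"
    using module_hom_comp[OF pure_tensor_hom_left f] module_hom_comp[OF pure_tensor_hom_right f]
    by (auto simp: bilinear_maps_def)
  note ex1 = tensor_lift[OF Z this]
  note the_eq = the1_equality[OF ex1, OF conjI]
  have "restrict f ?T = restrict g ?T"
    by (rule trans[OF the_eq[symmetric] the_eq])
       (auto simp: eq pure_tensor_in intro: restrict_in_Lin[OF vectorspace_tensor] f g)
  then show ?thesis using t by (metis restrict_apply')
qed

end

text \<open>Since \<open>f\<close> and \<open>g\<close> are linear, the right-hand side of the
  second claim is bilinear in \<open>v\<close> and \<open>w\<close>. Its lift exists and is unique,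
  which gives the description in \<open>tensor_map\<close> its meaning.\<close>

lemma
  assumes V: "V \<in> Vect K elts" and W: "W \<in> Vect K elts"
    and V': "V' \<in> Vect K elts" and W': "W' \<in> Vect K elts"
    and f: "f \<in> carrier (Lin K V V')" and g: "g \<in> carrier (Lin K W W')"
  shows tensor_map_in_Lin: "tensor_map K elts V W V' W' f g
      \<in> carrier (Lin K (tensor K elts V W) (tensor K elts V' W'))"
    and tensor_map_pure: "v \<in> carrier V \<Longrightarrow> w \<in> carrier W \<Longrightarrow>
      tensor_map K elts V W V' W' f g (pure_tensor K elts V W v w) =
      pure_tensor K elts V' W' (f v) (g w)"
proof -
  have hom: "f \<in> module_hom K V V'" "g \<in> module_hom K W W'" using f g by (simp_all add: carrier_Lin_iff)
  have "(\<lambda>v w. pure_tensor K elts V' W' (f v) (g w)) \<in> bilinear_maps K V W (tensor K elts V' W')"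
    using module_hom_comp[OF hom(1) pure_tensor_hom_left[OF V' W']]
      module_hom_comp[OF hom(2) pure_tensor_hom_right[OF V' W']]
    by (auto simp: bilinear_maps_def module_hom_in[OF hom(1)] module_hom_in[OF hom(2)])
  from theI'[OF tensor_lift[OF V W tensor_in_Vect[OF V' W'] this]]
  show "tensor_map K elts V W V' W' f g
      \<in> carrier (Lin K (tensor K elts V W) (tensor K elts V' W'))"
    "v \<in> carrier V \<Longrightarrow> w \<in> carrier W \<Longrightarrow>
      tensor_map K elts V W V' W' f g (pure_tensor K elts V W v w) =
      pure_tensor K elts V' W' (f v) (g w)"
    by (auto simp: tensor_map_def)
qed

text \<open>
  Coordinates on \<open>H \<otimes> V\<close> come from a linear map to the space of finitely supported families
  in \<open>V\<close>; landing there is what makes the expansion finite without decomposing into pure tensors.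
\<close>

lemma ex_tensor_coordinates:
  assumes H: "H \<in> Vect K elts" and b: "coord_basis K I H e c" and I: "small elts I"
    and V: "V \<in> Vect K elts"
  shows "\<exists>q. (\<forall>i\<in>I. q i \<in> module_hom K (tensor K elts H V) V \<and>
        (\<forall>x\<in>carrier H. \<forall>v\<in>carrier V. q i (pure_tensor K elts H V x v) = c i x \<odot>\<^bsub>V\<^esub> v)) \<and>
      (\<forall>t\<in>carrier (tensor K elts H V). finite {i\<in>I. q i t \<noteq> \<zero>\<^bsub>V\<^esub>} \<and>
        fsum (tensor K elts H V) (\<lambda>i. pure_tensor K elts H V (e i) (q i t)) I = t)"
proof -
  let ?T = "tensor K elts H V" and ?p = "pure_tensor K elts H V"
  let ?B = "born_space I {F. F \<subseteq> I \<and> finite F} V"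
  note vsV = vectorspace_if_Vect[OF V] and vsH = vectorspace_if_Vect[OF H]
    and vsT = vectorspace_tensor[OF H V]
  have vsB: "vectorspace K ?B" using bornology_finite_subsets vsV by (rule vectorspace_born_space)
  \<comment> \<open>The elements of the direct sum are functions, whereas the universal property
    speaks of targets in \<open>Vect\<close>. The detour over a copy \<open>Z\<close> reconciles the
    two.\<close>
  obtain Z f where Z: "Z \<in> Vect K elts" and f: "f \<in> module_hom K ?B Z"
    and f_bij: "bij_betw f (carrier ?B) (carrier Z)"
    using Vect_copy[OF vsB small_born_space[OF I small_carrier_if_Vect[OF V]]] by blast
  let ?g = "inv_into (carrier ?B) f"
  have g: "?g \<in> module_hom K Z ?B" using vsB f f_bij by (rule module_hom_inverse)
  have gf: "?g (f x) = x" if "x \<in> carrier ?B" for x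
    using f_bij that by (simp add: bij_betw_def)
  note cc = coord_basis_closed[OF b]
  \<comment> \<open>The coordinates that the tensor of \<open>x\<close> and \<open>v\<close> ought
    to have; finitely many are nonzero because this holds for the coordinates of
    \<open>x\<close>.\<close>
  define \<beta> where "\<beta> x v = (\<lambda>i\<in>I. c i x \<odot>\<^bsub>V\<^esub> v)" for x v
  have \<beta>_in: "\<beta> x v \<in> carrier ?B" if "x \<in> carrier H" "v \<in> carrier V" for x v
  proof -
    have "finite {i\<in>I. \<beta> x v i \<noteq> \<zero>\<^bsub>V\<^esub>}"
      by (rule finite_subset[OF _ coord_basis_finite[OF b that(1)]])
         (auto simp: \<beta>_def vs_zero_smult[OF vsV] that)
    then show ?thesis using that
      by (auto simp: carrier_born_space_iff \<beta>_def cc vs_smult_closed[OF vsV])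
  qed
  interpret K: field K by (rule field_K)
  have "(\<lambda>x. \<beta> x v) \<in> module_hom K H ?B" if "v \<in> carrier V" for v
    using that \<beta>_in
    by (intro module_homI) (auto simp: born_space_sel \<beta>_def coord_basis_add[OF b]
      coord_basis_smult[OF b] vs_smult_l_distr[OF vsV] vs_smult_assoc[OF vsV] cc intro!: restrict_ext)
  moreover have "\<beta> x \<in> module_hom K V ?B" if "x \<in> carrier H" for x
    using that \<beta>_in
    by (intro module_homI) (auto simp: born_space_sel \<beta>_def vs_smult_r_distr[OF vsV]
      vs_smult_assoc[OF vsV, symmetric] cc K.m_comm intro!: restrict_ext)
  ultimately have "(\<lambda>x v. f (\<beta> x v)) \<in> bilinear_maps K H V Z"
    using module_hom_comp[OF _ f] by (auto simp: bilinear_maps_def)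
  then obtain h where h: "h \<in> carrier (Lin K ?T Z)"
    and h_pure: "\<And>x v. x \<in> carrier H \<Longrightarrow> v \<in> carrier V \<Longrightarrow> h (?p x v) = f (\<beta> x v)"
    using tensor_lift[OF H V Z] by blast
  define Q where "Q t = ?g (h t)" for t
  have Q: "Q \<in> module_hom K ?T ?B"
    unfolding Q_def using h g module_hom_comp by (auto simp: carrier_Lin_iff)
  have Q_pure: "Q (?p x v) = \<beta> x v" if "x \<in> carrier H" "v \<in> carrier V" for x v
    using that by (simp add: Q_def h_pure gf \<beta>_in)
  have Qt: "Q t i \<in> carrier V"
    if "t \<in> carrier ?T" "i \<in> I" for t i
    using module_hom_in[OF Q that(1)] that(2) by (auto simp: carrier_born_space_iff)
  have Qfin: "finite {i\<in>I. Q t i \<noteq> \<zero>\<^bsub>V\<^esub>}" if "t \<in> carrier ?T" for t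
    using module_hom_in[OF Q that(1)] by (auto simp: carrier_born_space_iff)
  \<comment> \<open>\<open>R\<close> reassembles a tensor from its coordinates; it is linear on the
    direct sum since all supports there are finite.\<close>
  define R where "R \<phi> = fsum ?T (\<lambda>i. ?p (e i) (\<phi> i)) I" for \<phi>
  note e = coord_basis_in[OF b]
  note pr = pure_tensor_hom_right[OF H V e]
  have pfin: "finite {i\<in>I. ?p (e i) (\<phi> i) \<noteq> \<zero>\<^bsub>?T\<^esub>}" if "\<phi> \<in> carrier ?B" for \<phi>
    by (rule finite_subset[of _ "{i\<in>I. \<phi> i \<noteq> \<zero>\<^bsub>V\<^esub>}"])
       (use that in \<open>auto simp: carrier_born_space_iff pure_tensor_zero[OF H V] e\<close>)
  have pin: "?p (e i) (\<phi> i) \<in> carrier ?T" if "\<phi> \<in> carrier ?B" "i \<in> I" for \<phi> i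
    using that by (auto simp: carrier_born_space_iff pure_tensor_in[OF H V] e)
  have R: "R \<in> module_hom K ?B ?T"
  proof (rule module_homI)
    show "R \<phi> \<in> carrier ?T" if "\<phi> \<in> carrier ?B" for \<phi>
      unfolding R_def using fsum_closed[OF vsT pin[OF that]] .
    show "R (\<phi> \<oplus>\<^bsub>?B\<^esub> \<psi>) = R \<phi> \<oplus>\<^bsub>?T\<^esub> R \<psi>" if "\<phi> \<in> carrier ?B" "\<psi> \<in> carrier ?B" for \<phi> \<psi>
    proof -
      have "R (\<phi> \<oplus>\<^bsub>?B\<^esub> \<psi>) = fsum ?T (\<lambda>i. ?p (e i) (\<phi> i) \<oplus>\<^bsub>?T\<^esub> ?p (e i) (\<psi> i)) I"
        unfolding R_def using pin[OF vs_add_closed[OF vsB that]] that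
        by (intro fsum_cong[OF vsT])
           (auto simp: born_space_sel carrier_born_space_iff module_hom_add[OF pr])
      then show ?thesis
        unfolding R_def using fsum_add[OF vsT pin pfin pin pfin] that by simp
    qed
    show "R (a \<odot>\<^bsub>?B\<^esub> \<phi>) = a \<odot>\<^bsub>?T\<^esub> R \<phi>" if a: "a \<in> carrier K" and \<phi>: "\<phi> \<in> carrier ?B" for a \<phi>
    proof -
      have "R (a \<odot>\<^bsub>?B\<^esub> \<phi>) = fsum ?T (\<lambda>i. a \<odot>\<^bsub>?T\<^esub> ?p (e i) (\<phi> i)) I"
        unfolding R_def using pin[OF vs_smult_closed[OF vsB a \<phi>]] a \<phi>
        by (intro fsum_cong[OF vsT])
           (auto simp: born_space_sel carrier_born_space_iff module_hom_smult[OF pr])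
      then show ?thesis
        unfolding R_def using fsum_smult[OF vsT a pin[OF \<phi>] pfin[OF \<phi>]] by simp
    qed
  qed
  \<comment> \<open>Both sides are linear in \<open>t\<close>, so pure tensors suffice. For these it
    is the expansion of \<open>x\<close> in the basis, carried through the linear map that tensors
    with \<open>v\<close>, with the scalars then moved to the second factor.\<close>
  have RQ: "R (Q t) = t" if t: "t \<in> carrier ?T" for t
  proof (rule tensor_hom_eqI[OF H V tensor_in_Vect[OF H V] module_hom_comp[OF Q R] _ _ t])
    show "(\<lambda>t. t) \<in> module_hom K ?T ?T" by (rule module_homI) auto
    fix x v assume x: "x \<in> carrier H" and v: "v \<in> carrier V"
    have ce: "c i x \<odot>\<^bsub>H\<^esub> e i \<in> carrier H" if "i \<in> I" for i
      using that x by (simp add: vs_smult_closed[OF vsH] cc e)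
    have "?p x v = ?p (fsum H (\<lambda>i. c i x \<odot>\<^bsub>H\<^esub> e i) I) v" using coord_basis_expand[OF b x] by simp
    also have "\<dots> = fsum ?T (\<lambda>i. ?p (c i x \<odot>\<^bsub>H\<^esub> e i) v) I"
    proof (rule fsum_hom[OF vsH vsT pure_tensor_hom_left[OF H V v] ce])
      show "finite {i\<in>I. c i x \<odot>\<^bsub>H\<^esub> e i \<noteq> \<zero>\<^bsub>H\<^esub>}"
        by (rule finite_subset[OF _ coord_basis_finite[OF b x]])
           (auto simp: vs_zero_smult[OF vsH] e)
    qed
    also have "\<dots> = R (Q (?p x v))"
      unfolding R_def Q_pure[OF x v]
      using x v ce by (intro fsum_cong[OF vsT])
        (auto simp: \<beta>_def pure_tensor_in[OF H V] vs_smult_closed[OF vsT] e cc module_hom_smult[OF pure_tensor_hom_left[OF H V v]]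
          module_hom_smult[OF pr])
    finally show "R (Q (?p x v)) = ?p x v" by simp
  qed
  have Qi: "(\<lambda>t. Q t i) \<in> module_hom K ?T V" if "i \<in> I" for i
    using that by (intro module_homI)
      (auto simp: Qt module_hom_add[OF Q] module_hom_smult[OF Q] born_space_sel)
  show ?thesis
    by (rule exI[of _ "\<lambda>i t. Q t i"])
       (use Qi Qfin RQ in \<open>auto simp: Q_pure \<beta>_def R_def\<close>)
qed

end

section \<open>Functors and natural transformations\<close>

lemma
  assumes "is_vfunctor K elts X"
  shows vfunctor_vectorspace: "\<And>V. V \<in> Vect K elts \<Longrightarrow> vectorspace K (fobj X V)"
    and vfunctor_small: "\<And>V. V \<in> Vect K elts \<Longrightarrow> small elts (carrier (fobj X V))"
    and vfunctor_farr_hom: "\<And>V W. V \<in> Vect K elts \<Longrightarrow> W \<in> Vect K elts \<Longrightarrow>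
      farr X V W \<in> module_hom K (Lin K V W) (Lin K (fobj X V) (fobj X W))"
    and vfunctor_id: "\<And>V. V \<in> Vect K elts \<Longrightarrow> farr X V V (lin_id V) = lin_id (fobj X V)"
    and vfunctor_comp: "\<And>U V W f g. U \<in> Vect K elts \<Longrightarrow> V \<in> Vect K elts \<Longrightarrow> W \<in> Vect K elts \<Longrightarrow>
      f \<in> carrier (Lin K U V) \<Longrightarrow> g \<in> carrier (Lin K V W) \<Longrightarrow>
      farr X U W (compose (carrier U) g f) =
      compose (carrier (fobj X U)) (farr X V W g) (farr X U V f)"
  using assms unfolding is_vfunctor_def by blast+

lemma vfunctor_farr_in_Lin:
  "is_vfunctor K elts X \<Longrightarrow> V \<in> Vect K elts \<Longrightarrow> W \<in> Vect K elts \<Longrightarrow> f \<in> carrier (Lin K V W) \<Longrightarrow>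
   farr X V W f \<in> carrier (Lin K (fobj X V) (fobj X W))"
  using module_hom_in[OF vfunctor_farr_hom] .

lemma vfunctor_farr_closed:
  "is_vfunctor K elts X \<Longrightarrow> V \<in> Vect K elts \<Longrightarrow> W \<in> Vect K elts \<Longrightarrow> f \<in> carrier (Lin K V W) \<Longrightarrow>
   x \<in> carrier (fobj X V) \<Longrightarrow> farr X V W f x \<in> carrier (fobj X W)"
  using vfunctor_farr_in_Lin[of K elts X V W f] module_hom_in[of "farr X V W f" K "fobj X V" "fobj X W" x]
  by (simp add: carrier_Lin_iff)

text \<open>Once \<open>farr\<close> is known to give extensional linear maps, the functor laws can
  be tested on elements, free of restrictions and \<open>compose\<close>.\<close>

lemma is_vfunctorI:
  assumes vs: "\<And>V. V \<in> Vect K elts \<Longrightarrow> vectorspace K (fobj X V)"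
    and small: "\<And>V. V \<in> Vect K elts \<Longrightarrow> small elts (carrier (fobj X V))"
    and in_Lin: "\<And>V W f. V \<in> Vect K elts \<Longrightarrow> W \<in> Vect K elts \<Longrightarrow> f \<in> carrier (Lin K V W) \<Longrightarrow>
      farr X V W f \<in> carrier (Lin K (fobj X V) (fobj X W))"
    and add: "\<And>V W f g x. V \<in> Vect K elts \<Longrightarrow> W \<in> Vect K elts \<Longrightarrow>
      f \<in> carrier (Lin K V W) \<Longrightarrow> g \<in> carrier (Lin K V W) \<Longrightarrow> x \<in> carrier (fobj X V) \<Longrightarrow>
      farr X V W (f \<oplus>\<^bsub>Lin K V W\<^esub> g) x = farr X V W f x \<oplus>\<^bsub>fobj X W\<^esub> farr X V W g x"
    and smult: "\<And>V W a f x. V \<in> Vect K elts \<Longrightarrow> W \<in> Vect K elts \<Longrightarrow>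
      a \<in> carrier K \<Longrightarrow> f \<in> carrier (Lin K V W) \<Longrightarrow> x \<in> carrier (fobj X V) \<Longrightarrow>
      farr X V W (a \<odot>\<^bsub>Lin K V W\<^esub> f) x = a \<odot>\<^bsub>fobj X W\<^esub> farr X V W f x"
    and id: "\<And>V x. V \<in> Vect K elts \<Longrightarrow> x \<in> carrier (fobj X V) \<Longrightarrow> farr X V V (lin_id V) x = x"
    and comp: "\<And>U V W f g x. U \<in> Vect K elts \<Longrightarrow> V \<in> Vect K elts \<Longrightarrow> W \<in> Vect K elts \<Longrightarrow>
      f \<in> carrier (Lin K U V) \<Longrightarrow> g \<in> carrier (Lin K V W) \<Longrightarrow> x \<in> carrier (fobj X U) \<Longrightarrow>
      farr X U W (compose (carrier U) g f) x = farr X V W g (farr X U V f x)"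
  shows "is_vfunctor K elts X"
proof -
  have vsV: "vectorspace K V" if "V \<in> Vect K elts" for V using that by (simp add: Vect_def)
  have ext: "farr X V W f = restrict h (carrier (fobj X V))"
    if "V \<in> Vect K elts" "W \<in> Vect K elts" "f \<in> carrier (Lin K V W)"
      "\<And>x. x \<in> carrier (fobj X V) \<Longrightarrow> farr X V W f x = h x" for V W f h
    using in_Lin[OF that(1-3)] that(4)
    by (intro extensionalityI[of _ "carrier (fobj X V)"]) (simp_all add: carrier_Lin_iff)
  have "farr X V W \<in> module_hom K (Lin K V W) (Lin K (fobj X V) (fobj X W))"
    if V: "V \<in> Vect K elts" and W: "W \<in> Vect K elts" for V W
  proof (rule module_homI)
    note vsL = vectorspace_Lin[OF vsV[OF V] vsV[OF W]]
    show "farr X V W f \<in> carrier (Lin K (fobj X V) (fobj X W))" if "f \<in> carrier (Lin K V W)" for f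
      using in_Lin[OF V W that] .
    show "farr X V W (f \<oplus>\<^bsub>Lin K V W\<^esub> g) =
        farr X V W f \<oplus>\<^bsub>Lin K (fobj X V) (fobj X W)\<^esub> farr X V W g"
      if "f \<in> carrier (Lin K V W)" "g \<in> carrier (Lin K V W)" for f g
      unfolding Lin_sel(2)[of K "fobj X V"]
      using V W vs_add_closed[OF vsL that] add[OF V W that] by (rule ext)
    show "farr X V W (a \<odot>\<^bsub>Lin K V W\<^esub> f) = a \<odot>\<^bsub>Lin K (fobj X V) (fobj X W)\<^esub> farr X V W f"
      if "a \<in> carrier K" "f \<in> carrier (Lin K V W)" for a f
      unfolding Lin_sel(3)[where V = "fobj X V"]
      using V W vs_smult_closed[OF vsL that] smult[OF V W that] by (rule ext)
  qed
  moreover have "farr X V V (lin_id V) = lin_id (fobj X V)" if V: "V \<in> Vect K elts" for V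
    unfolding lin_id_def[of "fobj X V"]
    using V V lin_id_in_Lin[OF vsV[OF V]] id[OF V] by (rule ext)
  moreover have "farr X U W (compose (carrier U) g f) =
      compose (carrier (fobj X U)) (farr X V W g) (farr X U V f)"
    if U: "U \<in> Vect K elts" and V: "V \<in> Vect K elts" and W: "W \<in> Vect K elts"
      and f: "f \<in> carrier (Lin K U V)" and g: "g \<in> carrier (Lin K V W)" for U V W f g
    unfolding compose_def[of "carrier (fobj X U)"]
    using U W compose_in_Lin[OF vsV[OF U] f g] comp[OF U V W f g] by (rule ext)
  ultimately show ?thesis unfolding is_vfunctor_def using vs small by blast
qed

lemma compose_eq_iff:
  "compose A g f = compose A g' f' \<longleftrightarrow> (\<forall>x\<in>A. g (f x) = g' (f' x))"
  by (auto simp: compose_def fun_eq_iff restrict_def)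

lemma carrier_Nat_iff:
  "\<eta> \<in> carrier (Nat K elts X Y) \<longleftrightarrow>
    \<eta> \<in> extensional (Vect K elts) \<and>
    (\<forall>V\<in>Vect K elts. \<eta> V \<in> carrier (Lin K (fobj X V) (fobj Y V))) \<and>
    (\<forall>V\<in>Vect K elts. \<forall>W\<in>Vect K elts. \<forall>f\<in>carrier (Lin K V W). \<forall>x\<in>carrier (fobj X V).
      \<eta> W (farr X V W f x) = farr Y V W f (\<eta> V x))"
  unfolding Nat_def by (auto simp: compose_eq_iff PiE_def)

lemma
  assumes "\<eta> \<in> carrier (Nat K elts X Y)"
  shows Nat_extensional: "\<eta> \<in> extensional (Vect K elts)"
    and Nat_in_Lin: "\<And>V. V \<in> Vect K elts \<Longrightarrow> \<eta> V \<in> carrier (Lin K (fobj X V) (fobj Y V))"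
    and Nat_hom: "\<And>V. V \<in> Vect K elts \<Longrightarrow> \<eta> V \<in> module_hom K (fobj X V) (fobj Y V)"
    and Nat_closed: "\<And>V x. V \<in> Vect K elts \<Longrightarrow> x \<in> carrier (fobj X V) \<Longrightarrow>
      \<eta> V x \<in> carrier (fobj Y V)"
    and Nat_natural: "\<And>V W f x. V \<in> Vect K elts \<Longrightarrow> W \<in> Vect K elts \<Longrightarrow>
      f \<in> carrier (Lin K V W) \<Longrightarrow> x \<in> carrier (fobj X V) \<Longrightarrow>
      \<eta> W (farr X V W f x) = farr Y V W f (\<eta> V x)"
proof -
  show hom: "\<And>V. V \<in> Vect K elts \<Longrightarrow> \<eta> V \<in> module_hom K (fobj X V) (fobj Y V)"
    using assms by (simp add: carrier_Nat_iff carrier_Lin_iff)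
  show "\<And>V x. V \<in> Vect K elts \<Longrightarrow> x \<in> carrier (fobj X V) \<Longrightarrow> \<eta> V x \<in> carrier (fobj Y V)"
    using module_hom_in[OF hom] .
qed (use assms in \<open>simp_all add: carrier_Nat_iff\<close>)

lemma NatI:
  assumes "\<eta> \<in> extensional (Vect K elts)"
    and "\<And>V. V \<in> Vect K elts \<Longrightarrow> \<eta> V \<in> carrier (Lin K (fobj X V) (fobj Y V))"
    and "\<And>V W f x. V \<in> Vect K elts \<Longrightarrow> W \<in> Vect K elts \<Longrightarrow>
      f \<in> carrier (Lin K V W) \<Longrightarrow> x \<in> carrier (fobj X V) \<Longrightarrow>
      \<eta> W (farr X V W f x) = farr Y V W f (\<eta> V x)"
  shows "\<eta> \<in> carrier (Nat K elts X Y)"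
  using assms by (simp add: carrier_Nat_iff)

lemma Nat_eqI:
  assumes "\<eta> \<in> carrier (Nat K elts X Y)" "\<theta> \<in> carrier (Nat K elts X Y)"
    and "\<And>V x. V \<in> Vect K elts \<Longrightarrow> x \<in> carrier (fobj X V) \<Longrightarrow> \<eta> V x = \<theta> V x"
  shows "\<eta> = \<theta>"
proof (rule extensionalityI[OF Nat_extensional[OF assms(1)] Nat_extensional[OF assms(2)]])
  fix V assume "V \<in> Vect K elts"
  then show "\<eta> V = \<theta> V"
    using Lin_eqI[OF Nat_in_Lin[OF assms(1)] Nat_in_Lin[OF assms(2)]] assms(3) by blast
qed

lemma Nat_sel:
  "zero (Nat K elts X Y) = (\<lambda>V\<in>Vect K elts. \<lambda>x\<in>carrier (fobj X V). \<zero>\<^bsub>fobj Y V\<^esub>)"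
  "\<eta> \<oplus>\<^bsub>Nat K elts X Y\<^esub> \<theta> =
    (\<lambda>V\<in>Vect K elts. \<lambda>x\<in>carrier (fobj X V). \<eta> V x \<oplus>\<^bsub>fobj Y V\<^esub> \<theta> V x)"
  "a \<odot>\<^bsub>Nat K elts X Y\<^esub> \<eta> =
    (\<lambda>V\<in>Vect K elts. \<lambda>x\<in>carrier (fobj X V). a \<odot>\<^bsub>fobj Y V\<^esub> \<eta> V x)"
  by (simp_all add: Nat_def Lin_sel)

lemma nat_id_apply [simp]:
  "V \<in> Vect K elts \<Longrightarrow> x \<in> carrier (fobj X V) \<Longrightarrow> nat_id K elts X V x = x"
  by (simp add: nat_id_def lin_id_def)

lemma nat_comp_apply [simp]:
  "V \<in> Vect K elts \<Longrightarrow> x \<in> carrier (fobj X V) \<Longrightarrow> nat_comp K elts X \<theta> \<eta> V x = \<theta> V (\<eta> V x)"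
  by (simp add: nat_comp_def compose_def)

lemma nat_id_in_Nat:
  assumes "is_vfunctor K elts X" shows "nat_id K elts X \<in> carrier (Nat K elts X X)"
proof (rule NatI)
  show "nat_id K elts X V \<in> carrier (Lin K (fobj X V) (fobj X V))" if "V \<in> Vect K elts" for V
    using that lin_id_in_Lin[OF vfunctor_vectorspace[OF assms that]] by (simp add: nat_id_def)
qed (use vfunctor_farr_closed[OF assms] in \<open>auto simp: nat_id_def lin_id_def\<close>)

lemma nat_comp_in_Nat:
  assumes X: "is_vfunctor K elts X" and \<eta>: "\<eta> \<in> carrier (Nat K elts X Y)"
    and \<theta>: "\<theta> \<in> carrier (Nat K elts Y Z)"
  shows "nat_comp K elts X \<theta> \<eta> \<in> carrier (Nat K elts X Z)"
proof (rule NatI)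
  show "nat_comp K elts X \<theta> \<eta> V \<in> carrier (Lin K (fobj X V) (fobj Z V))"
    if "V \<in> Vect K elts" for V
    using that
      compose_in_Lin[OF vfunctor_vectorspace[OF X that] Nat_in_Lin[OF \<eta> that] Nat_in_Lin[OF \<theta> that]]
    by (simp add: nat_comp_def)
qed (use vfunctor_farr_closed[OF X] in \<open>simp_all add: Nat_natural[OF \<eta>] Nat_natural[OF \<theta>]
  Nat_closed[OF \<eta>], simp add: nat_comp_def\<close>)

context grothendieck_universe
begin

text \<open>Intended for the internal Hom. Beyond extensionality of its arrows nothing is assumed of
  \<open>X\<close> alone; vector space structure, smallness and the functor laws all come from
  \<open>Y\<close>, because every element of a value of \<open>X\<close> has the form
  \<open>\<epsilon> V y\<close>.\<close>

lemma vfunctor_transport: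
  assumes Y: "is_vfunctor K elts Y"
    and bij: "\<And>V. V \<in> Vect K elts \<Longrightarrow> bij_betw (\<epsilon> V) (carrier (fobj Y V)) (carrier (fobj X V))"
    and zero: "\<And>V. V \<in> Vect K elts \<Longrightarrow> \<epsilon> V \<zero>\<^bsub>fobj Y V\<^esub> = \<zero>\<^bsub>fobj X V\<^esub>"
    and hom: "\<And>V. V \<in> Vect K elts \<Longrightarrow> \<epsilon> V \<in> module_hom K (fobj Y V) (fobj X V)"
    and ext: "\<And>V W f. V \<in> Vect K elts \<Longrightarrow> W \<in> Vect K elts \<Longrightarrow> f \<in> carrier (Lin K V W) \<Longrightarrow>
      farr X V W f \<in> extensional (carrier (fobj X V))"
    and nat: "\<And>V W f y. V \<in> Vect K elts \<Longrightarrow> W \<in> Vect K elts \<Longrightarrow>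
      f \<in> carrier (Lin K V W) \<Longrightarrow> y \<in> carrier (fobj Y V) \<Longrightarrow>
      farr X V W f (\<epsilon> V y) = \<epsilon> W (farr Y V W f y)"
  shows "is_vfunctor K elts X"
proof (rule is_vfunctorI)
  have vsV: "vectorspace K V" if "V \<in> Vect K elts" for V using that by (simp add: Vect_def)
  note vsY = vfunctor_vectorspace[OF Y]
  have Y_hom: "farr Y V W f \<in> module_hom K (fobj Y V) (fobj Y W)"
    if "V \<in> Vect K elts" "W \<in> Vect K elts" "f \<in> carrier (Lin K V W)" for V W f
    using vfunctor_farr_in_Lin[OF Y that] by (simp add: carrier_Lin_iff)
  have X: "\<exists>y\<in>carrier (fobj Y V). x = \<epsilon> V y"
    if "V \<in> Vect K elts" "x \<in> carrier (fobj X V)" for V x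
    using bij[OF that(1)] that(2) by (auto simp: bij_betw_def)
  show vsX: "vectorspace K (fobj X V)" if V: "V \<in> Vect K elts" for V
    using vsY[OF V] bij[OF V] zero[OF V] module_hom_add[OF hom[OF V]] module_hom_smult[OF hom[OF V]]
    by (rule vectorspace_transport)
  show "small elts (carrier (fobj X V))" if "V \<in> Vect K elts" for V
    using small_image[OF vfunctor_small[OF Y that], of "\<epsilon> V"] bij[OF that]
    by (simp add: bij_betw_def)
  show "farr X V W f \<in> carrier (Lin K (fobj X V) (fobj X W))"
    if V: "V \<in> Vect K elts" and W: "W \<in> Vect K elts" and f: "f \<in> carrier (Lin K V W)" for V W f
  proof -
    have "farr X V W f x \<in> carrier (fobj X W)" if "x \<in> carrier (fobj X V)" for x
      using X[OF V that] nat[OF V W f] module_hom_in[OF hom[OF W] vfunctor_farr_closed[OF Y V W f]]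
      by auto
    moreover have "farr X V W f (x \<oplus>\<^bsub>fobj X V\<^esub> x') = farr X V W f x \<oplus>\<^bsub>fobj X W\<^esub> farr X V W f x'"
      if "x \<in> carrier (fobj X V)" "x' \<in> carrier (fobj X V)" for x x'
      using X[OF V that(1)] X[OF V that(2)]
      by (auto simp: module_hom_add[OF hom[OF V], symmetric] module_hom_add[OF hom[OF W], symmetric]
          nat[OF V W f] vs_add_closed[OF vsY[OF V]] module_hom_add[OF Y_hom[OF V W f]]
          vfunctor_farr_closed[OF Y V W f])
    moreover have "farr X V W f (a \<odot>\<^bsub>fobj X V\<^esub> x) = a \<odot>\<^bsub>fobj X W\<^esub> farr X V W f x"
      if "x \<in> carrier (fobj X V)" "a \<in> carrier K" for x a
      using X[OF V that(1)] that(2)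
      by (auto simp: module_hom_smult[OF hom[OF V], symmetric]
          module_hom_smult[OF hom[OF W], symmetric] nat[OF V W f] vs_smult_closed[OF vsY[OF V]]
          module_hom_smult[OF Y_hom[OF V W f]] vfunctor_farr_closed[OF Y V W f])
    ultimately show ?thesis
      unfolding carrier_Lin_iff using ext[OF V W f] by (intro conjI module_homI) auto
  qed
  show "farr X V W (f \<oplus>\<^bsub>Lin K V W\<^esub> g) x = farr X V W f x \<oplus>\<^bsub>fobj X W\<^esub> farr X V W g x"
    if V: "V \<in> Vect K elts" and W: "W \<in> Vect K elts" and f: "f \<in> carrier (Lin K V W)"
      and g: "g \<in> carrier (Lin K V W)" and x: "x \<in> carrier (fobj X V)" for V W f g x
    using X[OF V x] vs_add_closed[OF vectorspace_Lin[OF vsV[OF V] vsV[OF W]] f g]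
    by (auto simp: nat[OF V W] f g module_hom_add[OF vfunctor_farr_hom[OF Y V W] f g]
        Lin_sel(2)[of K "fobj Y V"] module_hom_add[OF hom[OF W], symmetric]
        vfunctor_farr_closed[OF Y V W])
  show "farr X V W (a \<odot>\<^bsub>Lin K V W\<^esub> f) x = a \<odot>\<^bsub>fobj X W\<^esub> farr X V W f x"
    if V: "V \<in> Vect K elts" and W: "W \<in> Vect K elts" and a: "a \<in> carrier K"
      and f: "f \<in> carrier (Lin K V W)" and x: "x \<in> carrier (fobj X V)" for V W a f x
    using X[OF V x] vs_smult_closed[OF vectorspace_Lin[OF vsV[OF V] vsV[OF W]] a f]
    by (auto simp: nat[OF V W] f a module_hom_smult[OF vfunctor_farr_hom[OF Y V W] a f]
        Lin_sel(3)[where V = "fobj Y V"] module_hom_smult[OF hom[OF W], symmetric]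
        vfunctor_farr_closed[OF Y V W])
  show "farr X V V (lin_id V) x = x" if V: "V \<in> Vect K elts" and x: "x \<in> carrier (fobj X V)" for V x
    using X[OF V x] lin_id_in_Lin[OF vsV[OF V]]
    by (auto simp: nat[OF V V] vfunctor_id[OF Y V] lin_id_def[of "fobj Y V"])
  show "farr X U W (compose (carrier U) g f) x = farr X V W g (farr X U V f x)"
    if U: "U \<in> Vect K elts" and V: "V \<in> Vect K elts" and W: "W \<in> Vect K elts"
      and f: "f \<in> carrier (Lin K U V)" and g: "g \<in> carrier (Lin K V W)"
      and x: "x \<in> carrier (fobj X U)" for U V W f g x
    using X[OF U x] compose_in_Lin[OF vsV[OF U] f g]
    by (auto simp: nat[OF U W] nat[OF U V f] nat[OF V W g] vfunctor_comp[OF Y U V W f g]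
        compose_def[of "carrier (fobj Y U)"] vfunctor_farr_closed[OF Y U V f])
qed

end

section \<open>Filtered colimits\<close>

context
  fixes K :: "'k ring" and elts :: "'u \<Rightarrow> 'u set" and I :: "'i set" and r :: "('i \<times> 'i) set"
    and D :: "'i \<Rightarrow> ('k, 'u, 'c) vfunctor" and \<tau> :: "'i \<Rightarrow> 'i \<Rightarrow> ('k, 'u) module \<Rightarrow> 'c \<Rightarrow> 'c"
  assumes r: "directed_poset I r" and D: "is_diagram K elts I r D \<tau>"
begin

lemma diagram_closed:
  "(i, j) \<in> r \<Longrightarrow> V \<in> Vect K elts \<Longrightarrow> x \<in> carrier (fobj (D i) V) \<Longrightarrow>
   \<tau> i j V x \<in> carrier (fobj (D j) V)"
  using D Nat_closed[of "\<tau> i j" K elts "D i" "D j" V x] by (simp add: is_diagram_def)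

lemma cocone_in_Nat:
  "is_cocone K elts I r D \<tau> Z \<mu> \<Longrightarrow> i \<in> I \<Longrightarrow> \<mu> i \<in> carrier (Nat K elts (D i) Z)"
  by (simp add: is_cocone_def)

lemma cocone_apply:
  assumes "is_cocone K elts I r D \<tau> Z \<mu>" "(i, j) \<in> r" "V \<in> Vect K elts" "x \<in> carrier (fobj (D i) V)"
  shows "\<mu> j V (\<tau> i j V x) = \<mu> i V x"
proof -
  have "\<mu> i = nat_comp K elts (D i) (\<mu> j) (\<tau> i j)" using assms(1,2) by (simp add: is_cocone_def)
  from this[THEN fun_cong, of V, THEN fun_cong, of x] assms(3,4) show ?thesis by simp
qed

lemma directed_upper_bound:
  assumes "i \<in> I" "j \<in> I" obtains l where "l \<in> I" "(i, l) \<in> r" "(j, l) \<in> r"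
  using r assms unfolding directed_poset_def by blast

text \<open>A functor that is the directed union of a diagram is its colimit. Injectivity of the
  cocone replaces the usual condition that elements with equal image in \<open>X\<close> become
  equal at a later stage, and joint surjectivity lets a map be prescribed stage by stage.\<close>

lemma is_colimitI:
  assumes X: "is_vfunctor K elts X" and \<kappa>: "is_cocone K elts I r D \<tau> X \<kappa>"
    and inj: "\<And>i V. i \<in> I \<Longrightarrow> V \<in> Vect K elts \<Longrightarrow> inj_on (\<kappa> i V) (carrier (fobj (D i) V))"
    and surj: "\<And>V x. V \<in> Vect K elts \<Longrightarrow> x \<in> carrier (fobj X V) \<Longrightarrow>
      \<exists>i\<in>I. x \<in> \<kappa> i V ` carrier (fobj (D i) V)"
  shows "is_colimit K elts I r D \<tau> X \<kappa>"
proof -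
  have "\<exists>!\<theta>. \<theta> \<in> carrier (Nat K elts X Z) \<and> (\<forall>i\<in>I. nat_comp K elts (D i) \<theta> (\<kappa> i) = \<mu> i)"
    if Z: "is_vfunctor K elts Z" and \<mu>: "is_cocone K elts I r D \<tau> Z \<mu>"
    for Z :: "('k, 'u, 'u) vfunctor" and \<mu>
  proof -
    have D_fun: "is_vfunctor K elts (D i)" if "i \<in> I" for i
      using D that by (simp add: is_diagram_def)
    note \<kappa>N = cocone_in_Nat[OF \<kappa>] and \<mu>N = cocone_in_Nat[OF \<mu>]
    \<comment> \<open>Well-definedness of the induced map: two representatives of one element are
      moved to a common stage \<open>l\<close>, where injectivity identifies them before the cocone
      \<open>\<mu>\<close> is applied.\<close>
    have well: "\<mu> i V g = \<mu> j V h"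
      if i: "i \<in> I" and j: "j \<in> I" and V: "V \<in> Vect K elts" and g: "g \<in> carrier (fobj (D i) V)"
        and h: "h \<in> carrier (fobj (D j) V)" and eq: "\<kappa> i V g = \<kappa> j V h" for i j V g h
    proof -
      obtain l where l: "l \<in> I" "(i, l) \<in> r" "(j, l) \<in> r" using directed_upper_bound[OF i j] .
      have "\<kappa> l V (\<tau> i l V g) = \<kappa> l V (\<tau> j l V h)"
        using cocone_apply[OF \<kappa> l(2) V g] cocone_apply[OF \<kappa> l(3) V h] eq by simp
      then have "\<tau> i l V g = \<tau> j l V h"
        using inj[OF l(1) V] diagram_closed[OF l(2) V g] diagram_closed[OF l(3) V h]
        by (simp add: inj_on_eq_iff)
      then show ?thesis
        using cocone_apply[OF \<mu> l(2) V g] cocone_apply[OF \<mu> l(3) V h] by simp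
    qed
    define \<theta> where "\<theta> = (\<lambda>V\<in>Vect K elts. \<lambda>x\<in>carrier (fobj X V). SOME z. \<exists>i\<in>I.
      \<exists>g\<in>carrier (fobj (D i) V). \<kappa> i V g = x \<and> \<mu> i V g = z)"
    have \<theta>: "\<theta> V (\<kappa> i V g) = \<mu> i V g"
      if i: "i \<in> I" and V: "V \<in> Vect K elts" and g: "g \<in> carrier (fobj (D i) V)" for i V g
    proof -
      have "(SOME z. \<exists>j\<in>I. \<exists>h\<in>carrier (fobj (D j) V). \<kappa> j V h = \<kappa> i V g \<and> \<mu> j V h = z) = \<mu> i V g"
      proof (rule some_equality)
        show "\<exists>j\<in>I. \<exists>h\<in>carrier (fobj (D j) V). \<kappa> j V h = \<kappa> i V g \<and> \<mu> j V h = \<mu> i V g"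
          using i g by blast
        show "z = \<mu> i V g"
          if "\<exists>j\<in>I. \<exists>h\<in>carrier (fobj (D j) V). \<kappa> j V h = \<kappa> i V g \<and> \<mu> j V h = z" for z
          using that well[OF _ i V _ g] by blast
      qed
      then show ?thesis using V Nat_closed[OF \<kappa>N[OF i] V g] by (simp add: \<theta>_def)
    qed
    \<comment> \<open>Additivity compares two elements within one stage; directedness supplies a
      stage that contains both.\<close>
    have two: "\<exists>l\<in>I. \<exists>g\<in>carrier (fobj (D l) V). \<exists>h\<in>carrier (fobj (D l) V). x = \<kappa> l V g \<and> y = \<kappa> l V h"
      if V: "V \<in> Vect K elts" and x: "x \<in> carrier (fobj X V)" and y: "y \<in> carrier (fobj X V)" for V x y
    proof -
      obtain i g where i: "i \<in> I" and g: "g \<in> carrier (fobj (D i) V)" "x = \<kappa> i V g"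
        using surj[OF V x] by blast
      obtain j h where j: "j \<in> I" and h: "h \<in> carrier (fobj (D j) V)" "y = \<kappa> j V h"
        using surj[OF V y] by blast
      obtain l where l: "l \<in> I" "(i, l) \<in> r" "(j, l) \<in> r" using directed_upper_bound[OF i j] .
      show ?thesis
        using l(1) diagram_closed[OF l(2) V g(1)] diagram_closed[OF l(3) V h(1)]
          cocone_apply[OF \<kappa> l(2) V g(1)] cocone_apply[OF \<kappa> l(3) V h(1)] g(2) h(2) by metis
    qed
    have "\<theta> \<in> carrier (Nat K elts X Z)"
    proof (rule NatI)
      show "\<theta> \<in> extensional (Vect K elts)" by (simp add: \<theta>_def)
      show "\<theta> V \<in> carrier (Lin K (fobj X V) (fobj Z V))" if V: "V \<in> Vect K elts" for V
        unfolding carrier_Lin_iff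
      proof (intro conjI module_homI)
        show "\<theta> V \<in> extensional (carrier (fobj X V))" using V by (simp add: \<theta>_def)
        fix x assume x: "x \<in> carrier (fobj X V)"
        then obtain i g where i: "i \<in> I" and g: "g \<in> carrier (fobj (D i) V)" "x = \<kappa> i V g"
          using surj[OF V] by blast
        note vs = vfunctor_vectorspace[OF D_fun[OF i] V]
        show "\<theta> V x \<in> carrier (fobj Z V)"
          using g Nat_closed[OF \<mu>N[OF i] V] by (simp add: \<theta>[OF i V])
        show "\<theta> V (a \<odot>\<^bsub>fobj X V\<^esub> x) = a \<odot>\<^bsub>fobj Z V\<^esub> \<theta> V x" if a: "a \<in> carrier K" for a
        proof -
          have "\<theta> V (a \<odot>\<^bsub>fobj X V\<^esub> x) = \<theta> V (\<kappa> i V (a \<odot>\<^bsub>fobj (D i) V\<^esub> g))"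
            by (simp add: g module_hom_smult[OF Nat_hom[OF \<kappa>N[OF i] V] a g(1)])
          also have "\<dots> = \<mu> i V (a \<odot>\<^bsub>fobj (D i) V\<^esub> g)"
            by (rule \<theta>[OF i V vs_smult_closed[OF vs a g(1)]])
          also have "\<dots> = a \<odot>\<^bsub>fobj Z V\<^esub> \<theta> V x"
            by (simp add: g \<theta>[OF i V] module_hom_smult[OF Nat_hom[OF \<mu>N[OF i] V] a g(1)])
          finally show ?thesis .
        qed
        fix y assume y: "y \<in> carrier (fobj X V)"
        obtain l g h where l: "l \<in> I" and g: "g \<in> carrier (fobj (D l) V)" "x = \<kappa> l V g"
          and h: "h \<in> carrier (fobj (D l) V)" "y = \<kappa> l V h" using two[OF V x y] by blast
        note vs = vfunctor_vectorspace[OF D_fun[OF l] V]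
        have "\<theta> V (x \<oplus>\<^bsub>fobj X V\<^esub> y) = \<theta> V (\<kappa> l V (g \<oplus>\<^bsub>fobj (D l) V\<^esub> h))"
          by (simp add: g h module_hom_add[OF Nat_hom[OF \<kappa>N[OF l] V] g(1) h(1)])
        also have "\<dots> = \<mu> l V (g \<oplus>\<^bsub>fobj (D l) V\<^esub> h)"
          by (rule \<theta>[OF l V vs_add_closed[OF vs g(1) h(1)]])
        also have "\<dots> = \<theta> V x \<oplus>\<^bsub>fobj Z V\<^esub> \<theta> V y"
          by (simp add: g h \<theta>[OF l V] module_hom_add[OF Nat_hom[OF \<mu>N[OF l] V] g(1) h(1)])
        finally show "\<theta> V (x \<oplus>\<^bsub>fobj X V\<^esub> y) = \<theta> V x \<oplus>\<^bsub>fobj Z V\<^esub> \<theta> V y" .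
      qed
      fix V W f x
      assume V: "V \<in> Vect K elts" and W: "W \<in> Vect K elts" and f: "f \<in> carrier (Lin K V W)"
        and x: "x \<in> carrier (fobj X V)"
      obtain i g where i: "i \<in> I" and g: "g \<in> carrier (fobj (D i) V)" "x = \<kappa> i V g"
        using surj[OF V x] by blast
      show "\<theta> W (farr X V W f x) = farr Z V W f (\<theta> V x)"
        using Nat_natural[OF \<kappa>N[OF i] V W f g(1)] Nat_natural[OF \<mu>N[OF i] V W f g(1)]
          \<theta>[OF i W vfunctor_farr_closed[OF D_fun[OF i] V W f g(1)]] \<theta>[OF i V g(1)] g(2) by simp
    qed
    moreover have "nat_comp K elts (D i) \<theta> (\<kappa> i) = \<mu> i" if i: "i \<in> I" for i
      using nat_comp_in_Nat[OF D_fun[OF i] \<kappa>N[OF i] calculation] \<mu>N[OF i]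
      by (rule Nat_eqI) (simp add: \<theta>[OF i])
    moreover have "\<theta>' = \<theta>"
      if \<theta>': "\<theta>' \<in> carrier (Nat K elts X Z)" "\<forall>i\<in>I. nat_comp K elts (D i) \<theta>' (\<kappa> i) = \<mu> i" for \<theta>'
      using \<theta>'(1) \<open>\<theta> \<in> carrier (Nat K elts X Z)\<close>
    proof (rule Nat_eqI)
      fix V x assume V: "V \<in> Vect K elts" and x: "x \<in> carrier (fobj X V)"
      obtain i g where i: "i \<in> I" and g: "g \<in> carrier (fobj (D i) V)" "x = \<kappa> i V g"
        using surj[OF V x] by blast
      have "nat_comp K elts (D i) \<theta>' (\<kappa> i) V g = \<mu> i V g" using \<theta>'(2) i by simp
      then show "\<theta>' V x = \<theta> V x" using V g \<theta>[OF i V g(1)] by simp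
    qed
    ultimately show ?thesis by blast
  qed
  then show ?thesis unfolding is_colimit_def using X \<kappa> by blast
qed

end

section \<open>Presentations of Ind-objects\<close>

lemma fobj_born_functor [simp]: "fobj (born_functor \<Gamma> \<F>) V = born_space \<Gamma> \<F> V"
  by (simp add: born_functor_def born_space_def)

lemma farr_born_functor:
  "farr (born_functor \<Gamma> \<F>) V W f = (\<lambda>\<phi>\<in>carrier (born_space \<Gamma> \<F> V). \<lambda>\<gamma>\<in>\<Gamma>. f (\<phi> \<gamma>))"
  by (simp add: born_functor_def born_space_def Let_def)

lemma representable_sel [simp]:
  "fobj (representable K H) V = Lin K H V"
  "farr (representable K H) V W f = (\<lambda>g\<in>carrier (Lin K H V). compose (carrier H) f g)"
  by (simp_all add: representable_def)

lemma born_space_map: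
  assumes \<F>: "bornology \<Gamma> \<F>" and V: "vectorspace K V" and W: "vectorspace K W"
    and f: "f \<in> module_hom K V W" and \<phi>: "\<phi> \<in> carrier (born_space \<Gamma> \<F> V)"
  shows "(\<lambda>\<gamma>\<in>\<Gamma>. f (\<phi> \<gamma>)) \<in> carrier (born_space \<Gamma> \<F> W)"
proof -
  have "{\<gamma>\<in>\<Gamma>. f (\<phi> \<gamma>) \<noteq> \<zero>\<^bsub>W\<^esub>} \<in> \<F>"
    by (rule bornology_subset[OF \<F>, of "{\<gamma>\<in>\<Gamma>. \<phi> \<gamma> \<noteq> \<zero>\<^bsub>V\<^esub>}"])
       (use \<phi> in \<open>auto simp: carrier_born_space_iff module_hom_zero[OF V W f]\<close>)
  moreover have "{\<gamma>\<in>\<Gamma>. (\<lambda>\<gamma>\<in>\<Gamma>. f (\<phi> \<gamma>)) \<gamma> \<noteq> \<zero>\<^bsub>W\<^esub>} = {\<gamma>\<in>\<Gamma>. f (\<phi> \<gamma>) \<noteq> \<zero>\<^bsub>W\<^esub>}" by auto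
  ultimately show ?thesis
    using \<phi> by (simp add: carrier_born_space_iff module_hom_in[OF f])
qed

lemma born_space_eqI:
  assumes "\<phi> \<in> carrier (born_space \<Gamma> \<F> V)" "\<psi> \<in> carrier (born_space \<Gamma> \<F> V)"
    and "\<And>\<gamma>. \<gamma> \<in> \<Gamma> \<Longrightarrow> \<phi> \<gamma> = \<psi> \<gamma>"
  shows "\<phi> = \<psi>"
  using assms by (intro extensionalityI[of _ \<Gamma>]) (simp_all add: carrier_born_space_iff)

text \<open>The colimit condition is kept in its elementwise form, that of a directed union. In this
  form it moves along a natural bijection, also to a functor whose values have another carrier type.
  The indices have type \<open>'u\<close> because \<open>is_ind_object\<close> wants the index set
  to be a member of the universe.\<close>

definition ind_presentation ::
    "'k ring \<Rightarrow> ('u \<Rightarrow> 'u set) \<Rightarrow> 'u set \<Rightarrow> ('u \<times> 'u) set \<Rightarrow> ('u \<Rightarrow> ('k, 'u) module) \<Rightarrow>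
     ('u \<Rightarrow> 'u \<Rightarrow> ('k, 'u) module \<Rightarrow> ('u \<Rightarrow> 'u) \<Rightarrow> 'u \<Rightarrow> 'u) \<Rightarrow> ('k, 'u, 'c) vfunctor \<Rightarrow>
     ('u \<Rightarrow> ('k, 'u) module \<Rightarrow> ('u \<Rightarrow> 'u) \<Rightarrow> 'c) \<Rightarrow> bool" where
  "ind_presentation K elts I r H \<tau> X \<kappa> \<longleftrightarrow>
    I \<in> range elts \<and> directed_poset I r \<and> (\<forall>i\<in>I. H i \<in> Vect K elts) \<and>
    is_diagram K elts I r (\<lambda>i. representable K (H i)) \<tau> \<and>
    is_cocone K elts I r (\<lambda>i. representable K (H i)) \<tau> X \<kappa> \<and>
    (\<forall>i\<in>I. \<forall>V\<in>Vect K elts. inj_on (\<kappa> i V) (carrier (Lin K (H i) V))) \<and>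
    (\<forall>V\<in>Vect K elts. \<forall>x\<in>carrier (fobj X V). \<exists>i\<in>I. x \<in> \<kappa> i V ` carrier (Lin K (H i) V))"

lemma ind_presentation_is_ind_object:
  assumes X: "is_vfunctor K elts X" and p: "ind_presentation K elts I r H \<tau> X \<kappa>"
  shows "is_ind_object K elts X"
proof -
  have "is_colimit K elts I r (\<lambda>i. representable K (H i)) \<tau> X \<kappa>"
    using p X by (intro is_colimitI) (simp_all add: ind_presentation_def)
  then show ?thesis using p unfolding is_ind_object_def ind_presentation_def by blast
qed

text \<open>This is how the internal Hom acquires a presentation: the diagram of representables
  stays the same and the cocone is composed with the isomorphism.\<close>

lemma ind_presentation_transport:
  assumes p: "ind_presentation K elts I r H \<tau> Y \<kappa>"
    and \<epsilon>: "\<epsilon> \<in> carrier (Nat K elts Y X)"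
    and bij: "\<And>V. V \<in> Vect K elts \<Longrightarrow> bij_betw (\<epsilon> V) (carrier (fobj Y V)) (carrier (fobj X V))"
  shows "ind_presentation K elts I r H \<tau> X (\<lambda>i. nat_comp K elts (representable K (H i)) \<epsilon> (\<kappa> i))"
proof -
  let ?D = "\<lambda>i. representable K (H i)"
  have r: "directed_poset I r" and D: "is_diagram K elts I r ?D \<tau>"
    and \<kappa>: "is_cocone K elts I r ?D \<tau> Y \<kappa>"
    using p by (simp_all add: ind_presentation_def)
  have D_fun: "is_vfunctor K elts (?D i)" if "i \<in> I" for i
    using D that by (simp add: is_diagram_def)
  note \<kappa>N = cocone_in_Nat[OF r D \<kappa>]
  have rI: "i \<in> I" "j \<in> I" if "(i, j) \<in> r" for i j using r that by (auto simp: directed_poset_def)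
  have "is_cocone K elts I r ?D \<tau> X (\<lambda>i. nat_comp K elts (?D i) \<epsilon> (\<kappa> i))"
    unfolding is_cocone_def
  proof (intro conjI ballI allI impI)
    show N: "nat_comp K elts (?D i) \<epsilon> (\<kappa> i) \<in> carrier (Nat K elts (?D i) X)" if "i \<in> I" for i
      using nat_comp_in_Nat[OF D_fun[OF that] \<kappa>N[OF that] \<epsilon>] .
    fix i j assume ij: "(i, j) \<in> r"
    have \<tau>: "\<tau> i j \<in> carrier (Nat K elts (?D i) (?D j))" using D ij by (simp add: is_diagram_def)
    show "nat_comp K elts (?D i) \<epsilon> (\<kappa> i) =
        nat_comp K elts (?D i) (nat_comp K elts (?D j) \<epsilon> (\<kappa> j)) (\<tau> i j)"
      using N[OF rI(1)[OF ij]] nat_comp_in_Nat[OF D_fun[OF rI(1)[OF ij]] \<tau> N[OF rI(2)[OF ij]]]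
    proof (rule Nat_eqI)
      fix V x assume V: "V \<in> Vect K elts" and x: "x \<in> carrier (fobj (?D i) V)"
      then show "nat_comp K elts (?D i) \<epsilon> (\<kappa> i) V x =
          nat_comp K elts (?D i) (nat_comp K elts (?D j) \<epsilon> (\<kappa> j)) (\<tau> i j) V x"
        using cocone_apply[OF r D \<kappa> ij V x] Nat_closed[OF \<tau> V x] by simp
    qed
  qed
  moreover have "inj_on (nat_comp K elts (?D i) \<epsilon> (\<kappa> i) V) (carrier (Lin K (H i) V))"
    if i: "i \<in> I" and V: "V \<in> Vect K elts" for i V
  proof (rule inj_onI)
    fix g h assume g: "g \<in> carrier (Lin K (H i) V)" and h: "h \<in> carrier (Lin K (H i) V)"
      and "nat_comp K elts (?D i) \<epsilon> (\<kappa> i) V g = nat_comp K elts (?D i) \<epsilon> (\<kappa> i) V h"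
    then have "\<epsilon> V (\<kappa> i V g) = \<epsilon> V (\<kappa> i V h)" using V by simp
    then have "\<kappa> i V g = \<kappa> i V h"
      by (rule inj_onD[OF bij_betw_imp_inj_on[OF bij[OF V]]])
         (use Nat_closed[OF \<kappa>N[OF i] V] g h in simp_all)
    moreover have "inj_on (\<kappa> i V) (carrier (Lin K (H i) V))"
      using p i V by (simp add: ind_presentation_def)
    ultimately show "g = h" using g h by (simp add: inj_on_eq_iff)
  qed
  moreover have "\<exists>i\<in>I. x \<in> nat_comp K elts (?D i) \<epsilon> (\<kappa> i) V ` carrier (Lin K (H i) V)"
    if V: "V \<in> Vect K elts" and x: "x \<in> carrier (fobj X V)" for V x
  proof -
    obtain y where y: "y \<in> carrier (fobj Y V)" "x = \<epsilon> V y"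
      using bij[OF V] x by (auto simp: bij_betw_def)
    obtain i g where i: "i \<in> I" and g: "g \<in> carrier (Lin K (H i) V)" "y = \<kappa> i V g"
      using p V y(1) unfolding ind_presentation_def by blast
    have "x = nat_comp K elts (?D i) \<epsilon> (\<kappa> i) V g" using V g y(2) by simp
    then show ?thesis using i g(1) by blast
  qed
  ultimately show ?thesis using p by (simp add: ind_presentation_def)
qed

section \<open>Bornological functors as directed unions of representables\<close>

context vect_universe
begin

lemma is_vfunctor_representable:
  assumes H: "H \<in> Vect K elts"
  shows "is_vfunctor K elts (representable K H)"
proof (rule is_vfunctorI)
  note vs = vectorspace_if_Vect
  show "vectorspace K (fobj (representable K H) V)" if "V \<in> Vect K elts" for V
    using vectorspace_Lin[OF vs[OF H] vs[OF that]] by simp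
  show "small elts (carrier (fobj (representable K H) V))" if V: "V \<in> Vect K elts" for V
  proof (rule small_subset[OF small_PiE])
    show "carrier (fobj (representable K H) V) \<subseteq> carrier H \<rightarrow>\<^sub>E carrier V"
      by (auto simp: carrier_Lin_iff PiE_def module_hom_in)
  qed (use H V in \<open>auto simp: small_carrier_if_Vect\<close>)
  fix V W f
  assume V: "V \<in> Vect K elts" and W: "W \<in> Vect K elts" and f: "f \<in> carrier (Lin K V W)"
  have f_hom: "f \<in> module_hom K V W" using f by (simp add: carrier_Lin_iff)
  have g_in: "g x \<in> carrier V" if "g \<in> carrier (Lin K H V)" "x \<in> carrier H" for g x
    using that by (auto simp: carrier_Lin_iff module_hom_in)
  show "farr (representable K H) V W f
      \<in> carrier (Lin K (fobj (representable K H) V) (fobj (representable K H) W))"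
    unfolding representable_sel
    by (intro restrict_in_Lin module_homI vectorspace_Lin vs H V compose_in_Lin[OF vs[OF H] _ f])
       (auto simp: Lin_sel compose_def g_in vs_add_closed[OF vs[OF V]] module_hom_add[OF f_hom]
          module_hom_smult[OF f_hom])
  fix g x assume g: "g \<in> carrier (Lin K V W)" and x: "x \<in> carrier (fobj (representable K H) V)"
  show "farr (representable K H) V W (f \<oplus>\<^bsub>Lin K V W\<^esub> g) x =
      farr (representable K H) V W f x \<oplus>\<^bsub>fobj (representable K H) W\<^esub> farr (representable K H) V W g x"
    using x by (auto simp: Lin_sel compose_def g_in)
next
  note vs = vectorspace_if_Vect
  fix V W a f x
  assume V: "V \<in> Vect K elts" and W: "W \<in> Vect K elts" and a: "a \<in> carrier K"
    and f: "f \<in> carrier (Lin K V W)" and x: "x \<in> carrier (fobj (representable K H) V)"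
  have "x v \<in> carrier V" if "v \<in> carrier H" for v
    using x that by (auto simp: carrier_Lin_iff module_hom_in)
  then show "farr (representable K H) V W (a \<odot>\<^bsub>Lin K V W\<^esub> f) x =
      a \<odot>\<^bsub>fobj (representable K H) W\<^esub> farr (representable K H) V W f x"
    using x by (auto simp: Lin_sel compose_def)
next
  fix V x assume "V \<in> Vect K elts" and x: "x \<in> carrier (fobj (representable K H) V)"
  then have "x v \<in> carrier V" if "v \<in> carrier H" for v
    using that by (auto simp: carrier_Lin_iff module_hom_in)
  then show "farr (representable K H) V V (lin_id V) x = x"
    using x by (intro extensionalityI[of _ "carrier H"])
      (auto simp: carrier_Lin_iff compose_def lin_id_def)
next
  fix U V W f g x
  assume "U \<in> Vect K elts" "V \<in> Vect K elts" "W \<in> Vect K elts"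
    and f: "f \<in> carrier (Lin K U V)" and x: "x \<in> carrier (fobj (representable K H) U)"
  then have "x v \<in> carrier U" if "v \<in> carrier H" for v
    using that by (auto simp: carrier_Lin_iff module_hom_in)
  moreover have "compose (carrier H) f x \<in> carrier (Lin K H V)"
    using compose_in_Lin[OF vectorspace_if_Vect[OF H] _ f] x by simp
  ultimately show "farr (representable K H) U W (compose (carrier U) g f) x =
      farr (representable K H) V W g (farr (representable K H) U V f x)"
    using x by (auto simp: compose_def cong: restrict_cong)
qed

lemma is_vfunctor_born_functor:
  assumes \<F>: "bornology \<Gamma> \<F>" and \<Gamma>: "small elts \<Gamma>"
  shows "is_vfunctor K elts (born_functor \<Gamma> \<F>)"
proof (rule is_vfunctorI)
  note vs = vectorspace_if_Vect
  show vsB: "vectorspace K (fobj (born_functor \<Gamma> \<F>) V)" if "V \<in> Vect K elts" for V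
    using vectorspace_born_space[OF \<F> vs[OF that]] by simp
  show "small elts (carrier (fobj (born_functor \<Gamma> \<F>) V))" if "V \<in> Vect K elts" for V
    using small_born_space[OF \<Gamma> small_carrier_if_Vect[OF that]] by simp
  show "farr (born_functor \<Gamma> \<F>) V W f
      \<in> carrier (Lin K (fobj (born_functor \<Gamma> \<F>) V) (fobj (born_functor \<Gamma> \<F>) W))"
    if V: "V \<in> Vect K elts" and W: "W \<in> Vect K elts" and f: "f \<in> carrier (Lin K V W)" for V W f
  proof -
    have f_hom: "f \<in> module_hom K V W" using f by (simp add: carrier_Lin_iff)
    show ?thesis
      unfolding farr_born_functor fobj_born_functor
      by (rule restrict_in_Lin[OF vectorspace_born_space[OF \<F> vs[OF V]]], rule module_homI)
         (auto simp: born_space_map[OF \<F> vs[OF V] vs[OF W] f_hom], auto simp: born_space_sel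
           carrier_born_space_iff module_hom_add[OF f_hom] module_hom_smult[OF f_hom])
  qed
  show "farr (born_functor \<Gamma> \<F>) V W (f \<oplus>\<^bsub>Lin K V W\<^esub> g) x =
      farr (born_functor \<Gamma> \<F>) V W f x \<oplus>\<^bsub>fobj (born_functor \<Gamma> \<F>) W\<^esub> farr (born_functor \<Gamma> \<F>) V W g x"
    if "x \<in> carrier (fobj (born_functor \<Gamma> \<F>) V)" for V W f g x
    using that by (auto simp: farr_born_functor born_space_sel carrier_born_space_iff Lin_sel)
  show "farr (born_functor \<Gamma> \<F>) V W (a \<odot>\<^bsub>Lin K V W\<^esub> f) x =
      a \<odot>\<^bsub>fobj (born_functor \<Gamma> \<F>) W\<^esub> farr (born_functor \<Gamma> \<F>) V W f x"
    if "x \<in> carrier (fobj (born_functor \<Gamma> \<F>) V)" for V W a f x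
    using that by (auto simp: farr_born_functor born_space_sel carrier_born_space_iff Lin_sel)
  show "farr (born_functor \<Gamma> \<F>) V V (lin_id V) x = x"
    if "x \<in> carrier (fobj (born_functor \<Gamma> \<F>) V)" for V x
    using that by (intro extensionalityI[of _ \<Gamma>])
      (auto simp: farr_born_functor carrier_born_space_iff lin_id_def)
  show "farr (born_functor \<Gamma> \<F>) U W (compose (carrier U) g f) x =
      farr (born_functor \<Gamma> \<F>) V W g (farr (born_functor \<Gamma> \<F>) U V f x)"
    if U: "U \<in> Vect K elts" and V: "V \<in> Vect K elts" and f: "f \<in> carrier (Lin K U V)"
      and x: "x \<in> carrier (fobj (born_functor \<Gamma> \<F>) U)" for U V W f g x
  proof -
    have "(\<lambda>\<gamma>\<in>\<Gamma>. f (x \<gamma>)) \<in> carrier (born_space \<Gamma> \<F> V)"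
      using born_space_map[OF \<F> vs[OF U] vs[OF V], of f x] f x by (simp add: carrier_Lin_iff)
    moreover have "x \<gamma> \<in> carrier U" if "\<gamma> \<in> \<Gamma>" for \<gamma> using x that by (simp add: carrier_born_space_iff)
    ultimately show ?thesis
      using x by (auto simp: farr_born_functor compose_def cong: restrict_cong)
  qed
qed

text \<open>The index poset is the bornology itself, ordered by inclusion and directed because it is
  closed under unions. A linear map from the free space on \<open>F\<close> is the same as a family
  on \<open>F\<close>, so the representables are the functors of families on \<open>F\<close> and
  the cocone extends such families by zero. The support of every element is one of the
  indices.\<close>

lemma ex_ind_presentation_born_functor:
  assumes \<F>: "bornology \<Gamma> \<F>" and \<Gamma>: "small elts \<Gamma>"
  shows "\<exists>I r H \<tau> \<kappa>. ind_presentation K elts I r H \<tau> (born_functor \<Gamma> \<F>) \<kappa>"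
proof -
  note vs = vectorspace_if_Vect
  have "small elts \<F>"
    by (rule small_subset[OF small_Pow[OF \<Gamma>]]) (use bornology_Pow[OF \<F>] in auto)
  \<comment> \<open>The members of \<F> are renamed by elements of the universe; \<open>d\<close>
    recovers the set that an index stands for.\<close>
  then obtain z d' where d': "bij_betw d' \<F> (elts z)" unfolding small_iff_bij_betw by blast
  define I where "I = elts z"
  define d where "d = inv_into \<F> d'"
  have d: "bij_betw d I \<F>" unfolding d_def I_def using d' by (rule bij_betw_inv_into)
  have d_in: "d i \<in> \<F>" if "i \<in> I" for i using d that by (auto simp: bij_betw_def)
  have d_sub: "d i \<subseteq> \<Gamma>" if "i \<in> I" for i using bornology_Pow[OF \<F> d_in[OF that]] .
  have d_surj: "\<exists>i\<in>I. F = d i" if "F \<in> \<F>" for F using d that by (auto simp: bij_betw_def)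
  define r where "r = {(i, j). i \<in> I \<and> j \<in> I \<and> d i \<subseteq> d j}"
  have r: "directed_poset I r"
  proof -
    have "I \<noteq> {}" using d_surj[OF bornology_finite[OF \<F>, of "{}"]] by auto
    moreover have "antisym r"
      using d by (auto simp: r_def antisym_def bij_betw_def inj_on_def)
    then have "partial_order_on I r"
      by (auto simp: partial_order_on_def preorder_on_def r_def refl_on_def trans_def)
    moreover have "\<exists>l\<in>I. (i, l) \<in> r \<and> (j, l) \<in> r" if "i \<in> I" "j \<in> I" for i j
      using d_surj[OF bornology_Un[OF \<F> d_in[OF that(1)] d_in[OF that(2)]]] that
      by (auto simp: r_def)
    ultimately show ?thesis by (auto simp: directed_poset_def r_def)
  qed
  have "\<exists>H e c. H \<in> Vect K elts \<and> coord_basis K (d i) H e c" if "i \<in> I" for i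
    using ex_coord_basis[OF field_K small_K small_subset[OF \<Gamma> d_sub[OF that]]] by blast
  then obtain H e c where H: "\<And>i. i \<in> I \<Longrightarrow> H i \<in> Vect K elts"
    and b: "\<And>i. i \<in> I \<Longrightarrow> coord_basis K (d i) (H i) (e i) (c i)" by metis
  let ?X = "born_functor \<Gamma> \<F>"
  let ?D = "\<lambda>i. representable K (H i)"
  have D_fun: "is_vfunctor K elts (?D i)" if "i \<in> I" for i
    using is_vfunctor_representable[OF H[OF that]] .
  define \<kappa> where "\<kappa> i = (\<lambda>V\<in>Vect K elts. \<lambda>g\<in>carrier (Lin K (H i) V).
    \<lambda>\<gamma>\<in>\<Gamma>. if \<gamma> \<in> d i then g (e i \<gamma>) else \<zero>\<^bsub>V\<^esub>)" for i
  \<comment> \<open>For \<open>d i\<close> contained in \<open>d j\<close> this is the coordinate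
    projection from the larger free space to the smaller one. Precomposition with it extends a
    family by zero from \<open>d i\<close> to \<open>d j\<close>.\<close>
  define P where "P i j = lin_ext (d j) (H j) (c j) (H i) (\<lambda>\<gamma>. if \<gamma> \<in> d i then e i \<gamma> else \<zero>\<^bsub>H i\<^esub>)"
    for i j
  define \<tau> where "\<tau> i j = (\<lambda>V\<in>Vect K elts. \<lambda>g\<in>carrier (Lin K (H i) V).
    compose (carrier (H j)) g (P i j))" for i j
  have e: "e i \<gamma> \<in> carrier (H i)" if "i \<in> I" "\<gamma> \<in> d i" for i \<gamma>
    using coord_basis_in[OF b[OF that(1)] that(2)] .
  have g_in: "g (e i \<gamma>) \<in> carrier V" if "i \<in> I" "\<gamma> \<in> d i" "g \<in> carrier (Lin K (H i) V)" for i \<gamma> g V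
    using that e by (auto simp: carrier_Lin_iff module_hom_in)
  have \<kappa>_in: "\<kappa> i V g \<in> carrier (born_space \<Gamma> \<F> V)"
    if i: "i \<in> I" and V: "V \<in> Vect K elts" and g: "g \<in> carrier (Lin K (H i) V)" for i V g
  proof -
    have "{\<gamma>\<in>\<Gamma>. \<kappa> i V g \<gamma> \<noteq> \<zero>\<^bsub>V\<^esub>} \<in> \<F>"
      by (rule bornology_subset[OF \<F> d_in[OF i]]) (use V g in \<open>auto simp: \<kappa>_def\<close>)
    then show ?thesis
      using i V g by (auto simp: carrier_born_space_iff \<kappa>_def g_in vs_zero_closed[OF vs[OF V]])
  qed
  have \<kappa>N: "\<kappa> i \<in> carrier (Nat K elts (?D i) ?X)" if i: "i \<in> I" for i
  proof (rule NatI)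
    show "\<kappa> i \<in> extensional (Vect K elts)" by (simp add: \<kappa>_def)
    show "\<kappa> i V \<in> carrier (Lin K (fobj (?D i) V) (fobj ?X V))" if V: "V \<in> Vect K elts" for V
      unfolding carrier_Lin_iff
    proof (intro conjI module_homI)
      show "\<kappa> i V \<in> extensional (carrier (fobj (?D i) V))" using V by (simp add: \<kappa>_def)
      note vsL = vectorspace_Lin[OF vs[OF H[OF i]] vs[OF V]]
      show "\<kappa> i V (g \<oplus>\<^bsub>fobj (?D i) V\<^esub> h) = \<kappa> i V g \<oplus>\<^bsub>fobj ?X V\<^esub> \<kappa> i V h"
        if "g \<in> carrier (fobj (?D i) V)" "h \<in> carrier (fobj (?D i) V)" for g h
        using that i V vs_add_closed[OF vsL, of g h]
        by (auto simp: \<kappa>_def born_space_sel Lin_sel e vs_simps[OF vs[OF V]] intro!: restrict_ext)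
      show "\<kappa> i V (a \<odot>\<^bsub>fobj (?D i) V\<^esub> g) = a \<odot>\<^bsub>fobj ?X V\<^esub> \<kappa> i V g"
        if "a \<in> carrier K" "g \<in> carrier (fobj (?D i) V)" for a g
        using that i V vs_smult_closed[OF vsL, of a g]
        by (auto simp: \<kappa>_def born_space_sel Lin_sel e vs_simps[OF vs[OF V]] intro!: restrict_ext)
    qed (simp add: \<kappa>_in[OF i V])
    fix V W f g
    assume V: "V \<in> Vect K elts" and W: "W \<in> Vect K elts" and f: "f \<in> carrier (Lin K V W)"
      and g: "g \<in> carrier (fobj (?D i) V)"
    have f_hom: "f \<in> module_hom K V W" using f by (simp add: carrier_Lin_iff)
    show "\<kappa> i W (farr (?D i) V W f g) = farr ?X V W f (\<kappa> i V g)"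
      using g V W i compose_in_Lin[OF vs[OF H[OF i]] _ f, of g] \<kappa>_in[OF i V, of g]
      by (auto simp: farr_born_functor \<kappa>_def compose_def e module_hom_zero[OF vs[OF V] vs[OF W] f_hom]
          intro!: restrict_ext)
  qed
  have \<kappa>_inj: "inj_on (\<kappa> i V) (carrier (Lin K (H i) V))" if i: "i \<in> I" and V: "V \<in> Vect K elts" for i V
  proof (rule inj_onI)
    fix g h
    assume g: "g \<in> carrier (Lin K (H i) V)" and h: "h \<in> carrier (Lin K (H i) V)"
      and eq: "\<kappa> i V g = \<kappa> i V h"
    show "g = h"
    proof (rule Lin_eq_on_basis[OF b[OF i] vs[OF V] g h])
      fix \<gamma> assume "\<gamma> \<in> d i"
      then show "g (e i \<gamma>) = h (e i \<gamma>)"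
        using fun_cong[OF eq, of \<gamma>] d_sub[OF i] g h V by (auto simp: \<kappa>_def)
    qed
  qed
  have \<kappa>_surj: "\<exists>i\<in>I. x \<in> \<kappa> i V ` carrier (Lin K (H i) V)"
    if V: "V \<in> Vect K elts" and x: "x \<in> carrier (fobj ?X V)" for V x
  proof -
    have x': "x \<in> carrier (born_space \<Gamma> \<F> V)" using x by simp
    \<comment> \<open>The support of \<open>x\<close> itself serves as the index.\<close>
    obtain i where i: "i \<in> I" and di: "{\<gamma>\<in>\<Gamma>. x \<gamma> \<noteq> \<zero>\<^bsub>V\<^esub>} = d i"
      using d_surj[of "{\<gamma>\<in>\<Gamma>. x \<gamma> \<noteq> \<zero>\<^bsub>V\<^esub>}"] x' by (auto simp: carrier_born_space_iff)
    have xV: "x \<gamma> \<in> carrier V" if "\<gamma> \<in> d i" for \<gamma>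
      using x' d_sub[OF i] that by (auto simp: carrier_born_space_iff)
    define g where "g = lin_ext (d i) (H i) (c i) V x"
    have g: "g \<in> carrier (Lin K (H i) V)"
      unfolding g_def using lin_ext_in_Lin[OF b[OF i] vs[OF V] xV] .
    have ge: "g (e i \<gamma>) = x \<gamma>" if "\<gamma> \<in> d i" for \<gamma>
      unfolding g_def using lin_ext_basis[OF b[OF i] vs[OF V] xV that] .
    have "x = \<kappa> i V g"
    proof (rule born_space_eqI[OF x' \<kappa>_in[OF i V g]])
      fix \<gamma> assume "\<gamma> \<in> \<Gamma>"
      then show "x \<gamma> = \<kappa> i V g \<gamma>"
        using V g di by (auto simp: \<kappa>_def ge)
    qed
    then show ?thesis using i g by blast
  qed
  have P: "P i j \<in> carrier (Lin K (H j) (H i))" if "i \<in> I" "j \<in> I" for i j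
    unfolding P_def using that e vs_zero_closed[OF vs[OF H]]
    by (intro lin_ext_in_Lin[OF b vs[OF H]]) auto
  have P_e: "P i j (e j \<gamma>) = (if \<gamma> \<in> d i then e i \<gamma> else \<zero>\<^bsub>H i\<^esub>)"
    if "i \<in> I" "j \<in> I" "\<gamma> \<in> d j" for i j \<gamma>
    unfolding P_def using that e vs_zero_closed[OF vs[OF H]]
    by (intro lin_ext_basis[OF b vs[OF H]]) auto
  have \<tau>_in: "\<tau> i j V g \<in> carrier (Lin K (H j) V)"
    if "i \<in> I" "j \<in> I" "V \<in> Vect K elts" "g \<in> carrier (Lin K (H i) V)" for i j V g
    using that compose_in_Lin[OF vs[OF H[OF that(2)]] P[OF that(1,2)] that(4)] by (simp add: \<tau>_def)
  have \<tau>N: "\<tau> i j \<in> carrier (Nat K elts (?D i) (?D j))" if i: "i \<in> I" and j: "j \<in> I" for i j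
  proof (rule NatI)
    have Pin: "P i j x \<in> carrier (H i)" if "x \<in> carrier (H j)" for x
      using P[OF i j] that by (auto simp: carrier_Lin_iff module_hom_in)
    show "\<tau> i j \<in> extensional (Vect K elts)" by (simp add: \<tau>_def)
    show "\<tau> i j V \<in> carrier (Lin K (fobj (?D i) V) (fobj (?D j) V))" if V: "V \<in> Vect K elts" for V
      unfolding carrier_Lin_iff
    proof (intro conjI module_homI)
      show "\<tau> i j V \<in> extensional (carrier (fobj (?D i) V))" using V by (simp add: \<tau>_def)
      note vsL = vectorspace_Lin[OF vs[OF H[OF i]] vs[OF V]]
      show "\<tau> i j V (g \<oplus>\<^bsub>fobj (?D i) V\<^esub> h) = \<tau> i j V g \<oplus>\<^bsub>fobj (?D j) V\<^esub> \<tau> i j V h"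
        if "g \<in> carrier (fobj (?D i) V)" "h \<in> carrier (fobj (?D i) V)" for g h
        using that V vs_add_closed[OF vsL, of g h]
        by (auto simp: \<tau>_def Lin_sel compose_def Pin intro!: restrict_ext)
      show "\<tau> i j V (a \<odot>\<^bsub>fobj (?D i) V\<^esub> g) = a \<odot>\<^bsub>fobj (?D j) V\<^esub> \<tau> i j V g"
        if "a \<in> carrier K" "g \<in> carrier (fobj (?D i) V)" for a g
        using that V vs_smult_closed[OF vsL, of a g]
        by (auto simp: \<tau>_def Lin_sel compose_def Pin intro!: restrict_ext)
    qed (simp add: \<tau>_in[OF i j V])
    fix V W f g
    assume V: "V \<in> Vect K elts" and W: "W \<in> Vect K elts" and f: "f \<in> carrier (Lin K V W)"
      and g: "g \<in> carrier (fobj (?D i) V)"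
    show "\<tau> i j W (farr (?D i) V W f g) = farr (?D j) V W f (\<tau> i j V g)"
      using g V W compose_in_Lin[OF vs[OF H[OF i]] _ f, of g] \<tau>_in[OF i j V, of g]
      by (auto simp: \<tau>_def compose_def Pin intro!: restrict_ext)
  qed
  have \<kappa>\<tau>: "\<kappa> j V (\<tau> i j V g) = \<kappa> i V g"
    if i: "i \<in> I" and j: "j \<in> I" and sub: "d i \<subseteq> d j" and V: "V \<in> Vect K elts"
      and g: "g \<in> carrier (Lin K (H i) V)" for i j V g
  proof (rule born_space_eqI[OF \<kappa>_in[OF j V \<tau>_in[OF i j V g]] \<kappa>_in[OF i V g]])
    fix \<gamma> assume "\<gamma> \<in> \<Gamma>"
    moreover have "\<tau> i j V g (e j \<gamma>) = (if \<gamma> \<in> d i then g (e i \<gamma>) else \<zero>\<^bsub>V\<^esub>)" if "\<gamma> \<in> d j"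
      using V g e[OF j that] P_e[OF i j that] module_hom_zero[OF vs[OF H[OF i]] vs[OF V], of g]
      by (simp add: \<tau>_def compose_def carrier_Lin_iff)
    ultimately show "\<kappa> j V (\<tau> i j V g) \<gamma> = \<kappa> i V g \<gamma>"
      using V g \<tau>_in[OF i j V g] sub by (auto simp: \<kappa>_def)
  qed
  have rI: "i \<in> I" "j \<in> I" "d i \<subseteq> d j" if "(i, j) \<in> r" for i j using that by (auto simp: r_def)
  have refl: "(i, i) \<in> r" if "i \<in> I" for i using that by (simp add: r_def)
  have rtrans: "(i, l) \<in> r" if "(i, j) \<in> r" "(j, l) \<in> r" for i j l using that by (auto simp: r_def)
  have "is_diagram K elts I r ?D \<tau>"
    unfolding is_diagram_def
  proof (intro conjI ballI allI impI)
    show "\<tau> i j \<in> carrier (Nat K elts (?D i) (?D j))" if "(i, j) \<in> r" for i j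
      using \<tau>N rI[OF that] by blast
    \<comment> \<open>The diagram laws need no computation with \<open>P\<close>: by
      \<open>\<kappa>\<tau>\<close> both sides agree after the cocone map, which is injective. The
      composition law below is obtained in the same way.\<close>
    show "\<tau> i i = nat_id K elts (?D i)" if i: "i \<in> I" for i
    proof (rule Nat_eqI[OF \<tau>N[OF i i] nat_id_in_Nat[OF D_fun[OF i]]])
      fix V g assume V: "V \<in> Vect K elts" and g: "g \<in> carrier (fobj (?D i) V)"
      then have g': "g \<in> carrier (Lin K (H i) V)" by simp
      have "\<tau> i i V g = g"
        using \<kappa>\<tau>[OF i i _ V g'] by (rule inj_onD[OF \<kappa>_inj[OF i V]]) (use \<tau>_in[OF i i V g'] g' in auto)
      then show "\<tau> i i V g = nat_id K elts (?D i) V g" using V g by simp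
    qed
    fix i j l assume ij: "(i, j) \<in> r" and jl: "(j, l) \<in> r"
    note i = rI(1)[OF ij] and j = rI(2)[OF ij] and l = rI(2)[OF jl]
    show "\<tau> i l = nat_comp K elts (?D i) (\<tau> j l) (\<tau> i j)"
    proof (rule Nat_eqI[OF \<tau>N[OF i l] nat_comp_in_Nat[OF D_fun[OF i] \<tau>N[OF i j] \<tau>N[OF j l]]])
      fix V g assume V: "V \<in> Vect K elts" and g: "g \<in> carrier (fobj (?D i) V)"
      then have g': "g \<in> carrier (Lin K (H i) V)" by simp
      note t = \<tau>_in[OF i j V g']
      have "\<kappa> l V (\<tau> i l V g) = \<kappa> l V (\<tau> j l V (\<tau> i j V g))"
        using \<kappa>\<tau>[OF i l rI(3)[OF rtrans[OF ij jl]] V g'] \<kappa>\<tau>[OF j l rI(3)[OF jl] V t]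
          \<kappa>\<tau>[OF i j rI(3)[OF ij] V g'] by simp
      then have "\<tau> i l V g = \<tau> j l V (\<tau> i j V g)"
        by (rule inj_onD[OF \<kappa>_inj[OF l V]]) (rule \<tau>_in[OF i l V g'], rule \<tau>_in[OF j l V t])
      then show "\<tau> i l V g = nat_comp K elts (?D i) (\<tau> j l) (\<tau> i j) V g" using V g by simp
    qed
  qed (rule D_fun)
  moreover have "is_cocone K elts I r ?D \<tau> ?X \<kappa>"
    unfolding is_cocone_def
  proof (intro conjI ballI allI impI)
    fix i j assume ij: "(i, j) \<in> r"
    note i = rI(1)[OF ij] and j = rI(2)[OF ij]
    show "\<kappa> i = nat_comp K elts (?D i) (\<kappa> j) (\<tau> i j)"
      using \<kappa>N[OF i] nat_comp_in_Nat[OF D_fun[OF i] \<tau>N[OF i j] \<kappa>N[OF j]]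
      by (rule Nat_eqI) (simp add: \<kappa>\<tau>[OF i j rI(3)[OF ij]])
  qed (rule \<kappa>N)
  ultimately have "ind_presentation K elts I r H \<tau> ?X \<kappa>"
    unfolding ind_presentation_def using r H \<kappa>_inj \<kappa>_surj by (auto simp: I_def)
  then show ?thesis by blast
qed

end

section \<open>The internal Hom of two bornological functors\<close>

text \<open>Fibres over points outside \<open>G\<close> are empty, so finiteness may be demanded
  over every point. The bound \<open>G\<close> and the finiteness of fibres then become two separate
  conditions.\<close>

lemma bornology_fun_iff:
  "S \<in> bornology_fun \<Gamma> \<F> \<Delta> \<G> \<longleftrightarrow> S \<subseteq> \<Gamma> \<times> \<Delta> \<and>
    (\<forall>F\<in>\<F>. (\<exists>G\<in>\<G>. \<forall>\<gamma>\<in>F. \<forall>\<delta>. (\<gamma>, \<delta>) \<in> S \<longrightarrow> \<delta> \<in> G) \<and> (\<forall>\<delta>. finite {\<gamma>\<in>F. (\<gamma>, \<delta>) \<in> S}))"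
  (is "?L \<longleftrightarrow> ?R")
proof
  assume L: ?L
  have "(\<exists>G\<in>\<G>. \<forall>\<gamma>\<in>F. \<forall>\<delta>. (\<gamma>, \<delta>) \<in> S \<longrightarrow> \<delta> \<in> G) \<and> (\<forall>\<delta>. finite {\<gamma>\<in>F. (\<gamma>, \<delta>) \<in> S})"
    if F: "F \<in> \<F>" for F
  proof -
    obtain G where G: "G \<in> \<G>" "S \<inter> (F \<times> \<Delta>) \<subseteq> F \<times> G" "\<forall>g\<in>G. finite {\<gamma>\<in>F. (\<gamma>, g) \<in> S}"
      using L F unfolding bornology_fun_def by blast
    have S: "\<delta> \<in> G" if "\<gamma> \<in> F" "(\<gamma>, \<delta>) \<in> S" for \<gamma> \<delta>
      using that G(2) L unfolding bornology_fun_def by blast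
    have "finite {\<gamma>\<in>F. (\<gamma>, \<delta>) \<in> S}" for \<delta>
    proof (cases "\<delta> \<in> G")
      case False
      then have "{\<gamma>\<in>F. (\<gamma>, \<delta>) \<in> S} = {}" using S by auto
      then show ?thesis by (simp only: finite.emptyI)
    qed (use G(3) in simp)
    then show ?thesis using G(1) S by blast
  qed
  moreover have "S \<subseteq> \<Gamma> \<times> \<Delta>" using L by (simp add: bornology_fun_def)
  ultimately show ?R by simp
next
  assume R: ?R
  have "\<exists>G\<in>\<G>. S \<inter> (F \<times> \<Delta>) \<subseteq> F \<times> G \<and> (\<forall>g\<in>G. finite {\<gamma>\<in>F. (\<gamma>, g) \<in> S})" if F: "F \<in> \<F>" for F
  proof -
    obtain G where G: "G \<in> \<G>" "\<forall>\<gamma>\<in>F. \<forall>\<delta>. (\<gamma>, \<delta>) \<in> S \<longrightarrow> \<delta> \<in> G" using R F by blast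
    then have "S \<inter> (F \<times> \<Delta>) \<subseteq> F \<times> G" by blast
    moreover have "\<forall>g\<in>G. finite {\<gamma>\<in>F. (\<gamma>, g) \<in> S}" using R F by simp
    ultimately show ?thesis using G(1) by (intro bexI[of _ G] conjI)
  qed
  then show ?L using R by (simp add: bornology_fun_def)
qed

lemma
  assumes "S \<in> bornology_fun \<Gamma> \<F> \<Delta> \<G>" "F \<in> \<F>"
  shows bornology_fun_range: "\<exists>G\<in>\<G>. \<forall>\<gamma>\<in>F. \<forall>\<delta>. (\<gamma>, \<delta>) \<in> S \<longrightarrow> \<delta> \<in> G"
    and bornology_fun_fibre: "finite {\<gamma>\<in>F. (\<gamma>, \<delta>) \<in> S}"
  using assms by (simp_all add: bornology_fun_iff)

lemma bornology_bornology_fun: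
  assumes \<G>: "bornology \<Delta> \<G>"
  shows "bornology (\<Gamma> \<times> \<Delta>) (bornology_fun \<Gamma> \<F> \<Delta> \<G>)"
  unfolding bornology_def
proof (intro conjI ballI allI impI)
  let ?B = "bornology_fun \<Gamma> \<F> \<Delta> \<G>"
  show "?B \<subseteq> Pow (\<Gamma> \<times> \<Delta>)" by (auto simp: bornology_fun_def)
  show "T \<in> ?B" if S: "S \<in> ?B" and "T \<subseteq> S" for S T
  proof -
    have "finite {\<gamma>\<in>F. (\<gamma>, \<delta>) \<in> T}" if "F \<in> \<F>" for F \<delta>
      by (rule finite_subset[of _ "{\<gamma>\<in>F. (\<gamma>, \<delta>) \<in> S}"])
         (use S \<open>T \<subseteq> S\<close> that in \<open>auto simp: bornology_fun_iff\<close>)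
    then show ?thesis
      using S \<open>T \<subseteq> S\<close> unfolding bornology_fun_iff by (meson subsetD subset_trans)
  qed
  show "S \<union> T \<in> ?B" if S: "S \<in> ?B" and T: "T \<in> ?B" for S T
    unfolding bornology_fun_iff
  proof (intro conjI ballI allI)
    show "S \<union> T \<subseteq> \<Gamma> \<times> \<Delta>" using S T by (auto simp: bornology_fun_iff)
    fix F assume F: "F \<in> \<F>"
    obtain G where G: "G \<in> \<G>" "\<forall>\<gamma>\<in>F. \<forall>\<delta>. (\<gamma>, \<delta>) \<in> S \<longrightarrow> \<delta> \<in> G"
      using bornology_fun_range[OF S F] by (elim bexE)
    obtain G' where G': "G' \<in> \<G>" "\<forall>\<gamma>\<in>F. \<forall>\<delta>. (\<gamma>, \<delta>) \<in> T \<longrightarrow> \<delta> \<in> G'"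
      using bornology_fun_range[OF T F] by (elim bexE)
    from G G' show "\<exists>G\<in>\<G>. \<forall>\<gamma>\<in>F. \<forall>\<delta>. (\<gamma>, \<delta>) \<in> S \<union> T \<longrightarrow> \<delta> \<in> G"
      by (intro bexI[of _ "G \<union> G'"] bornology_Un[OF \<G>]) auto
    fix \<delta>
    have "{\<gamma>\<in>F. (\<gamma>, \<delta>) \<in> S \<union> T} = {\<gamma>\<in>F. (\<gamma>, \<delta>) \<in> S} \<union> {\<gamma>\<in>F. (\<gamma>, \<delta>) \<in> T}" by auto
    then show "finite {\<gamma>\<in>F. (\<gamma>, \<delta>) \<in> S \<union> T}" using S T F by (simp add: bornology_fun_iff)
  qed
  show "S \<in> ?B" if S: "S \<subseteq> \<Gamma> \<times> \<Delta>" and fin: "finite S" for S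
    unfolding bornology_fun_iff
  proof (intro conjI ballI allI)
    fix F
    \<comment> \<open>For a finite \<open>S\<close> the second projection bounds the range for every
      \<open>F\<close> simultaneously.\<close>
    have "snd ` S \<in> \<G>" using S fin by (intro bornology_finite[OF \<G>]) auto
    then show "\<exists>G\<in>\<G>. \<forall>\<gamma>\<in>F. \<forall>\<delta>. (\<gamma>, \<delta>) \<in> S \<longrightarrow> \<delta> \<in> G"
      by (intro bexI[of _ "snd ` S"] ballI allI impI) (erule rev_image_eqI, simp)
    show "finite {\<gamma>\<in>F. (\<gamma>, \<delta>) \<in> S}" for \<delta>
      by (rule finite_subset[of _ "fst ` S"]) (use fin in \<open>auto intro: rev_image_eqI\<close>)
  qed (rule S)
qed

locale bornological_pair = vect_universe elts K for elts :: "'u \<Rightarrow> 'u set" and K :: "'k ring" +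
  fixes \<Gamma> :: "'a set" and \<F> :: "'a set set" and \<Delta> :: "'b set" and \<G> :: "'b set set"
  assumes small_\<Gamma>: "small elts \<Gamma>" and small_\<Delta>: "small elts \<Delta>"
    and \<F>: "bornology \<Gamma> \<F>" and \<G>: "bornology \<Delta> \<G>"
begin

abbreviation "X \<equiv> born_functor \<Gamma> \<F>"
abbreviation "Y \<equiv> born_functor \<Delta> \<G>"
abbreviation "B \<equiv> born_functor (\<Gamma> \<times> \<Delta>) (bornology_fun \<Gamma> \<F> \<Delta> \<G>)"
abbreviation "Hom \<equiv> ind_Hom K elts X Y"
abbreviation "tens \<equiv> tensor K elts"
abbreviation "pure \<equiv> pure_tensor K elts"

lemma bornology_B: "bornology (\<Gamma> \<times> \<Delta>) (bornology_fun \<Gamma> \<F> \<Delta> \<G>)"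
  using \<G> by (rule bornology_bornology_fun)

lemma small_B: "small elts (\<Gamma> \<times> \<Delta>)"
  using small_\<Gamma> small_\<Delta> by (rule small_Times)

lemmas vs = vectorspace_if_Vect
lemmas is_vfunctor_X = is_vfunctor_born_functor[OF \<F> small_\<Gamma>]
lemmas is_vfunctor_Y = is_vfunctor_born_functor[OF \<G> small_\<Delta>]
lemmas is_vfunctor_B = is_vfunctor_born_functor[OF bornology_B small_B]

lemma tensor_shift_sel [simp]:
  "fobj (tensor_shift K elts Z V) W = fobj Z (tens W V)"
  "farr (tensor_shift K elts Z V) W W' f =
    farr Z (tens W V) (tens W' V) (tensor_map K elts W V W' V f (lin_id V))"
  by (simp_all add: tensor_shift_def)

text \<open>Kept as a function of both families, so that naturality in \<open>W\<close> and in
  \<open>V\<close> becomes a single statement. The sum is taken by \<open>fsum\<close>;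
  \<open>pairing_finite\<close> guarantees that it is a genuine finite sum.\<close>

definition pairing ::
    "('k, 'u) module \<Rightarrow> ('k, 'u) module \<Rightarrow> ('a \<Rightarrow> 'u) \<Rightarrow> ('a \<times> 'b \<Rightarrow> 'u) \<Rightarrow> 'b \<Rightarrow> 'u" where
  "pairing W V \<psi> \<phi> = (\<lambda>\<delta>\<in>\<Delta>. fsum (tens W V) (\<lambda>\<gamma>. pure W V (\<psi> \<gamma>) (\<phi> (\<gamma>, \<delta>))) \<Gamma>)"

context
  fixes W V assumes W: "W \<in> Vect K elts" and V: "V \<in> Vect K elts"
begin

lemma pairing_term_in:
  assumes "\<psi> \<in> carrier (fobj X W)" "\<phi> \<in> carrier (fobj B V)" "\<delta> \<in> \<Delta>" "\<gamma> \<in> \<Gamma>"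
  shows "pure W V (\<psi> \<gamma>) (\<phi> (\<gamma>, \<delta>)) \<in> carrier (tens W V)"
  using assms by (auto simp: carrier_born_space_iff intro!: pure_tensor_in[OF W V])

lemma pairing_term_nonzero:
  assumes "\<psi> \<in> carrier (fobj X W)" "\<phi> \<in> carrier (fobj B V)" "\<delta> \<in> \<Delta>" "\<gamma> \<in> \<Gamma>"
    and "pure W V (\<psi> \<gamma>) (\<phi> (\<gamma>, \<delta>)) \<noteq> \<zero>\<^bsub>tens W V\<^esub>"
  shows "\<gamma> \<in> {\<gamma>\<in>\<Gamma>. \<psi> \<gamma> \<noteq> \<zero>\<^bsub>W\<^esub>}" "(\<gamma>, \<delta>) \<in> {p\<in>\<Gamma> \<times> \<Delta>. \<phi> p \<noteq> \<zero>\<^bsub>V\<^esub>}"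
  using assms by (auto simp: carrier_born_space_iff pure_tensor_zero[OF W V])

text \<open>Nonzero terms have \<open>\<gamma>\<close> in the support of \<open>\<psi>\<close>, a
  member of \<F>, and \<open>(\<gamma>, \<delta>)\<close> in the support of \<open>\<phi>\<close>.
  This is where the finite fibres of the function bornology are used.\<close>

lemma pairing_finite:
  assumes \<psi>: "\<psi> \<in> carrier (fobj X W)" and \<phi>: "\<phi> \<in> carrier (fobj B V)" and \<delta>: "\<delta> \<in> \<Delta>"
  shows "finite {\<gamma>\<in>\<Gamma>. pure W V (\<psi> \<gamma>) (\<phi> (\<gamma>, \<delta>)) \<noteq> \<zero>\<^bsub>tens W V\<^esub>}"
proof (rule finite_subset)
  let ?F = "{\<gamma>\<in>\<Gamma>. \<psi> \<gamma> \<noteq> \<zero>\<^bsub>W\<^esub>}" and ?S = "{p\<in>\<Gamma> \<times> \<Delta>. \<phi> p \<noteq> \<zero>\<^bsub>V\<^esub>}"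
  show "{\<gamma>\<in>\<Gamma>. pure W V (\<psi> \<gamma>) (\<phi> (\<gamma>, \<delta>)) \<noteq> \<zero>\<^bsub>tens W V\<^esub>} \<subseteq> {\<gamma>\<in>?F. (\<gamma>, \<delta>) \<in> ?S}"
    using pairing_term_nonzero[OF \<psi> \<phi> \<delta>] by blast
  show "finite {\<gamma>\<in>?F. (\<gamma>, \<delta>) \<in> ?S}"
    by (rule bornology_fun_fibre[of _ \<Gamma> \<F> \<Delta> \<G>])
       (use \<psi> \<phi> in \<open>simp_all add: carrier_born_space_iff\<close>)
qed

text \<open>The other half of the function bornology: the set \<open>G\<close> that belongs to the
  support of \<open>\<psi>\<close> contains all \<open>\<delta>\<close> at which some term is
  nonzero.\<close>

lemma pairing_in:
  assumes \<psi>: "\<psi> \<in> carrier (fobj X W)" and \<phi>: "\<phi> \<in> carrier (fobj B V)"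
  shows "pairing W V \<psi> \<phi> \<in> carrier (fobj Y (tens W V))"
proof -
  let ?F = "{\<gamma>\<in>\<Gamma>. \<psi> \<gamma> \<noteq> \<zero>\<^bsub>W\<^esub>}" and ?S = "{p\<in>\<Gamma> \<times> \<Delta>. \<phi> p \<noteq> \<zero>\<^bsub>V\<^esub>}"
  have "?F \<in> \<F>" "?S \<in> bornology_fun \<Gamma> \<F> \<Delta> \<G>"
    using \<psi> \<phi> by (simp_all add: carrier_born_space_iff)
  from bornology_fun_range[OF this(2,1)]
  obtain G where G: "G \<in> \<G>" "\<forall>\<gamma>\<in>?F. \<forall>\<delta>. (\<gamma>, \<delta>) \<in> ?S \<longrightarrow> \<delta> \<in> G"
    by (elim bexE)
  have "fsum (tens W V) (\<lambda>\<gamma>. pure W V (\<psi> \<gamma>) (\<phi> (\<gamma>, \<delta>))) \<Gamma> = \<zero>\<^bsub>tens W V\<^esub>"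
    if \<delta>: "\<delta> \<in> \<Delta>" "\<delta> \<notin> G" for \<delta>
  proof (rule fsum_zero[OF _ vectorspace_tensor[OF W V]])
    fix \<gamma> assume "\<gamma> \<in> \<Gamma>"
    then show "pure W V (\<psi> \<gamma>) (\<phi> (\<gamma>, \<delta>)) = \<zero>\<^bsub>tens W V\<^esub>"
      using pairing_term_nonzero[OF \<psi> \<phi> \<delta>(1)] G(2) \<delta>(2) by blast
  qed
  then have "{\<delta>\<in>\<Delta>. pairing W V \<psi> \<phi> \<delta> \<noteq> \<zero>\<^bsub>tens W V\<^esub>} \<subseteq> G" by (auto simp: pairing_def)
  then have "{\<delta>\<in>\<Delta>. pairing W V \<psi> \<phi> \<delta> \<noteq> \<zero>\<^bsub>tens W V\<^esub>} \<in> \<G>" using bornology_subset[OF \<G> G(1)] by blast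
  moreover have "pairing W V \<psi> \<phi> \<delta> \<in> carrier (tens W V)" if "\<delta> \<in> \<Delta>" for \<delta>
    using fsum_closed[OF vectorspace_tensor[OF W V] pairing_term_in[OF \<psi> \<phi> that]] that
    by (simp add: pairing_def)
  moreover have "pairing W V \<psi> \<phi> \<in> extensional \<Delta>" by (simp add: pairing_def)
  ultimately show ?thesis by (simp add: carrier_born_space_iff)
qed

lemma pairing_hom_left:
  assumes \<phi>: "\<phi> \<in> carrier (fobj B V)"
  shows "(\<lambda>\<psi>. pairing W V \<psi> \<phi>) \<in> module_hom K (fobj X W) (fobj Y (tens W V))"
proof (rule module_homI)
  note vsT = vectorspace_tensor[OF W V] and vsX = vfunctor_vectorspace[OF is_vfunctor_X W]
  note t = pairing_term_in[OF _ \<phi>] and fin = pairing_finite[OF _ \<phi>]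
  have \<phi>V: "\<phi> (\<gamma>, \<delta>) \<in> carrier V" if "\<gamma> \<in> \<Gamma>" "\<delta> \<in> \<Delta>" for \<gamma> \<delta>
    using \<phi> that by (simp add: carrier_born_space_iff)
  note left = pure_tensor_hom_left[OF W V \<phi>V]
  show "pairing W V \<psi> \<phi> \<in> carrier (fobj Y (tens W V))" if "\<psi> \<in> carrier (fobj X W)" for \<psi>
    using pairing_in[OF that \<phi>] .
  show "pairing W V (\<psi> \<oplus>\<^bsub>fobj X W\<^esub> \<psi>') \<phi> =
      pairing W V \<psi> \<phi> \<oplus>\<^bsub>fobj Y (tens W V)\<^esub> pairing W V \<psi>' \<phi>"
    if \<psi>: "\<psi> \<in> carrier (fobj X W)" and \<psi>': "\<psi>' \<in> carrier (fobj X W)" for \<psi> \<psi>'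
  proof -
    have "fsum (tens W V) (\<lambda>\<gamma>. pure W V ((\<psi> \<oplus>\<^bsub>fobj X W\<^esub> \<psi>') \<gamma>) (\<phi> (\<gamma>, \<delta>))) \<Gamma> =
        fsum (tens W V) (\<lambda>\<gamma>. pure W V (\<psi> \<gamma>) (\<phi> (\<gamma>, \<delta>))) \<Gamma> \<oplus>\<^bsub>tens W V\<^esub>
        fsum (tens W V) (\<lambda>\<gamma>. pure W V (\<psi>' \<gamma>) (\<phi> (\<gamma>, \<delta>))) \<Gamma>" if \<delta>: "\<delta> \<in> \<Delta>" for \<delta>
    proof -
      have "fsum (tens W V) (\<lambda>\<gamma>. pure W V ((\<psi> \<oplus>\<^bsub>fobj X W\<^esub> \<psi>') \<gamma>) (\<phi> (\<gamma>, \<delta>))) \<Gamma> =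
          fsum (tens W V) (\<lambda>\<gamma>. pure W V (\<psi> \<gamma>) (\<phi> (\<gamma>, \<delta>)) \<oplus>\<^bsub>tens W V\<^esub>
            pure W V (\<psi>' \<gamma>) (\<phi> (\<gamma>, \<delta>))) \<Gamma>"
        using t[OF vs_add_closed[OF vsX \<psi> \<psi>'] \<delta>] \<psi> \<psi>' \<delta>
        by (intro fsum_cong[OF vsT])
           (auto simp: born_space_sel carrier_born_space_iff module_hom_add[OF left])
      then show ?thesis
        using fsum_add[OF vsT t[OF \<psi> \<delta>] fin[OF \<psi> \<delta>] t[OF \<psi>' \<delta>] fin[OF \<psi>' \<delta>]] by simp
    qed
    then show ?thesis
      by (simp add: pairing_def born_space_sel cong: restrict_cong)
  qed
  show "pairing W V (a \<odot>\<^bsub>fobj X W\<^esub> \<psi>) \<phi> = a \<odot>\<^bsub>fobj Y (tens W V)\<^esub> pairing W V \<psi> \<phi>"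
    if a: "a \<in> carrier K" and \<psi>: "\<psi> \<in> carrier (fobj X W)" for a \<psi>
  proof -
    have "fsum (tens W V) (\<lambda>\<gamma>. pure W V ((a \<odot>\<^bsub>fobj X W\<^esub> \<psi>) \<gamma>) (\<phi> (\<gamma>, \<delta>))) \<Gamma> =
        a \<odot>\<^bsub>tens W V\<^esub> fsum (tens W V) (\<lambda>\<gamma>. pure W V (\<psi> \<gamma>) (\<phi> (\<gamma>, \<delta>))) \<Gamma>"
      if \<delta>: "\<delta> \<in> \<Delta>" for \<delta>
    proof -
      have "fsum (tens W V) (\<lambda>\<gamma>. pure W V ((a \<odot>\<^bsub>fobj X W\<^esub> \<psi>) \<gamma>) (\<phi> (\<gamma>, \<delta>))) \<Gamma> =
          fsum (tens W V) (\<lambda>\<gamma>. a \<odot>\<^bsub>tens W V\<^esub> pure W V (\<psi> \<gamma>) (\<phi> (\<gamma>, \<delta>))) \<Gamma>"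
        using t[OF vs_smult_closed[OF vsX a \<psi>] \<delta>] a \<psi> \<delta>
        by (intro fsum_cong[OF vsT])
           (auto simp: born_space_sel carrier_born_space_iff module_hom_smult[OF left])
      then show ?thesis using fsum_smult[OF vsT a t[OF \<psi> \<delta>] fin[OF \<psi> \<delta>]] by simp
    qed
    then show ?thesis
      by (simp add: pairing_def born_space_sel cong: restrict_cong)
  qed
qed

lemma pairing_hom_right:
  assumes \<psi>: "\<psi> \<in> carrier (fobj X W)"
  shows "pairing W V \<psi> \<in> module_hom K (fobj B V) (fobj Y (tens W V))"
proof (rule module_homI)
  note vsT = vectorspace_tensor[OF W V] and vsB = vfunctor_vectorspace[OF is_vfunctor_B V]
  note t = pairing_term_in[OF \<psi>] and fin = pairing_finite[OF \<psi>]
  have \<psi>W: "\<psi> \<gamma> \<in> carrier W" if "\<gamma> \<in> \<Gamma>" for \<gamma>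
    using \<psi> that by (simp add: carrier_born_space_iff)
  note right = pure_tensor_hom_right[OF W V \<psi>W]
  show "pairing W V \<psi> \<phi> \<in> carrier (fobj Y (tens W V))" if "\<phi> \<in> carrier (fobj B V)" for \<phi>
    using pairing_in[OF \<psi> that] .
  show "pairing W V \<psi> (\<phi> \<oplus>\<^bsub>fobj B V\<^esub> \<phi>') =
      pairing W V \<psi> \<phi> \<oplus>\<^bsub>fobj Y (tens W V)\<^esub> pairing W V \<psi> \<phi>'"
    if \<phi>: "\<phi> \<in> carrier (fobj B V)" and \<phi>': "\<phi>' \<in> carrier (fobj B V)" for \<phi> \<phi>'
  proof -
    have "fsum (tens W V) (\<lambda>\<gamma>. pure W V (\<psi> \<gamma>) ((\<phi> \<oplus>\<^bsub>fobj B V\<^esub> \<phi>') (\<gamma>, \<delta>))) \<Gamma> =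
        fsum (tens W V) (\<lambda>\<gamma>. pure W V (\<psi> \<gamma>) (\<phi> (\<gamma>, \<delta>))) \<Gamma> \<oplus>\<^bsub>tens W V\<^esub>
        fsum (tens W V) (\<lambda>\<gamma>. pure W V (\<psi> \<gamma>) (\<phi>' (\<gamma>, \<delta>))) \<Gamma>" if \<delta>: "\<delta> \<in> \<Delta>" for \<delta>
    proof -
      have "fsum (tens W V) (\<lambda>\<gamma>. pure W V (\<psi> \<gamma>) ((\<phi> \<oplus>\<^bsub>fobj B V\<^esub> \<phi>') (\<gamma>, \<delta>))) \<Gamma> =
          fsum (tens W V) (\<lambda>\<gamma>. pure W V (\<psi> \<gamma>) (\<phi> (\<gamma>, \<delta>)) \<oplus>\<^bsub>tens W V\<^esub>
            pure W V (\<psi> \<gamma>) (\<phi>' (\<gamma>, \<delta>))) \<Gamma>"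
        using t[OF vs_add_closed[OF vsB \<phi> \<phi>'] \<delta>] \<phi> \<phi>' \<delta>
        by (intro fsum_cong[OF vsT])
           (auto simp: born_space_sel carrier_born_space_iff module_hom_add[OF right])
      then show ?thesis
        using fsum_add[OF vsT t[OF \<phi> \<delta>] fin[OF \<phi> \<delta>] t[OF \<phi>' \<delta>] fin[OF \<phi>' \<delta>]] by simp
    qed
    then show ?thesis
      by (simp add: pairing_def born_space_sel cong: restrict_cong)
  qed
  show "pairing W V \<psi> (a \<odot>\<^bsub>fobj B V\<^esub> \<phi>) = a \<odot>\<^bsub>fobj Y (tens W V)\<^esub> pairing W V \<psi> \<phi>"
    if a: "a \<in> carrier K" and \<phi>: "\<phi> \<in> carrier (fobj B V)" for a \<phi>
  proof -
    have "fsum (tens W V) (\<lambda>\<gamma>. pure W V (\<psi> \<gamma>) ((a \<odot>\<^bsub>fobj B V\<^esub> \<phi>) (\<gamma>, \<delta>))) \<Gamma> =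
        a \<odot>\<^bsub>tens W V\<^esub> fsum (tens W V) (\<lambda>\<gamma>. pure W V (\<psi> \<gamma>) (\<phi> (\<gamma>, \<delta>))) \<Gamma>"
      if \<delta>: "\<delta> \<in> \<Delta>" for \<delta>
    proof -
      have "fsum (tens W V) (\<lambda>\<gamma>. pure W V (\<psi> \<gamma>) ((a \<odot>\<^bsub>fobj B V\<^esub> \<phi>) (\<gamma>, \<delta>))) \<Gamma> =
          fsum (tens W V) (\<lambda>\<gamma>. a \<odot>\<^bsub>tens W V\<^esub> pure W V (\<psi> \<gamma>) (\<phi> (\<gamma>, \<delta>))) \<Gamma>"
        using t[OF vs_smult_closed[OF vsB a \<phi>] \<delta>] a \<phi> \<delta>
        by (intro fsum_cong[OF vsT])
           (auto simp: born_space_sel carrier_born_space_iff module_hom_smult[OF right])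
      then show ?thesis using fsum_smult[OF vsT a t[OF \<phi> \<delta>] fin[OF \<phi> \<delta>]] by simp
    qed
    then show ?thesis
      by (simp add: pairing_def born_space_sel cong: restrict_cong)
  qed
qed

text \<open>The map induced on tensor products is linear and sends pure tensors to pure tensors, so
  it passes under the sum. With \<open>g\<close> an identity this makes each \<open>\<phi>\<close>
  act as a natural transformation; with \<open>f\<close> an identity it makes the action natural in
  \<open>V\<close>.\<close>

lemma pairing_natural:
  assumes W': "W' \<in> Vect K elts" and V': "V' \<in> Vect K elts"
    and f: "f \<in> carrier (Lin K W W')" and g: "g \<in> carrier (Lin K V V')"
    and \<psi>: "\<psi> \<in> carrier (fobj X W)" and \<phi>: "\<phi> \<in> carrier (fobj B V)"
  shows "pairing W' V' (farr X W W' f \<psi>) (farr B V V' g \<phi>) =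
    farr Y (tens W V) (tens W' V') (tensor_map K elts W V W' V' f g) (pairing W V \<psi> \<phi>)"
proof -
  let ?m = "tensor_map K elts W V W' V' f g"
  have m: "?m \<in> module_hom K (tens W V) (tens W' V')"
    using tensor_map_in_Lin[OF W V W' V' f g] by (simp add: carrier_Lin_iff)
  have "?m (fsum (tens W V) (\<lambda>\<gamma>. pure W V (\<psi> \<gamma>) (\<phi> (\<gamma>, \<delta>))) \<Gamma>) =
      fsum (tens W' V') (\<lambda>\<gamma>. pure W' V' (farr X W W' f \<psi> \<gamma>) (farr B V V' g \<phi> (\<gamma>, \<delta>))) \<Gamma>"
    if \<delta>: "\<delta> \<in> \<Delta>" for \<delta>
  proof (rule trans[OF fsum_hom[OF vectorspace_tensor[OF W V] vectorspace_tensor[OF W' V'] m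
      pairing_term_in[OF \<psi> \<phi> \<delta>] pairing_finite[OF \<psi> \<phi> \<delta>]]
      fsum_cong[OF vectorspace_tensor[OF W' V']]])
    fix \<gamma> assume \<gamma>: "\<gamma> \<in> \<Gamma>"
    show "?m (pure W V (\<psi> \<gamma>) (\<phi> (\<gamma>, \<delta>))) \<in> carrier (tens W' V')"
      using module_hom_in[OF m pairing_term_in[OF \<psi> \<phi> \<delta> \<gamma>]] .
    have "\<psi> \<gamma> \<in> carrier W" "\<phi> (\<gamma>, \<delta>) \<in> carrier V"
      using \<psi> \<phi> \<gamma> \<delta> by (simp_all add: carrier_born_space_iff)
    from tensor_map_pure[OF W V W' V' f g this]
    show "?m (pure W V (\<psi> \<gamma>) (\<phi> (\<gamma>, \<delta>))) = pure W' V' (farr X W W' f \<psi> \<gamma>) (farr B V V' g \<phi> (\<gamma>, \<delta>))"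
      using \<psi> \<phi> \<gamma> \<delta> by (simp add: farr_born_functor)
  qed
  then show ?thesis
    using pairing_in[OF \<psi> \<phi>]
    by (simp add: farr_born_functor[of \<Delta>], simp add: pairing_def cong: restrict_cong)
qed

end

text \<open>The nested restrictions make the values literal elements of \<open>Nat\<close>, hence
  comparable by equality of functions. An inverse is not given by a formula and comes later from
  bijectivity.\<close>

definition iso :: "('k, 'u) module \<Rightarrow> ('a \<times> 'b \<Rightarrow> 'u) \<Rightarrow> ('k, 'u) module \<Rightarrow> ('a \<Rightarrow> 'u) \<Rightarrow> 'b \<Rightarrow> 'u" where
  "iso = (\<lambda>V\<in>Vect K elts. \<lambda>\<phi>\<in>carrier (fobj B V).
     \<lambda>W\<in>Vect K elts. \<lambda>\<psi>\<in>carrier (fobj X W). pairing W V \<psi> \<phi>)"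

lemma iso_apply:
  "V \<in> Vect K elts \<Longrightarrow> \<phi> \<in> carrier (fobj B V) \<Longrightarrow> W \<in> Vect K elts \<Longrightarrow> \<psi> \<in> carrier (fobj X W) \<Longrightarrow>
   iso V \<phi> W \<psi> = pairing W V \<psi> \<phi>"
  by (simp add: iso_def)

lemma fobj_Hom: "fobj Hom V = Nat K elts X (tensor_shift K elts Y V)"
  by (simp add: ind_Hom_def)

lemma farr_id_B: "V \<in> Vect K elts \<Longrightarrow> \<phi> \<in> carrier (fobj B V) \<Longrightarrow> farr B V V (lin_id V) \<phi> = \<phi>"
  using vfunctor_id[OF is_vfunctor_B, of V] by (simp add: lin_id_def)

lemma farr_id_X: "W \<in> Vect K elts \<Longrightarrow> \<psi> \<in> carrier (fobj X W) \<Longrightarrow> farr X W W (lin_id W) \<psi> = \<psi>"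
  using vfunctor_id[OF is_vfunctor_X, of W] by (simp add: lin_id_def)

lemma iso_in_Nat:
  assumes V: "V \<in> Vect K elts" and \<phi>: "\<phi> \<in> carrier (fobj B V)"
  shows "iso V \<phi> \<in> carrier (fobj Hom V)"
  unfolding fobj_Hom
proof (rule NatI)
  show "iso V \<phi> \<in> extensional (Vect K elts)" using V \<phi> by (simp add: iso_def)
  show "iso V \<phi> W \<in> carrier (Lin K (fobj X W) (fobj (tensor_shift K elts Y V) W))"
    if W: "W \<in> Vect K elts" for W
    using restrict_in_Lin[OF vfunctor_vectorspace[OF is_vfunctor_X W] pairing_hom_left[OF W V \<phi>]]
      V \<phi> W by (simp add: iso_def)
  fix W W' f \<psi>
  assume W: "W \<in> Vect K elts" and W': "W' \<in> Vect K elts" and f: "f \<in> carrier (Lin K W W')"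
    and \<psi>: "\<psi> \<in> carrier (fobj X W)"
  show "iso V \<phi> W' (farr X W W' f \<psi>) = farr (tensor_shift K elts Y V) W W' f (iso V \<phi> W \<psi>)"
    using pairing_natural[OF W V W' V f lin_id_in_Lin[OF vs[OF V]] \<psi> \<phi>]
      vfunctor_farr_closed[OF is_vfunctor_X W W' f \<psi>]
    by (simp only: iso_apply[OF V \<phi>] W W' \<psi> farr_id_B[OF V \<phi>] tensor_shift_sel)
qed

lemma iso_hom:
  assumes V: "V \<in> Vect K elts" shows "iso V \<in> module_hom K (fobj B V) (fobj Hom V)"
proof (rule module_homI)
  note vsB = vfunctor_vectorspace[OF is_vfunctor_B V]
  show "iso V \<phi> \<in> carrier (fobj Hom V)" if "\<phi> \<in> carrier (fobj B V)" for \<phi>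
    using iso_in_Nat[OF V that] .
  show "iso V (\<phi> \<oplus>\<^bsub>fobj B V\<^esub> \<phi>') = iso V \<phi> \<oplus>\<^bsub>fobj Hom V\<^esub> iso V \<phi>'"
    if "\<phi> \<in> carrier (fobj B V)" "\<phi>' \<in> carrier (fobj B V)" for \<phi> \<phi>'
  proof -
    have "pairing W V \<psi> (\<phi> \<oplus>\<^bsub>fobj B V\<^esub> \<phi>') =
        pairing W V \<psi> \<phi> \<oplus>\<^bsub>fobj Y (tens W V)\<^esub> pairing W V \<psi> \<phi>'"
      if "W \<in> Vect K elts" "\<psi> \<in> carrier (fobj X W)" for W \<psi>
      using module_hom_add[OF pairing_hom_right[OF that(1) V that(2)] \<open>\<phi> \<in> _\<close> \<open>\<phi>' \<in> _\<close>] .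
    then show ?thesis
      using V that vs_add_closed[OF vsB that] unfolding fobj_Hom Nat_sel iso_def
      by (simp del: fobj_born_functor cong: restrict_cong)
  qed
  show "iso V (a \<odot>\<^bsub>fobj B V\<^esub> \<phi>) = a \<odot>\<^bsub>fobj Hom V\<^esub> iso V \<phi>"
    if "a \<in> carrier K" "\<phi> \<in> carrier (fobj B V)" for a \<phi>
  proof -
    have "pairing W V \<psi> (a \<odot>\<^bsub>fobj B V\<^esub> \<phi>) = a \<odot>\<^bsub>fobj Y (tens W V)\<^esub> pairing W V \<psi> \<phi>"
      if "W \<in> Vect K elts" "\<psi> \<in> carrier (fobj X W)" for W \<psi>
      using module_hom_smult[OF pairing_hom_right[OF that(1) V that(2)] \<open>a \<in> _\<close> \<open>\<phi> \<in> _\<close>] .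
    then show ?thesis
      using V that vs_smult_closed[OF vsB that] unfolding fobj_Hom Nat_sel iso_def
      by (simp del: fobj_born_functor cong: restrict_cong)
  qed
qed

lemma iso_zero:
  assumes V: "V \<in> Vect K elts" shows "iso V \<zero>\<^bsub>fobj B V\<^esub> = \<zero>\<^bsub>fobj Hom V\<^esub>"
proof -
  note vsB = vfunctor_vectorspace[OF is_vfunctor_B V]
  have "pairing W V \<psi> \<zero>\<^bsub>fobj B V\<^esub> = \<zero>\<^bsub>fobj Y (tens W V)\<^esub>"
    if "W \<in> Vect K elts" "\<psi> \<in> carrier (fobj X W)" for W \<psi>
    using module_hom_zero[OF vsB vfunctor_vectorspace[OF is_vfunctor_Y tensor_in_Vect[OF that(1) V]]
      pairing_hom_right[OF that(1) V that(2)]] .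
  then show ?thesis
    using V vs_zero_closed[OF vsB] unfolding fobj_Hom Nat_sel iso_def
    by (simp del: fobj_born_functor cong: restrict_cong)
qed

lemma farr_Hom_iso:
  assumes V: "V \<in> Vect K elts" and V': "V' \<in> Vect K elts" and g: "g \<in> carrier (Lin K V V')"
    and \<phi>: "\<phi> \<in> carrier (fobj B V)"
  shows "farr Hom V V' g (iso V \<phi>) = iso V' (farr B V V' g \<phi>)"
proof -
  have g\<phi>: "farr B V V' g \<phi> \<in> carrier (fobj B V')"
    using vfunctor_farr_closed[OF is_vfunctor_B V V' g \<phi>] .
  have "farr Y (tens W V) (tens W V') (tensor_map K elts W V W V' (lin_id W) g) (pairing W V \<psi> \<phi>) =
      pairing W V' \<psi> (farr B V V' g \<phi>)" if W: "W \<in> Vect K elts" and \<psi>: "\<psi> \<in> carrier (fobj X W)" for W \<psi>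
    using pairing_natural[OF W V W V' lin_id_in_Lin[OF vs[OF W]] g \<psi> \<phi>] farr_id_X[OF W \<psi>] by simp
  then have "nat_comp K elts X (\<lambda>W. farr Y (tens W V) (tens W V')
        (tensor_map K elts W V W V' (lin_id W) g)) (iso V \<phi>) = iso V' (farr B V V' g \<phi>)"
    using V V' \<phi> g\<phi> unfolding nat_comp_def compose_def iso_def
    by (simp del: fobj_born_functor cong: restrict_cong)
  then show ?thesis
    using iso_in_Nat[OF V \<phi>] by (simp add: ind_Hom_def)
qed

end

section \<open>Bijectivity, by evaluation at generic families\<close>

context bornological_pair
begin

text \<open>For \<open>H\<close> free on \<open>F\<close> this is the element that corresponds to
  the identity of \<open>H\<close> under Yoneda: every family with support in \<open>F\<close> is
  its image under exactly one linear map out of \<open>H\<close>.\<close>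

definition generic :: "'a set \<Rightarrow> ('k, 'u) module \<Rightarrow> ('a \<Rightarrow> 'u) \<Rightarrow> 'a \<Rightarrow> 'u" where
  "generic F H e = (\<lambda>\<gamma>\<in>\<Gamma>. if \<gamma> \<in> F then e \<gamma> else \<zero>\<^bsub>H\<^esub>)"

lemma generic_in:
  assumes F: "F \<in> \<F>" and H: "H \<in> Vect K elts" and b: "coord_basis K F H e c"
  shows "generic F H e \<in> carrier (fobj X H)"
proof -
  have "{\<gamma>\<in>\<Gamma>. generic F H e \<gamma> \<noteq> \<zero>\<^bsub>H\<^esub>} \<in> \<F>"
    by (rule bornology_subset[OF \<F> F]) (auto simp: generic_def)
  then show ?thesis
    using coord_basis_in[OF b] vs_zero_closed[OF vs[OF H]]
    by (simp add: carrier_born_space_iff generic_def)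
qed

text \<open>One predicate for the free space, its basis and the coordinates of its tensor product
  with \<open>V\<close>, so that all of them can be chosen at once for every member of \<F>.\<close>

definition tensor_basis ::
    "('k, 'u) module \<Rightarrow> 'a set \<Rightarrow> ('k, 'u) module \<Rightarrow> ('a \<Rightarrow> 'u) \<Rightarrow> ('a \<Rightarrow> 'u \<Rightarrow> 'k) \<Rightarrow> ('a \<Rightarrow> 'u \<Rightarrow> 'u) \<Rightarrow> bool"
  where "tensor_basis V F H e c q \<longleftrightarrow> H \<in> Vect K elts \<and> coord_basis K F H e c \<and>
    (\<forall>\<gamma>\<in>F. q \<gamma> \<in> module_hom K (tens H V) V \<and>
      (\<forall>x\<in>carrier H. \<forall>v\<in>carrier V. q \<gamma> (pure H V x v) = c \<gamma> x \<odot>\<^bsub>V\<^esub> v)) \<and>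
    (\<forall>t\<in>carrier (tens H V). finite {\<gamma>\<in>F. q \<gamma> t \<noteq> \<zero>\<^bsub>V\<^esub>} \<and>
      fsum (tens H V) (\<lambda>\<gamma>. pure H V (e \<gamma>) (q \<gamma> t)) F = t)"

lemma
  assumes "tensor_basis V F H e c q"
  shows tensor_basis_Vect: "H \<in> Vect K elts"
    and tensor_basis_coord_basis: "coord_basis K F H e c"
    and tensor_basis_hom: "\<And>\<gamma>. \<gamma> \<in> F \<Longrightarrow> q \<gamma> \<in> module_hom K (tens H V) V"
    and tensor_basis_pure: "\<And>\<gamma> x v. \<gamma> \<in> F \<Longrightarrow> x \<in> carrier H \<Longrightarrow> v \<in> carrier V \<Longrightarrow>
      q \<gamma> (pure H V x v) = c \<gamma> x \<odot>\<^bsub>V\<^esub> v"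
    and tensor_basis_finite: "\<And>t. t \<in> carrier (tens H V) \<Longrightarrow> finite {\<gamma>\<in>F. q \<gamma> t \<noteq> \<zero>\<^bsub>V\<^esub>}"
    and tensor_basis_expand: "\<And>t. t \<in> carrier (tens H V) \<Longrightarrow>
      fsum (tens H V) (\<lambda>\<gamma>. pure H V (e \<gamma>) (q \<gamma> t)) F = t"
  using assms by (simp_all add: tensor_basis_def)

lemma ex_tensor_basis:
  assumes F: "F \<in> \<F>" and V: "V \<in> Vect K elts"
  shows "\<exists>H e c q. tensor_basis V F H e c q"
proof -
  have small_F: "small elts F" using small_subset[OF small_\<Gamma> bornology_Pow[OF \<F> F]] .
  obtain H e c where H: "H \<in> Vect K elts" and b: "coord_basis K F H e c"
    using ex_coord_basis[OF field_K small_K small_F] by blast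
  show ?thesis
    using ex_tensor_coordinates[OF H b small_F V] H b unfolding tensor_basis_def by (elim exE) blast
qed

text \<open>The generic family vanishes off \<open>F\<close> and is the basis on \<open>F\<close>,
  so the sum takes the shape of the coordinate expansion in \<open>tensor_basis\<close>, with
  coefficients \<open>\<phi> (\<gamma>, \<delta>)\<close>.\<close>

lemma pairing_generic:
  assumes F: "F \<in> \<F>" and H: "H \<in> Vect K elts" and b: "coord_basis K F H e c"
    and V: "V \<in> Vect K elts" and \<phi>: "\<phi> \<in> carrier (fobj B V)" and \<delta>: "\<delta> \<in> \<Delta>"
  shows "pairing H V (generic F H e) \<phi> \<delta> = fsum (tens H V) (\<lambda>\<gamma>. pure H V (e \<gamma>) (\<phi> (\<gamma>, \<delta>))) F"
proof -
  have sub: "F \<subseteq> \<Gamma>" using bornology_Pow[OF \<F> F] .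
  have \<phi>V: "\<phi> (\<gamma>, \<delta>) \<in> carrier V" if "\<gamma> \<in> \<Gamma>" for \<gamma>
    using \<phi> that \<delta> by (simp add: carrier_born_space_iff)
  have "pairing H V (generic F H e) \<phi> \<delta> =
      fsum (tens H V) (\<lambda>\<gamma>. pure H V (generic F H e \<gamma>) (\<phi> (\<gamma>, \<delta>))) \<Gamma>"
    using \<delta> by (simp add: pairing_def)
  also have "\<dots> = fsum (tens H V) (\<lambda>\<gamma>. pure H V (generic F H e \<gamma>) (\<phi> (\<gamma>, \<delta>))) F"
    using \<phi>V by (intro fsum_mono_neutral[OF sub]) (auto simp: generic_def pure_tensor_zero[OF H V])
  also have "\<dots> = fsum (tens H V) (\<lambda>\<gamma>. pure H V (e \<gamma>) (\<phi> (\<gamma>, \<delta>))) F"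
    using sub \<phi>V by (intro fsum_cong[OF vectorspace_tensor[OF H V]])
      (auto simp: generic_def subset_iff coord_basis_in[OF b] intro!: pure_tensor_in[OF H V])
  finally show ?thesis .
qed

text \<open>Singletons suffice: they are members of \<F>, and over \<open>{\<gamma>}\<close> the
  value at the generic family is one pure tensor, from which its coordinate returns
  \<open>\<phi> (\<gamma>, \<delta>)\<close>.\<close>

lemma iso_inj:
  assumes V: "V \<in> Vect K elts" shows "inj_on (iso V) (carrier (fobj B V))"
proof (rule inj_onI)
  fix \<phi> \<phi>'
  assume \<phi>: "\<phi> \<in> carrier (fobj B V)" and \<phi>': "\<phi>' \<in> carrier (fobj B V)" and eq: "iso V \<phi> = iso V \<phi>'"
  show "\<phi> = \<phi>'"
  proof (rule born_space_eqI[OF \<phi>[simplified] \<phi>'[simplified]])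
    fix p assume "p \<in> \<Gamma> \<times> \<Delta>"
    then obtain \<gamma> \<delta> where p: "p = (\<gamma>, \<delta>)" and \<gamma>: "\<gamma> \<in> \<Gamma>" and \<delta>: "\<delta> \<in> \<Delta>" by blast
    have F: "{\<gamma>} \<in> \<F>" using \<gamma> by (intro bornology_finite[OF \<F>]) auto
    obtain H e c q where basis: "tensor_basis V {\<gamma>} H e c q" using ex_tensor_basis[OF F V] by blast
    note H = tensor_basis_Vect[OF basis] and b = tensor_basis_coord_basis[OF basis]
    note q = tensor_basis_pure[OF basis singletonI]
    have e: "e \<gamma> \<in> carrier H" using coord_basis_in[OF b] by simp
    have recover: "q \<gamma> (pairing H V (generic {\<gamma>} H e) \<chi> \<delta>) = \<chi> (\<gamma>, \<delta>)"
      if \<chi>: "\<chi> \<in> carrier (fobj B V)" for \<chi>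
    proof -
      have \<chi>V: "\<chi> (\<gamma>, \<delta>) \<in> carrier V" using \<chi> \<gamma> \<delta> by (simp add: carrier_born_space_iff)
      have "pairing H V (generic {\<gamma>} H e) \<chi> \<delta> = pure H V (e \<gamma>) (\<chi> (\<gamma>, \<delta>))"
        unfolding pairing_generic[OF F H b V \<chi> \<delta>]
        using pure_tensor_in[OF H V e \<chi>V] by (intro fsum_single[OF vectorspace_tensor[OF H V]]) auto
      then show ?thesis
        using q[OF e \<chi>V] coord_basis_same[OF b] vs_one_smult[OF vs[OF V] \<chi>V] by simp
    qed
    have "pairing H V (generic {\<gamma>} H e) \<phi> = pairing H V (generic {\<gamma>} H e) \<phi>'"
      using fun_cong[OF fun_cong[OF eq, of H], of "generic {\<gamma>} H e"] generic_in[OF F H b]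
      by (simp only: iso_apply[OF V \<phi> H] iso_apply[OF V \<phi>' H])
    then show "\<phi> p = \<phi>' p" using recover[OF \<phi>] recover[OF \<phi>'] p by simp
  qed
qed

text \<open>\<open>\<phi>\<close> is read off from singletons alone, since a choice of
  \<open>F\<close> for each \<open>\<gamma>\<close> would not obviously be consistent. The core of
  the proof is \<open>\<phi>_eq\<close>: the coordinates of \<open>s F\<close> give the same values
  for every \<open>F\<close> containing \<open>\<gamma>\<close>. Membership in the function
  bornology and the equality with \<open>\<eta>\<close> then follow from properties of
  \<open>s F\<close> for one \<open>F\<close> at a time.\<close>

lemma iso_surj:
  assumes V: "V \<in> Vect K elts" and \<eta>: "\<eta> \<in> carrier (fobj Hom V)"
  shows "\<exists>\<phi>\<in>carrier (fobj B V). iso V \<phi> = \<eta>"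
proof -
  have \<eta>N: "\<eta> \<in> carrier (Nat K elts X (tensor_shift K elts Y V))" using \<eta> by (simp add: fobj_Hom)
  have "\<forall>F\<in>\<F>. \<exists>H e c q. tensor_basis V F H e c q" using ex_tensor_basis[OF _ V] by blast
  then obtain H e c q where basis: "\<And>F. F \<in> \<F> \<Longrightarrow> tensor_basis V F (H F) (e F) (c F) (q F)"
    by metis
  note H = tensor_basis_Vect[OF basis] and b = tensor_basis_coord_basis[OF basis]
    and q = tensor_basis_hom[OF basis] and q_pure = tensor_basis_pure[OF basis]
    and q_fin = tensor_basis_finite[OF basis] and q_sum = tensor_basis_expand[OF basis]
  interpret K: field K by (rule field_K)
  have F_sub: "F \<subseteq> \<Gamma>" if "F \<in> \<F>" for F using bornology_Pow[OF \<F> that] .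
  have sing: "{\<gamma>} \<in> \<F>" if "\<gamma> \<in> \<Gamma>" for \<gamma> using that by (intro bornology_finite[OF \<F>]) auto
  define u where "u F = generic F (H F) (e F)" for F
  have u: "u F \<in> carrier (fobj X (H F))" if "F \<in> \<F>" for F
    unfolding u_def using generic_in[OF that H[OF that] b[OF that]] .
  define s where "s F = \<eta> (H F) (u F)" for F
  have s: "s F \<in> carrier (fobj Y (tens (H F) V))" if "F \<in> \<F>" for F
    unfolding s_def using Nat_closed[OF \<eta>N H[OF that] u[OF that]] by (simp only: tensor_shift_sel)
  have s\<delta>: "s F \<delta> \<in> carrier (tens (H F) V)" if "F \<in> \<F>" "\<delta> \<in> \<Delta>" for F \<delta>
    using s[OF that(1)] that(2) by (simp add: carrier_born_space_iff)
  have \<eta>_u: "\<eta> W (farr X (H F) W f (u F)) =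
      farr Y (tens (H F) V) (tens W V) (tensor_map K elts (H F) V W V f (lin_id V)) (s F)"
    if "F \<in> \<F>" "W \<in> Vect K elts" "f \<in> carrier (Lin K (H F) W)" for F W f
    unfolding s_def using Nat_natural[OF \<eta>N H[OF that(1)] that(2,3) u[OF that(1)]]
    by (simp only: tensor_shift_sel)
  define \<phi> where "\<phi> = (\<lambda>(\<gamma>, \<delta>)\<in>\<Gamma> \<times> \<Delta>. q {\<gamma>} \<gamma> (s {\<gamma>} \<delta>))"
  have \<phi>_eq: "\<phi> (\<gamma>, \<delta>) = q F \<gamma> (s F \<delta>)" if F: "F \<in> \<F>" and \<gamma>: "\<gamma> \<in> F" and \<delta>: "\<delta> \<in> \<Delta>" for F \<gamma> \<delta>
  proof -
    have \<gamma>\<Gamma>: "\<gamma> \<in> \<Gamma>" using F_sub[OF F] \<gamma> by blast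
    let ?E = "{\<gamma>}"
    have E: "?E \<in> \<F>" using sing[OF \<gamma>\<Gamma>] .
    have e: "e ?E \<gamma> \<in> carrier (H ?E)" using coord_basis_in[OF b[OF E]] by simp
    note cK = coord_basis_closed[OF b[OF F] \<gamma>]
    \<comment> \<open>The coordinate projection from the free space on \<open>F\<close> to the one
      on \<open>{\<gamma>}\<close>. It sends one generic family to the other, so naturality of
      \<open>\<eta>\<close> relates \<open>s F\<close> to \<open>s {\<gamma>}\<close>.\<close>
    define f where "f = (\<lambda>x\<in>carrier (H F). c F \<gamma> x \<odot>\<^bsub>H ?E\<^esub> e ?E \<gamma>)"
    have f: "f \<in> carrier (Lin K (H F) (H ?E))"
      unfolding f_def
      by (rule restrict_in_Lin[OF vs[OF H[OF F]]], rule module_homI)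
         (auto simp: cK e vs_smult_closed[OF vs[OF H[OF E]]] vs_smult_l_distr[OF vs[OF H[OF E]]]
           vs_smult_assoc[OF vs[OF H[OF E]]] coord_basis_add[OF b[OF F] \<gamma>]
           coord_basis_smult[OF b[OF F] \<gamma>])
    have f_hom: "f \<in> module_hom K (H F) (H ?E)" using f by (simp add: carrier_Lin_iff)
    have "f (u F \<gamma>') = u ?E \<gamma>'" if "\<gamma>' \<in> \<Gamma>" for \<gamma>'
    proof (cases "\<gamma>' \<in> F")
      case True
      then show ?thesis
        using that \<gamma> coord_basis_in[OF b[OF F] True] e
        by (auto simp: u_def generic_def f_def coord_basis_same[OF b[OF F]]
          coord_basis_other[OF b[OF F] \<gamma> True] vs_one_smult[OF vs[OF H[OF E]]]
          vs_zero_smult[OF vs[OF H[OF E]]])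
    next
      case False
      then show ?thesis
        using that \<gamma> module_hom_zero[OF vs[OF H[OF F]] vs[OF H[OF E]] f_hom]
        by (auto simp: u_def generic_def)
    qed
    then have "farr X (H F) (H ?E) f (u F) = u ?E"
      using vfunctor_farr_closed[OF is_vfunctor_X H[OF F] H[OF E] f u[OF F]] u[OF F] u[OF E]
      by (intro born_space_eqI[of _ \<Gamma> \<F> "H ?E"]) (simp_all add: farr_born_functor)
    from \<eta>_u[OF F H[OF E] f, unfolded this]
    have "s ?E \<delta> = tensor_map K elts (H F) V (H ?E) V f (lin_id V) (s F \<delta>)"
      using s[OF F] \<delta> by (simp add: s_def[of ?E] farr_born_functor)
    \<comment> \<open>Reading the coordinate after the projection or before it gives two linear maps
      on the tensor product; on a pure tensor both return the coordinate of \<open>x\<close> times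
      \<open>v\<close>.\<close>
    moreover have "q ?E \<gamma> (tensor_map K elts (H F) V (H ?E) V f (lin_id V) (s F \<delta>)) = q F \<gamma> (s F \<delta>)"
    proof (rule tensor_hom_eqI[OF H[OF F] V V _ q[OF F \<gamma>] _ s\<delta>[OF F \<delta>]])
      note id = lin_id_in_Lin[OF vs[OF V]]
      have "tensor_map K elts (H F) V (H ?E) V f (lin_id V) \<in> module_hom K (tens (H F) V) (tens (H ?E) V)"
        using tensor_map_in_Lin[OF H[OF F] V H[OF E] V f id] by (simp add: carrier_Lin_iff)
      from module_hom_comp[OF this q[OF E, of \<gamma>]]
      show "(\<lambda>t. q ?E \<gamma> (tensor_map K elts (H F) V (H ?E) V f (lin_id V) t))
          \<in> module_hom K (tens (H F) V) V" by simp
      fix x v assume x: "x \<in> carrier (H F)" and v: "v \<in> carrier V"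
      have "c ?E \<gamma> (f x) = c F \<gamma> x"
        using x cK[OF x] e by (simp add: f_def coord_basis_smult[OF b[OF E]] coord_basis_same[OF b[OF E]])
      then show "q ?E \<gamma> (tensor_map K elts (H F) V (H ?E) V f (lin_id V) (pure (H F) V x v)) =
          q F \<gamma> (pure (H F) V x v)"
        using tensor_map_pure[OF H[OF F] V H[OF E] V f id x v] x v module_hom_in[OF f_hom x]
        by (simp add: q_pure[OF F \<gamma>] q_pure[OF E] lin_id_def)
    qed
    ultimately show ?thesis using \<gamma>\<Gamma> \<delta> by (simp add: \<phi>_def)
  qed
  have \<phi>: "\<phi> \<in> carrier (fobj B V)"
  proof -
    have "\<phi> (\<gamma>, \<delta>) \<in> carrier V" if "\<gamma> \<in> \<Gamma>" "\<delta> \<in> \<Delta>" for \<gamma> \<delta>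
      using \<phi>_eq[OF sing[OF that(1)] _ that(2), of \<gamma>]
        module_hom_in[OF q[OF sing[OF that(1)]] s\<delta>[OF sing[OF that(1)] that(2)], of \<gamma>] by simp
    \<comment> \<open>On \<open>F\<close> the function \<open>\<phi>\<close> consists of the
      coordinates of \<open>s F\<close>. The support of \<open>s F\<close> is the required bound in
      \<G>, and the fibres are finite because a single tensor has finitely many nonzero
      coordinates.\<close>
    moreover have "{p\<in>\<Gamma> \<times> \<Delta>. \<phi> p \<noteq> \<zero>\<^bsub>V\<^esub>} \<in> bornology_fun \<Gamma> \<F> \<Delta> \<G>"
      unfolding bornology_fun_iff
    proof (intro conjI ballI allI)
      show "{p\<in>\<Gamma> \<times> \<Delta>. \<phi> p \<noteq> \<zero>\<^bsub>V\<^esub>} \<subseteq> \<Gamma> \<times> \<Delta>" by blast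
      fix F assume F: "F \<in> \<F>"
      let ?G = "{\<delta>\<in>\<Delta>. s F \<delta> \<noteq> \<zero>\<^bsub>tens (H F) V\<^esub>}"
      have "?G \<in> \<G>" using s[OF F] by (simp add: carrier_born_space_iff)
      moreover have "\<delta> \<in> ?G" if "\<gamma> \<in> F" "(\<gamma>, \<delta>) \<in> {p\<in>\<Gamma> \<times> \<Delta>. \<phi> p \<noteq> \<zero>\<^bsub>V\<^esub>}" for \<gamma> \<delta>
        using that \<phi>_eq[OF F that(1), of \<delta>]
          module_hom_zero[OF vectorspace_tensor[OF H[OF F] V] vs[OF V] q[OF F that(1)]] by auto
      ultimately show "\<exists>G\<in>\<G>. \<forall>\<gamma>\<in>F. \<forall>\<delta>. (\<gamma>, \<delta>) \<in> {p\<in>\<Gamma> \<times> \<Delta>. \<phi> p \<noteq> \<zero>\<^bsub>V\<^esub>} \<longrightarrow> \<delta> \<in> G" by blast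
      fix \<delta>
      show "finite {\<gamma>\<in>F. (\<gamma>, \<delta>) \<in> {p\<in>\<Gamma> \<times> \<Delta>. \<phi> p \<noteq> \<zero>\<^bsub>V\<^esub>}}"
      proof (cases "\<delta> \<in> \<Delta>")
        case True
        show ?thesis
          by (rule finite_subset[OF _ q_fin[OF F s\<delta>[OF F True]]]) (auto simp: \<phi>_eq[OF F])
      qed simp
    qed
    moreover have "\<phi> \<in> extensional (\<Gamma> \<times> \<Delta>)" by (simp add: \<phi>_def)
    ultimately show ?thesis by (auto simp: carrier_born_space_iff)
  qed
  \<comment> \<open>The pairing with a generic family has the coordinates of \<open>s F\<close> as
    coefficients, hence reproduces \<open>s F\<close> by the expansion of a tensor.\<close>
  have pairing_u: "pairing (H F) V (u F) \<phi> = s F" if F: "F \<in> \<F>" for F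
  proof (rule born_space_eqI[of _ \<Delta> \<G> "tens (H F) V"])
    show "pairing (H F) V (u F) \<phi> \<in> carrier (born_space \<Delta> \<G> (tens (H F) V))"
      using pairing_in[OF H[OF F] V u[OF F] \<phi>] by simp
    show "s F \<in> carrier (born_space \<Delta> \<G> (tens (H F) V))" using s[OF F] by simp
    fix \<delta> assume \<delta>: "\<delta> \<in> \<Delta>"
    have "\<phi> (\<gamma>, \<delta>) \<in> carrier V" if "\<gamma> \<in> F" for \<gamma>
      using \<phi> F_sub[OF F] that \<delta> by (auto simp: carrier_born_space_iff)
    then have "fsum (tens (H F) V) (\<lambda>\<gamma>. pure (H F) V (e F \<gamma>) (\<phi> (\<gamma>, \<delta>))) F =
        fsum (tens (H F) V) (\<lambda>\<gamma>. pure (H F) V (e F \<gamma>) (q F \<gamma> (s F \<delta>))) F"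
      using \<phi>_eq[OF F _ \<delta>] coord_basis_in[OF b[OF F]]
      by (intro fsum_cong[OF vectorspace_tensor[OF H[OF F] V]])
         (auto intro!: pure_tensor_in[OF H[OF F] V])
    then show "pairing (H F) V (u F) \<phi> \<delta> = s F \<delta>"
      unfolding u_def pairing_generic[OF F H[OF F] b[OF F] V \<phi> \<delta>]
      using q_sum[OF F s\<delta>[OF F \<delta>]] by simp
  qed
  have "iso V \<phi> = \<eta>"
    using iso_in_Nat[OF V \<phi>, unfolded fobj_Hom] \<eta>N
  proof (rule Nat_eqI)
    fix W \<psi> assume W: "W \<in> Vect K elts" and \<psi>: "\<psi> \<in> carrier (fobj X W)"
    \<comment> \<open>With \<open>F\<close> the support of \<open>\<psi>\<close>, the linear map
      with values \<open>\<psi>\<close> on the basis carries the generic family to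
      \<open>\<psi>\<close>. Naturality of both transformations along it reduces the claim to
      \<open>pairing_u\<close>.\<close>
    define F where "F = {\<gamma>\<in>\<Gamma>. \<psi> \<gamma> \<noteq> \<zero>\<^bsub>W\<^esub>}"
    have F: "F \<in> \<F>" using \<psi> by (simp add: carrier_born_space_iff F_def)
    have \<psi>W: "\<psi> \<gamma> \<in> carrier W" if "\<gamma> \<in> F" for \<gamma>
      using \<psi> that by (simp add: carrier_born_space_iff F_def)
    define f where "f = lin_ext F (H F) (c F) W \<psi>"
    have f: "f \<in> carrier (Lin K (H F) W)"
      unfolding f_def using lin_ext_in_Lin[OF b[OF F] vs[OF W] \<psi>W] .
    have f_e: "f (e F \<gamma>) = \<psi> \<gamma>" if "\<gamma> \<in> F" for \<gamma>
      unfolding f_def using lin_ext_basis[OF b[OF F] vs[OF W] \<psi>W that] .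
    have f_zero: "f \<zero>\<^bsub>H F\<^esub> = \<zero>\<^bsub>W\<^esub>"
      using f module_hom_zero[OF vs[OF H[OF F]] vs[OF W]] by (simp add: carrier_Lin_iff)
    have \<psi>_eq: "farr X (H F) W f (u F) = \<psi>"
    proof (rule born_space_eqI[of _ \<Gamma> \<F> W])
      show "farr X (H F) W f (u F) \<in> carrier (born_space \<Gamma> \<F> W)"
        using vfunctor_farr_closed[OF is_vfunctor_X H[OF F] W f u[OF F]] by simp
      show "farr X (H F) W f (u F) \<gamma> = \<psi> \<gamma>" if "\<gamma> \<in> \<Gamma>" for \<gamma>
      proof -
        have "\<gamma> \<notin> F \<Longrightarrow> \<psi> \<gamma> = \<zero>\<^bsub>W\<^esub>" using that by (simp add: F_def)
        then have "f (u F \<gamma>) = \<psi> \<gamma>" using that by (simp add: u_def generic_def f_e f_zero)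
        then show ?thesis using that u[OF F] by (simp add: farr_born_functor)
      qed
    qed (use \<psi> in simp)
    have "pairing W V \<psi> \<phi> =
        farr Y (tens (H F) V) (tens W V) (tensor_map K elts (H F) V W V f (lin_id V)) (s F)"
      using pairing_natural[OF H[OF F] V W V f lin_id_in_Lin[OF vs[OF V]] u[OF F] \<phi>]
      by (simp only: \<psi>_eq farr_id_B[OF V \<phi>] pairing_u[OF F])
    also have "\<dots> = \<eta> W \<psi>" using \<eta>_u[OF F W f] by (simp only: \<psi>_eq)
    finally show "iso V \<phi> W \<psi> = \<eta> W \<psi>" by (simp only: iso_apply[OF V \<phi> W \<psi>])
  qed
  then show ?thesis using \<phi> by blast
qed

section \<open>Assembly of the isomorphism of Ind-objects\<close>

lemma iso_bij:
  assumes V: "V \<in> Vect K elts"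
  shows "bij_betw (iso V) (carrier (fobj B V)) (carrier (fobj Hom V))"
proof (rule bij_betw_imageI[OF iso_inj[OF V]])
  show "iso V ` carrier (fobj B V) = carrier (fobj Hom V)"
  proof (intro equalityI image_subsetI subsetI)
    show "iso V \<phi> \<in> carrier (fobj Hom V)" if "\<phi> \<in> carrier (fobj B V)" for \<phi>
      using iso_in_Nat[OF V that] .
    fix \<eta> assume "\<eta> \<in> carrier (fobj Hom V)"
    from iso_surj[OF V this] obtain \<phi> where \<phi>: "\<phi> \<in> carrier (fobj B V)" and "iso V \<phi> = \<eta>"
      by (elim bexE)
    from this(2)[symmetric] \<phi> show "\<eta> \<in> iso V ` carrier (fobj B V)" by (rule image_eqI)
  qed
qed

text \<open>Obtained only after bijectivity, since smallness of the space of natural transformations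
  is seen through its identification with families on
  \<open>\<Gamma> \<times> \<Delta>\<close>.\<close>

lemma is_vfunctor_Hom: "is_vfunctor K elts Hom"
proof (rule vfunctor_transport[where Y = B and \<epsilon> = iso])
  show "farr Hom V W f \<in> extensional (carrier (fobj Hom V))" for V W f
    by (simp add: ind_Hom_def)
qed (fact is_vfunctor_B iso_bij iso_zero iso_hom farr_Hom_iso)+

lemma iso_Nat: "iso \<in> carrier (Nat K elts B Hom)"
proof (rule NatI)
  show "iso \<in> extensional (Vect K elts)" by (simp add: iso_def)
  show "iso V \<in> carrier (Lin K (fobj B V) (fobj Hom V))" if "V \<in> Vect K elts" for V
    using iso_hom[OF that] that by (simp add: carrier_Lin_iff, simp add: iso_def)
qed (rule farr_Hom_iso[symmetric])

lemma ind_isomorphic_Hom: "ind_isomorphic K elts Hom B"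
  unfolding ind_isomorphic_def
proof (intro conjI)
  obtain I r H \<tau> \<kappa> where p: "ind_presentation K elts I r H \<tau> B \<kappa>"
    using ex_ind_presentation_born_functor[OF bornology_B small_B] by blast
  show "is_ind_object K elts B" using is_vfunctor_B p by (rule ind_presentation_is_ind_object)
  show "is_ind_object K elts Hom"
    using is_vfunctor_Hom ind_presentation_transport[OF p iso_Nat iso_bij]
    by (rule ind_presentation_is_ind_object)
  define \<zeta> where "\<zeta> = (\<lambda>V\<in>Vect K elts. \<lambda>\<eta>\<in>carrier (fobj Hom V). inv_into (carrier (fobj B V)) (iso V) \<eta>)"
  have \<zeta>_in: "inv_into (carrier (fobj B V)) (iso V) \<eta> \<in> carrier (fobj B V)"
    if "V \<in> Vect K elts" "\<eta> \<in> carrier (fobj Hom V)" for V \<eta>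
    using bij_betw_inv_into[OF iso_bij[OF that(1)]] that(2) by (auto simp: bij_betw_def)
  have iso_\<zeta>: "iso V (\<zeta> V \<eta>) = \<eta>" if "V \<in> Vect K elts" "\<eta> \<in> carrier (fobj Hom V)" for V \<eta>
    using bij_betw_inv_into_right[OF iso_bij[OF that(1)] that(2)] that by (simp add: \<zeta>_def)
  have \<zeta>_iso: "\<zeta> V (iso V \<phi>) = \<phi>" if "V \<in> Vect K elts" "\<phi> \<in> carrier (fobj B V)" for V \<phi>
    using bij_betw_inv_into_left[OF iso_bij[OF that(1)] that(2)] that iso_in_Nat[OF that]
    by (simp add: \<zeta>_def)
  have \<zeta>: "\<zeta> \<in> carrier (Nat K elts Hom B)"
  proof (rule NatI)
    show "\<zeta> \<in> extensional (Vect K elts)" by (simp add: \<zeta>_def)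
    show "\<zeta> V \<in> carrier (Lin K (fobj Hom V) (fobj B V))" if V: "V \<in> Vect K elts" for V
      using restrict_in_Lin[OF vfunctor_vectorspace[OF is_vfunctor_Hom V]
          module_hom_inverse[OF vfunctor_vectorspace[OF is_vfunctor_B V] iso_hom[OF V] iso_bij[OF V]]] V
      by (simp add: \<zeta>_def)
    fix V W f \<eta>
    assume V: "V \<in> Vect K elts" and W: "W \<in> Vect K elts" and f: "f \<in> carrier (Lin K V W)"
      and \<eta>: "\<eta> \<in> carrier (fobj Hom V)"
    have \<phi>: "\<zeta> V \<eta> \<in> carrier (fobj B V)" using \<zeta>_in[OF V \<eta>] V \<eta> by (simp add: \<zeta>_def)
    \<comment> \<open>Naturality of the inverse: \<open>\<eta>\<close> is rewritten as an image
      under \<open>iso\<close>, whose naturality then moves the arrow to the other side.\<close>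
    have "\<zeta> W (farr Hom V W f (iso V (\<zeta> V \<eta>))) = farr B V W f (\<zeta> V \<eta>)"
      unfolding farr_Hom_iso[OF V W f \<phi>]
      using \<zeta>_iso[OF W vfunctor_farr_closed[OF is_vfunctor_B V W f \<phi>]] .
    then show "\<zeta> W (farr Hom V W f \<eta>) = farr B V W f (\<zeta> V \<eta>)" by (simp only: iso_\<zeta>[OF V \<eta>])
  qed
  have "nat_comp K elts Hom iso \<zeta> = nat_id K elts Hom"
    using nat_comp_in_Nat[OF is_vfunctor_Hom \<zeta> iso_Nat] nat_id_in_Nat[OF is_vfunctor_Hom]
    by (rule Nat_eqI) (simp add: iso_\<zeta>)
  moreover have "nat_comp K elts B \<zeta> iso = nat_id K elts B"
    using nat_comp_in_Nat[OF is_vfunctor_B iso_Nat \<zeta>] nat_id_in_Nat[OF is_vfunctor_B]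
  proof (rule Nat_eqI)
    fix V \<phi> assume "V \<in> Vect K elts" "\<phi> \<in> carrier (fobj B V)"
    then show "nat_comp K elts B \<zeta> iso V \<phi> = nat_id K elts B V \<phi>"
      by (simp only: nat_comp_apply nat_id_apply \<zeta>_iso)
  qed
  ultimately show "\<exists>\<eta>\<in>carrier (Nat K elts Hom B). \<exists>\<epsilon>\<in>carrier (Nat K elts B Hom).
      nat_comp K elts Hom \<epsilon> \<eta> = nat_id K elts Hom \<and> nat_comp K elts B \<eta> \<epsilon> = nat_id K elts B"
    using \<zeta> iso_Nat by blast
qed

end

text \<open>\<open>ind_isomorphic\<close> asks for more than inverse natural transformations: both
  functors have to be Ind-objects. The first conjunct places the right-hand side among the functors
  of bornologies.\<close>

theorem proposition6p11:
  fixes K :: "'k ring" and elts :: "'u \<Rightarrow> 'u set"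
    and \<Gamma> :: "'a set" and \<F> :: "'a set set"
    and \<Delta> :: "'b set" and \<G> :: "'b set set"
  assumes "grothendieck_universe elts"
    and "field K" and "small elts (carrier K)"
    and "small elts \<Gamma>" and "small elts \<Delta>"
    and "bornology \<Gamma> \<F>" and "bornology \<Delta> \<G>"
  shows "bornology (\<Gamma> \<times> \<Delta>) (bornology_fun \<Gamma> \<F> \<Delta> \<G>) \<and>
    ind_isomorphic K elts
      (ind_Hom K elts (born_functor \<Gamma> \<F>) (born_functor \<Delta> \<G>))
      (born_functor (\<Gamma> \<times> \<Delta>) (bornology_fun \<Gamma> \<F> \<Delta> \<G>))"
proof -
  interpret bornological_pair elts K \<Gamma> \<F> \<Delta> \<G>
    using assms by (simp add: bornological_pair_def bornological_pair_axioms_def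
      vect_universe_def vect_universe_axioms_def)
  show ?thesis using bornology_B ind_isomorphic_Hom by blast
qed

end
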